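(* Let $T\in\mathcal{B}_n(\Omega)$. Then $T$ has a unique (IR) decomposition up to unitary equivalence. That is, if $T$ has the (IR) decomposition $T=\bigoplus_{i=1}^{t}T_i^{(m_i)}$ with $T_i\in\mathcal{B}_{n_i}(\Omega)$, then for any operator $\widetilde{T}$ unitarily equivalent to $T$ with (IR) decomposition $\widetilde{T}=\bigoplus_{i=1}^{s}\widetilde{T}_i^{(l_i)}$, $\widetilde{T}_i\in\mathcal{B}_{h_i}(\Omega)$, the following hold: (1) $t=s$; (2) there is a permutation $\pi$ of $\{1,2,\dots,t\}$ such that $T_i\sim_u\widetilde{T}_{\pi(i)}$ and $m_i=l_{\pi(i)}$ for all $1\le i\le t$.
   Context: Let $\Omega\subset\mathbb{C}$ be open and connected and $n$ a positive integer. For a complex separable Hilbert space $\mathcal{H}$, the Cowen-Douglas class $\mathcal{B}_n(\Omega)$ consists of bounded linear operators $T$ on $\mathcal{H}$ such that: (1) $\Omega\subset\sigma(T)$; (2) $\operatorname{ran}(T-\lambda)=\mathcal{H}$ for every $\lambda\in\Omega$; (3) the closed linear span of $\bigcup_{\lambda\in\Omega}\ker(T-\lambda)$ is $\mathcal{H}$; (4) $\dim\ker(T-\lambda)=n$ for every $\lambda\in\Omega$. Every $T\in\mathcal{B}_n(\Omega)$ is regarded, up to unitary equivalence, as the adjoint $M_z^*$ of multiplication by $z$ on a reproducing kernel Hilbert space of holomorphic $\mathbb{C}^n$-valued functions on $\Omega^*=\{\lambda:\overline\lambda\in\Omega\}$. $T\sim_u S$ means that $T$ and $S$ are unitarily equivalent: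 $UT=SU$ for some unitary $U$ between the underlying Hilbert spaces. A bounded operator is irreducible, written $T\in(IR)$, if it has no nontrivial reducing subspace (equivalently, its commutant contains no nontrivial self-adjoint idempotent). $T^{(m)}$ denotes the orthogonal direct sum of $m$ copies of $T$, and $\bigoplus$ denotes orthogonal direct sum. (IR) decomposition: for $T\in\mathcal{B}_n(\Omega)$, a decomposition $T=\bigoplus_{i=1}^{t}T_i^{(m_i)}$ with $T_i\in\mathcal{B}_{n_i}(\Omega)$ and $\sum_{i=1}^t m_in_i=n$ is called an (IR) decomposition if each $T_i\in(IR)$ and $T_i\not\sim_u T_j$ for $i\ne j$. *)

theory Defs
  imports
    "HOL-Analysis.Analysis"
    "HOL-Library.Function_Algebras"
    "HOL-Combinatorics.Permutations"
begin

section \<open>Complex vector spaces\<close>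

class complex_vector = ab_group_add +
  fixes scaleC :: "complex \<Rightarrow> 'a \<Rightarrow> 'a"  (infixr "*\<^sub>C" 75)
  assumes scaleC_add_right: "a *\<^sub>C (x + y) = a *\<^sub>C x + a *\<^sub>C y"
    and scaleC_add_left: "(a + b) *\<^sub>C x = a *\<^sub>C x + b *\<^sub>C x"
    and scaleC_scaleC: "a *\<^sub>C b *\<^sub>C x = (a * b) *\<^sub>C x"
    and scaleC_one: "1 *\<^sub>C x = x"

global_interpretation complex_vector: vector_space "scaleC :: complex \<Rightarrow> 'a \<Rightarrow> 'a::complex_vector"
  by unfold_locales (rule scaleC_add_right scaleC_add_left scaleC_scaleC scaleC_one)+

instantiation complex :: complex_vector
begin
definition scaleC_complex :: "complex \<Rightarrow> complex \<Rightarrow> complex"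
  where "scaleC_complex = (*)"
instance by standard (simp_all add: scaleC_complex_def algebra_simps)
end

instantiation "fun" :: (type, complex_vector) complex_vector
begin
definition scaleC_fun :: "complex \<Rightarrow> ('a \<Rightarrow> 'b) \<Rightarrow> 'a \<Rightarrow> 'b"
  where "scaleC_fun c f = (\<lambda>i. c *\<^sub>C f i)"
instance
  by standard (simp_all add: scaleC_fun_def fun_eq_iff scaleC_add_right scaleC_add_left
      scaleC_scaleC scaleC_one)
end


section \<open>Hilbert spaces\<close>

text \<open>
  A Hilbert space is a linear subspace \<open>hcarrier H\<close> of a complex vector space type, together with
  an inner product of its own (linear in the first argument). Only the values of \<open>hinner H\<close> on
  the carrier matter. Explicit carriers allow a finite family of different Hilbert spaces to be
  indexed by numbers, closed subspaces to be Hilbert spaces over the same type, and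
  direct sums to be formed in a function type.
\<close>

record 'a hilbert =
  hcarrier :: "'a set"
  hinner :: "'a \<Rightarrow> 'a \<Rightarrow> complex"

definition hnorm :: "'a hilbert \<Rightarrow> 'a \<Rightarrow> real"
  where "hnorm H x = sqrt (Re (hinner H x x))"

text \<open>The library locale \<open>Metric_space\<close> requires nonnegativity and symmetry of the distance
  also outside the carrier, hence the value 0 there.\<close>

definition hdist :: "'a::complex_vector hilbert \<Rightarrow> 'a \<Rightarrow> 'a \<Rightarrow> real"
  where "hdist H x y = (if x \<in> hcarrier H \<and> y \<in> hcarrier H then hnorm H (x - y) else 0)"

definition htopology :: "'a::complex_vector hilbert \<Rightarrow> 'a topology"
  where "htopology H = Metric_space.mtopology (hcarrier H) (hdist H)"

locale hilbert_space =
  fixes H :: "'a::complex_vector hilbert"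
  assumes subspace_carrier: "complex_vector.subspace (hcarrier H)"
    and inner_add_left: "\<lbrakk>x \<in> hcarrier H; y \<in> hcarrier H; z \<in> hcarrier H\<rbrakk>
          \<Longrightarrow> hinner H (x + y) z = hinner H x z + hinner H y z"
    and inner_scale_left: "\<lbrakk>x \<in> hcarrier H; y \<in> hcarrier H\<rbrakk>
          \<Longrightarrow> hinner H (c *\<^sub>C x) y = c * hinner H x y"
    and inner_commute: "\<lbrakk>x \<in> hcarrier H; y \<in> hcarrier H\<rbrakk>
          \<Longrightarrow> hinner H x y = cnj (hinner H y x)"
    and inner_nonneg: "x \<in> hcarrier H \<Longrightarrow> 0 \<le> Re (hinner H x x)"
    and inner_definite: "\<lbrakk>x \<in> hcarrier H; hinner H x x = 0\<rbrakk> \<Longrightarrow> x = 0"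
    and complete: "Metric_space.mcomplete (hcarrier H) (hdist H)"
    and separable: "separable_space (htopology H)"

definition ortho_complement :: "'a hilbert \<Rightarrow> 'a set \<Rightarrow> 'a set"
  where "ortho_complement H M = {x \<in> hcarrier H. \<forall>y\<in>M. hinner H x y = 0}"

text \<open>For finite index sets; the carrier consists of the families that vanish outside the index set.\<close>

definition hilbert_sum :: "'i set \<Rightarrow> ('i \<Rightarrow> 'a::complex_vector hilbert) \<Rightarrow> ('i \<Rightarrow> 'a) hilbert"
  where "hilbert_sum I H =
    \<lparr>hcarrier = {f. (\<forall>i\<in>I. f i \<in> hcarrier (H i)) \<and> (\<forall>i. i \<notin> I \<longrightarrow> f i = 0)},
     hinner = (\<lambda>f g. \<Sum>i\<in>I. hinner (H i) (f i) (g i))\<rparr>"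

definition hilbert_copies :: "nat \<Rightarrow> 'a::complex_vector hilbert \<Rightarrow> (nat \<Rightarrow> 'a) hilbert"
  where "hilbert_copies m H = hilbert_sum {1..m} (\<lambda>_. H)"


section \<open>Operators\<close>

text \<open>An operator is represented by a function of which only the values on the carrier of its
  domain matter.\<close>

definition linear_operator ::
    "'a::complex_vector hilbert \<Rightarrow> 'b::complex_vector hilbert \<Rightarrow> ('a \<Rightarrow> 'b) \<Rightarrow> bool"
  where "linear_operator H K T \<longleftrightarrow>
    (\<forall>x\<in>hcarrier H. T x \<in> hcarrier K) \<and>
    (\<forall>x\<in>hcarrier H. \<forall>y\<in>hcarrier H. T (x + y) = T x + T y) \<and>
    (\<forall>c. \<forall>x\<in>hcarrier H. T (c *\<^sub>C x) = c *\<^sub>C T x)"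

definition bounded_operator ::
    "'a::complex_vector hilbert \<Rightarrow> 'b::complex_vector hilbert \<Rightarrow> ('a \<Rightarrow> 'b) \<Rightarrow> bool"
  where "bounded_operator H K T \<longleftrightarrow>
    linear_operator H K T \<and> (\<exists>B. \<forall>x\<in>hcarrier H. hnorm K (T x) \<le> B * hnorm H x)"

definition operator_sum :: "'i set \<Rightarrow> ('i \<Rightarrow> 'a \<Rightarrow> 'a::complex_vector) \<Rightarrow> ('i \<Rightarrow> 'a) \<Rightarrow> 'i \<Rightarrow> 'a"
  where "operator_sum I T f = (\<lambda>i. if i \<in> I then T i (f i) else 0)"

definition operator_copies :: "nat \<Rightarrow> ('a \<Rightarrow> 'a::complex_vector) \<Rightarrow> (nat \<Rightarrow> 'a) \<Rightarrow> nat \<Rightarrow> 'a"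
  where "operator_copies m T = operator_sum {1..m} (\<lambda>_. T)"

definition unitary_operator ::
    "'a::complex_vector hilbert \<Rightarrow> 'b::complex_vector hilbert \<Rightarrow> ('a \<Rightarrow> 'b) \<Rightarrow> bool"
  where "unitary_operator H K U \<longleftrightarrow>
    linear_operator H K U \<and> bij_betw U (hcarrier H) (hcarrier K) \<and>
    (\<forall>x\<in>hcarrier H. \<forall>y\<in>hcarrier H. hinner K (U x) (U y) = hinner H x y)"

definition unitarily_equivalent ::
    "'a::complex_vector hilbert \<Rightarrow> ('a \<Rightarrow> 'a) \<Rightarrow> 'b::complex_vector hilbert \<Rightarrow> ('b \<Rightarrow> 'b) \<Rightarrow> bool"
  where "unitarily_equivalent H T K S \<longleftrightarrow>
    (\<exists>U. unitary_operator H K U \<and> (\<forall>x\<in>hcarrier H. U (T x) = S (U x)))"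

definition reducing_subspace :: "'a::complex_vector hilbert \<Rightarrow> ('a \<Rightarrow> 'a) \<Rightarrow> 'a set \<Rightarrow> bool"
  where "reducing_subspace H T M \<longleftrightarrow>
    M \<subseteq> hcarrier H \<and> complex_vector.subspace M \<and> closedin (htopology H) M \<and>
    T ` M \<subseteq> M \<and> T ` ortho_complement H M \<subseteq> ortho_complement H M"

definition irreducible_operator :: "'a::complex_vector hilbert \<Rightarrow> ('a \<Rightarrow> 'a) \<Rightarrow> bool"
  where "irreducible_operator H T \<longleftrightarrow>
    (\<forall>M. reducing_subspace H T M \<longrightarrow> M = {0} \<or> M = hcarrier H)"

definition operator_spectrum :: "'a::complex_vector hilbert \<Rightarrow> ('a \<Rightarrow> 'a) \<Rightarrow> complex set"
  where "operator_spectrum H T =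
    {\<mu>. \<not> (\<exists>R. bounded_operator H H R \<and>
              (\<forall>x\<in>hcarrier H. R (T x - \<mu> *\<^sub>C x) = x \<and> T (R x) - \<mu> *\<^sub>C R x = x))}"

definition eigenspace :: "'a::complex_vector hilbert \<Rightarrow> ('a \<Rightarrow> 'a) \<Rightarrow> complex \<Rightarrow> 'a set"
  where "eigenspace H T \<mu> = {x \<in> hcarrier H. T x - \<mu> *\<^sub>C x = 0}"


section \<open>The Cowen-Douglas class and (IR) decompositions\<close>

text \<open>The library dimension of an infinite-dimensional space is 0; as \<open>n\<close> is positive, the last
  condition below does imply that the eigenspaces are finite-dimensional.\<close>

definition cowen_douglas ::
    "complex set \<Rightarrow> nat \<Rightarrow> 'a::complex_vector hilbert \<Rightarrow> ('a \<Rightarrow> 'a) \<Rightarrow> bool"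
  where "cowen_douglas \<Omega> n H T \<longleftrightarrow>
    n > 0 \<and> hilbert_space H \<and> bounded_operator H H T \<and>
    \<Omega> \<subseteq> operator_spectrum H T \<and>
    (\<forall>\<mu>\<in>\<Omega>. (\<lambda>x. T x - \<mu> *\<^sub>C x) ` hcarrier H = hcarrier H) \<and>
    htopology H closure_of complex_vector.span (\<Union>\<mu>\<in>\<Omega>. eigenspace H T \<mu>) = hcarrier H \<and>
    (\<forall>\<mu>\<in>\<Omega>. complex_vector.dim (eigenspace H T \<mu>) = n)"

text \<open>
  \<open>IR_decomposition \<Omega> n H T t G S m d\<close>: the operator \<open>T\<close> on \<open>H\<close>, in the Cowen-Douglas class of
  rank \<open>n\<close>, is the orthogonal direct sum over \<open>1 \<le> i \<le> t\<close> of \<open>m i\<close> copies of the operator \<open>S i\<close>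
  on \<open>G i\<close>, which has rank \<open>d i\<close>. Since the direct sum is an external one, it is identified with
  \<open>T\<close> by a unitary. The multiplicities have to be positive: summands with multiplicity 0
  could be added at will.
\<close>

definition IR_decomposition ::
    "complex set \<Rightarrow> nat \<Rightarrow> 'a::complex_vector hilbert \<Rightarrow> ('a \<Rightarrow> 'a) \<Rightarrow>
     nat \<Rightarrow> (nat \<Rightarrow> 'b::complex_vector hilbert) \<Rightarrow> (nat \<Rightarrow> 'b \<Rightarrow> 'b) \<Rightarrow>
     (nat \<Rightarrow> nat) \<Rightarrow> (nat \<Rightarrow> nat) \<Rightarrow> bool"
  where "IR_decomposition \<Omega> n H T t G S m d \<longleftrightarrow>
    unitarily_equivalent H T
      (hilbert_sum {1..t} (\<lambda>i. hilbert_copies (m i) (G i)))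
      (operator_sum {1..t} (\<lambda>i. operator_copies (m i) (S i))) \<and>
    (\<forall>i\<in>{1..t}. m i > 0 \<and> cowen_douglas \<Omega> (d i) (G i) (S i) \<and>
                irreducible_operator (G i) (S i)) \<and>
    (\<Sum>i=1..t. m i * d i) = n \<and>
    (\<forall>i\<in>{1..t}. \<forall>j\<in>{1..t}. i \<noteq> j \<longrightarrow> \<not> unitarily_equivalent (G i) (S i) (G j) (S j))"

end

theory Submission
  imports Defs "HOL-Computational_Algebra.Fundamental_Theorem_Algebra"
begin

text \<open>
  Existence. Let \<open>M\<close> be a reducing subspace of a Cowen-Douglas operator \<open>T\<close> of rank \<open>n\<close>. At every point
  of \<open>\<Omega>\<close> the eigenspace of \<open>T\<close> is the orthogonal sum of its intersections with \<open>M\<close> and with the orthogonal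
  complement of \<open>M\<close>, so the two dimensions add up to \<open>n\<close>. Since \<open>T - \<mu>\<close> is surjective, the open mapping
  theorem lets eigenvectors for \<open>\<mu>\<close> be continued to eigenvectors for nearby points; hence neither of
  the two dimensions can drop near \<open>\<mu>\<close>. As their sum is constant, each of them is locally constant, and
  constant because \<open>\<Omega>\<close> is connected. So both restrictions of \<open>T\<close> are again of Cowen-Douglas class
  unless they act on the zero space (\<open>cowen_douglas_reducing\<close>). A nontrivial reducing subspace
  therefore has smaller rank, and induction on the rank first yields an irreducible restriction and
  then a full decomposition: the new irreducible summand either increases a multiplicity or becomes a
  new type (\<open>IR_decomposition_insert\<close>).
  
  Uniqueness. Two decompositions are compared by a unitary \<open>\<Phi>\<close> from one orthogonal sum of irreducible
  blocks to the other that intertwines the two operators. Each matrix entry of \<open>\<Phi>\<close> intertwines two blocks,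
  and its adjoint, being an entry of the inverse of \<open>\<Phi>\<close>, intertwines them in the other direction, without
  any recourse to the adjoints of the operators themselves. By Schur's lemma (\<open>schur_intertwiner\<close>)
  the entry is, up to a factor \<open>sqrt c\<close>, unitary, and it vanishes between blocks that are not
  unitarily equivalent. Schur's lemma usually needs spectral projections; here an eigenvector is found
  in a finite-dimensional eigenspace instead. Since \<open>\<Phi>\<close> is unitary, the numbers \<open>c\<close> form a matrix with row
  and column sums 1 that is supported on pairs of equivalent blocks. So every type on one side
  occurs on the other, and summing over the rectangle that belongs to a type in both
  orders gives equal multiplicities (\<open>block_matching\<close>).
\<close>

section \<open>Geometry of the inner product\<close>

context hilbert_space
begin

lemma zero_mem [simp]: "0 \<in> hcarrier H"
  using subspace_carrier complex_vector.subspace_0 by blast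

lemma add_mem [simp]: "x \<in> hcarrier H \<Longrightarrow> y \<in> hcarrier H \<Longrightarrow> x + y \<in> hcarrier H"
  using subspace_carrier complex_vector.subspace_add by blast

lemma scale_mem [simp]: "x \<in> hcarrier H \<Longrightarrow> c *\<^sub>C x \<in> hcarrier H"
  using subspace_carrier complex_vector.subspace_scale by blast

lemma diff_mem [simp]: "x \<in> hcarrier H \<Longrightarrow> y \<in> hcarrier H \<Longrightarrow> x - y \<in> hcarrier H"
  using subspace_carrier complex_vector.subspace_diff by blast

lemma neg_mem [simp]: "x \<in> hcarrier H \<Longrightarrow> - x \<in> hcarrier H"
  using subspace_carrier complex_vector.subspace_neg by blast

lemma inner_add_right:
  "\<lbrakk>x \<in> hcarrier H; y \<in> hcarrier H; z \<in> hcarrier H\<rbrakk> \<Longrightarrow> hinner H x (y + z) = hinner H x y + hinner H x z"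
  by (metis add_mem complex_cnj_add inner_add_left inner_commute)

lemma inner_scale_right:
  "\<lbrakk>x \<in> hcarrier H; y \<in> hcarrier H\<rbrakk> \<Longrightarrow> hinner H x (c *\<^sub>C y) = cnj c * hinner H x y"
  by (metis scale_mem complex_cnj_mult inner_scale_left inner_commute)

lemma inner_zero_left [simp]: "x \<in> hcarrier H \<Longrightarrow> hinner H 0 x = 0"
  using inner_scale_left[of 0 x 0] by simp

lemma inner_zero_right [simp]: "x \<in> hcarrier H \<Longrightarrow> hinner H x 0 = 0"
  using inner_scale_right[of x 0 0] by simp

lemma inner_diff_left:
  "\<lbrakk>x \<in> hcarrier H; y \<in> hcarrier H; z \<in> hcarrier H\<rbrakk> \<Longrightarrow> hinner H (x - y) z = hinner H x z - hinner H y z"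
  using inner_add_left[of "x - y" y z] by simp

lemma inner_diff_right:
  "\<lbrakk>x \<in> hcarrier H; y \<in> hcarrier H; z \<in> hcarrier H\<rbrakk> \<Longrightarrow> hinner H x (y - z) = hinner H x y - hinner H x z"
  using inner_add_right[of x "y - z" z] by simp

lemma hnorm_nonneg [simp]: "x \<in> hcarrier H \<Longrightarrow> 0 \<le> hnorm H x"
  using inner_nonneg by (simp add: hnorm_def)

lemma inner_self: "x \<in> hcarrier H \<Longrightarrow> hinner H x x = complex_of_real ((hnorm H x)\<^sup>2)"
  using inner_nonneg[of x] inner_commute[of x x]
  by (simp add: hnorm_def complex_eq_iff)

lemma hnorm_zero [simp]: "hnorm H 0 = 0"
  by (simp add: hnorm_def)

lemma hnorm_eq_0: "x \<in> hcarrier H \<Longrightarrow> hnorm H x = 0 \<longleftrightarrow> x = 0"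
  using inner_self[of x] inner_definite[of x] by auto

lemma hnorm_scale: "x \<in> hcarrier H \<Longrightarrow> hnorm H (c *\<^sub>C x) = cmod c * hnorm H x"
proof -
  assume x: "x \<in> hcarrier H"
  have "hinner H (c *\<^sub>C x) (c *\<^sub>C x) = complex_of_real ((cmod c)\<^sup>2) * hinner H x x"
    using x complex_norm_square[of c] by (simp add: inner_scale_left inner_scale_right)
  then have "(hnorm H (c *\<^sub>C x))\<^sup>2 = (cmod c * hnorm H x)\<^sup>2"
    using x by (simp add: inner_self power_mult_distrib flip: of_real_mult del: of_real_power)
  then show ?thesis using x by (simp add: power2_eq_iff_nonneg)
qed

lemma norm_add_sq:
  assumes "x \<in> hcarrier H" "y \<in> hcarrier H"
  shows "(hnorm H (x + y))\<^sup>2 = (hnorm H x)\<^sup>2 + (hnorm H y)\<^sup>2 + 2 * Re (hinner H x y)"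
proof -
  have "hinner H (x+y) (x+y) = hinner H x x + hinner H y y + hinner H x y + hinner H y x"
    using assms by (simp add: inner_add_left inner_add_right)
  then have "Re (hinner H (x+y) (x+y)) = (hnorm H x)\<^sup>2 + (hnorm H y)\<^sup>2 + 2 * Re (hinner H x y)"
    using assms inner_commute[of x y] by (simp add: inner_self del: of_real_power)
  then show ?thesis using assms by (simp add: inner_self del: of_real_power)
qed

lemma hnorm_minus [simp]: "x \<in> hcarrier H \<Longrightarrow> hnorm H (- x) = hnorm H x"
  using hnorm_scale[of x "-1"] by simp

lemma hnorm_diff_commute: "x \<in> hcarrier H \<Longrightarrow> y \<in> hcarrier H \<Longrightarrow> hnorm H (x - y) = hnorm H (y - x)"
  using hnorm_minus[of "x - y"] by simp

lemma norm_diff_sq: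
  assumes "x \<in> hcarrier H" "y \<in> hcarrier H"
  shows "(hnorm H (x - y))\<^sup>2 = (hnorm H x)\<^sup>2 + (hnorm H y)\<^sup>2 - 2 * Re (hinner H x y)"
  using norm_add_sq[of x "-y"] inner_scale_right[of x y "-1"] assms by simp

lemma parallelogram:
  assumes "x \<in> hcarrier H" "y \<in> hcarrier H"
  shows "(hnorm H (x + y))\<^sup>2 + (hnorm H (x - y))\<^sup>2 = 2 * (hnorm H x)\<^sup>2 + 2 * (hnorm H y)\<^sup>2"
  using norm_add_sq[OF assms] norm_diff_sq[OF assms] by simp

lemma cauchy_schwarz:
  assumes x: "x \<in> hcarrier H" and y: "y \<in> hcarrier H"
  shows "cmod (hinner H x y) \<le> hnorm H x * hnorm H y"
proof (cases "y = 0")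
  case True then show ?thesis using x by simp
next
  case False
  define a where "a = hinner H x y / hinner H y y"
  define z where "z = x - a *\<^sub>C y"
  have ny: "hinner H y y \<noteq> 0" "hnorm H y > 0"
    using False y inner_definite hnorm_eq_0[of y] hnorm_nonneg[of y] by (auto simp: less_le)
  have z: "z \<in> hcarrier H" using x y by (simp add: z_def)
  have "hinner H z y = 0" using x y ny by (simp add: z_def inner_diff_left inner_scale_left a_def)
  then have "(hnorm H (z + a *\<^sub>C y))\<^sup>2 = (hnorm H z)\<^sup>2 + (hnorm H (a *\<^sub>C y))\<^sup>2"
    using norm_add_sq[of z "a *\<^sub>C y"] z y by (simp add: inner_scale_right)
  then have "(hnorm H (a *\<^sub>C y))\<^sup>2 \<le> (hnorm H x)\<^sup>2" by (simp add: z_def)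
  then have "cmod a * hnorm H y \<le> hnorm H x"
    using x y by (simp add: hnorm_scale power2_le_iff_abs_le)
  then have "cmod a * hnorm H y * hnorm H y \<le> hnorm H x * hnorm H y"
    using ny by (simp add: mult_right_mono)
  moreover have "cmod (hinner H x y) = cmod a * hnorm H y * hnorm H y"
    using ny y unfolding a_def by (simp add: inner_self norm_divide norm_mult power2_eq_square)
  ultimately show ?thesis by simp
qed

lemma triangle_ineq:
  assumes x: "x \<in> hcarrier H" and y: "y \<in> hcarrier H"
  shows "hnorm H (x + y) \<le> hnorm H x + hnorm H y"
proof -
  have "Re (hinner H x y) \<le> hnorm H x * hnorm H y"
    using cauchy_schwarz[OF x y] complex_Re_le_cmod order_trans by blast
  then have "(hnorm H (x + y))\<^sup>2 \<le> (hnorm H x + hnorm H y)\<^sup>2"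
    using norm_add_sq[OF x y] by (simp add: power2_eq_square algebra_simps)
  then show ?thesis using x y by (simp add: power2_le_iff_abs_le)
qed

lemma triangle_diff:
  assumes "x \<in> hcarrier H" "y \<in> hcarrier H" "z \<in> hcarrier H"
  shows "hnorm H (x - z) \<le> hnorm H (x - y) + hnorm H (y - z)"
  using triangle_ineq[of "x - y" "y - z"] assms by simp

sublocale metric: Metric_space "hcarrier H" "hdist H"
  by unfold_locales
    (auto simp: hdist_def hnorm_diff_commute hnorm_eq_0 triangle_diff)

lemma htopology_eq: "htopology H = metric.mtopology"
  by (simp add: htopology_def)

lemma in_closure_iff: "x \<in> htopology H closure_of S \<longleftrightarrow>
    x \<in> hcarrier H \<and> (\<forall>r>0. \<exists>y\<in>S. y \<in> hcarrier H \<and> hnorm H (x - y) < r)"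
  unfolding htopology_eq metric.metric_closure_of by (auto simp: hdist_def)

lemma closure_absorb:
  assumes "closedin (htopology H) M" "x \<in> hcarrier H"
    "\<And>r. r > 0 \<Longrightarrow> \<exists>y\<in>M. y \<in> hcarrier H \<and> hnorm H (x - y) < r"
  shows "x \<in> M"
  using assms closure_of_closedin in_closure_iff by blast

lemma closedin_carrierI:
  assumes "M \<subseteq> hcarrier H"
    "\<And>x. \<lbrakk>x \<in> hcarrier H; \<And>r. r > 0 \<Longrightarrow> \<exists>y\<in>M. y \<in> hcarrier H \<and> hnorm H (x - y) < r\<rbrakk> \<Longrightarrow> x \<in> M"
  shows "closedin (htopology H) M"
proof -
  have "htopology H closure_of M \<subseteq> M" using assms(2) in_closure_iff by blast
  then show ?thesis using assms(1) closure_of_subset_eq[of M "htopology H"] by (simp add: htopology_eq)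
qed

lemma closedin_subset_carrier: "closedin (htopology H) M \<Longrightarrow> M \<subseteq> hcarrier H"
  using closedin_subset htopology_eq by fastforce

lemma cauchy_converges:
  assumes s: "\<And>n. s n \<in> hcarrier H"
    and C: "\<And>e::real. e > 0 \<Longrightarrow> \<exists>N. \<forall>m\<ge>N. \<forall>n\<ge>N. hnorm H (s m - s n) < e"
  obtains x where "x \<in> hcarrier H" "(\<lambda>n. hnorm H (s n - x)) \<longlonglongrightarrow> 0"
proof -
  have "metric.MCauchy s"
    unfolding metric.MCauchy_def using s C by (auto simp: hdist_def)
  then obtain x where x: "limitin metric.mtopology s x sequentially"
    using complete metric.mcomplete_def by blast
  then have xH: "x \<in> hcarrier H" using metric.limitin_mspace by blast
  have "\<exists>N. \<forall>n\<ge>N. norm (hnorm H (s n - x) - 0) < e" if "e > 0" for e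
    using x that s xH unfolding metric.limitin_metric eventually_sequentially
    by (simp add: hdist_def)
  then have "(\<lambda>n. hnorm H (s n - x)) \<longlonglongrightarrow> 0" by (rule LIMSEQ_I)
  then show ?thesis using that xH by blast
qed

lemma closed_limit:
  assumes M: "closedin (htopology H) M" and s: "\<And>n. s n \<in> M" and x: "x \<in> hcarrier H"
    and lim: "(\<lambda>n. hnorm H (s n - x)) \<longlonglongrightarrow> 0"
  shows "x \<in> M"
proof (rule closure_absorb[OF M x])
  fix r :: real assume "r > 0"
  then obtain n where "norm (hnorm H (s n - x) - 0) < r" using LIMSEQ_D[OF lim] by blast
  then show "\<exists>y\<in>M. y \<in> hcarrier H \<and> hnorm H (x - y) < r"
    using s[of n] closedin_subset_carrier[OF M] hnorm_diff_commute[of "s n" x] x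
    by (intro bexI[of _ "s n"]) auto
qed

section \<open>Orthogonal projections\<close>

text \<open>
  A minimizing sequence for the distance from \<open>x\<close> to \<open>M\<close> is Cauchy by the parallelogram law, as the
  midpoint of two of its members lies in \<open>M\<close> and is no closer to \<open>x\<close> than the infimum. At the limit \<open>m\<close>
  the remainder \<open>x - m\<close> is orthogonal to every \<open>y\<close> in \<open>M\<close>, since otherwise subtracting its component along \<open>y\<close>
  would bring it below the minimum.
\<close>

lemma projection_exists:
  assumes M: "complex_vector.subspace M" "closedin (htopology H) M" and x: "x \<in> hcarrier H"
  obtains m where "m \<in> M" "x - m \<in> ortho_complement H M"
proof -
  have MH: "m \<in> hcarrier H" if "m \<in> M" for m using closedin_subset_carrier[OF M(2)] that by blast
  define \<delta> where "\<delta> = (INF m\<in>M. (hnorm H (x - m))\<^sup>2)"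
  have M0: "0 \<in> M" using M(1) complex_vector.subspace_0 by blast
  have bdd: "bdd_below ((\<lambda>m. (hnorm H (x - m))\<^sup>2) ` M)" by (rule bdd_belowI[of _ 0]) auto
  have low: "\<delta> \<le> (hnorm H (x - m))\<^sup>2" if "m \<in> M" for m
    unfolding \<delta>_def using bdd that by (rule cINF_lower)
  have "\<exists>m\<in>M. (hnorm H (x - m))\<^sup>2 < \<delta> + e" if "e > 0" for e
    using cINF_less_iff[of M "\<lambda>m. (hnorm H (x - m))\<^sup>2" "\<delta> + e"] bdd M0 that
    unfolding \<delta>_def by auto
  then have "\<forall>n. \<exists>m\<in>M. (hnorm H (x - m))\<^sup>2 < \<delta> + inverse (real (Suc n))" by simp
  then obtain s where s: "\<And>n. s n \<in> M" "\<And>n. (hnorm H (x - s n))\<^sup>2 < \<delta> + inverse (real (Suc n))" by metis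
  have sH: "s n \<in> hcarrier H" for n using s(1) MH by blast
  have near: "(hnorm H (s i - s j))\<^sup>2 \<le> 2 * inverse (real (Suc i)) + 2 * inverse (real (Suc j))" for i j
  proof -
    define h where "h = (1/2) *\<^sub>C (s i + s j)"
    have hM: "h \<in> M" unfolding h_def
      using M(1) s(1) complex_vector.subspace_add complex_vector.subspace_scale by blast
    have two: "2 *\<^sub>C z = z + z" for z :: 'a using scaleC_add_left[of 1 1 z] by (simp add: scaleC_one)
    have e: "(x - s i) + (x - s j) = 2 *\<^sub>C (x - h)"
    proof -
      have "2 *\<^sub>C h = s i + s j" by (simp add: h_def scaleC_scaleC)
      then have "2 *\<^sub>C (x - h) = x + x - (s i + s j)"
        by (simp add: complex_vector.scale_right_diff_distrib two)
      then show ?thesis by simp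
    qed
    have "(hnorm H ((x - s i) + (x - s j)))\<^sup>2 + (hnorm H ((x - s i) - (x - s j)))\<^sup>2
        = 2 * (hnorm H (x - s i))\<^sup>2 + 2 * (hnorm H (x - s j))\<^sup>2"
      using parallelogram[of "x - s i" "x - s j"] x sH by simp
    moreover have "(hnorm H ((x - s i) + (x - s j)))\<^sup>2 = 4 * (hnorm H (x - h))\<^sup>2"
      unfolding e using x MH[OF hM] by (simp add: hnorm_scale power_mult_distrib)
    moreover have "hnorm H ((x - s i) - (x - s j)) = hnorm H (s i - s j)"
      using hnorm_diff_commute[of "s i" "s j"] sH by simp
    ultimately have "(hnorm H (s i - s j))\<^sup>2 = 2 * (hnorm H (x - s i))\<^sup>2 + 2 * (hnorm H (x - s j))\<^sup>2 - 4 * (hnorm H (x - h))\<^sup>2"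
      by simp
    then show ?thesis using low[OF hM] s(2)[of i] s(2)[of j] by simp
  qed
  obtain m where m: "m \<in> hcarrier H" "(\<lambda>n. hnorm H (s n - m)) \<longlonglongrightarrow> 0"
  proof (rule cauchy_converges[of s])
    show "s n \<in> hcarrier H" for n by (rule sH)
    fix e :: real assume e: "e > 0"
    obtain N where N: "inverse (real (Suc N)) < e\<^sup>2 / 4" using reals_Archimedean[of "e\<^sup>2/4"] e by auto
    have "hnorm H (s i - s j) < e" if "i \<ge> N" "j \<ge> N" for i j
    proof -
      have "inverse (real (Suc i)) \<le> inverse (real (Suc N))" "inverse (real (Suc j)) \<le> inverse (real (Suc N))"
        using that by (auto intro: le_imp_inverse_le)
      then have "(hnorm H (s i - s j))\<^sup>2 < e\<^sup>2" using near[of i j] N by linarith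
      then show ?thesis using e by (simp add: power2_less_imp_less)
    qed
    then show "\<exists>N. \<forall>i\<ge>N. \<forall>j\<ge>N. hnorm H (s i - s j) < e" by blast
  qed blast
  have mM: "m \<in> M" by (rule closed_limit[OF M(2) s(1) m])
  have min: "hnorm H (x - m) \<le> hnorm H (x - s n) + hnorm H (s n - m)" for n
    using triangle_diff x sH m(1) by blast
  have lim1: "(\<lambda>n. sqrt (\<delta> + inverse (real (Suc n))) + hnorm H (s n - m)) \<longlonglongrightarrow> sqrt (\<delta> + 0) + 0"
    using m(2) LIMSEQ_inverse_real_of_nat by (intro tendsto_intros)
  have "hnorm H (x - m) \<le> sqrt (\<delta> + 0) + 0"
  proof (rule LIMSEQ_le_const[OF lim1], intro exI allI impI)
    fix n
    have "hnorm H (x - s n) \<le> sqrt (\<delta> + inverse (real (Suc n)))"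
      using s(2)[of n] by (intro real_le_rsqrt) simp
    then show "hnorm H (x - m) \<le> sqrt (\<delta> + inverse (real (Suc n))) + hnorm H (s n - m)"
      using min[of n] by linarith
  qed
  then have "(hnorm H (x - m))\<^sup>2 \<le> (sqrt \<delta>)\<^sup>2"
    using x m(1) by (intro power_mono) auto
  moreover have "\<delta> \<ge> 0" unfolding \<delta>_def using M0 by (intro cINF_greatest) auto
  ultimately have md: "(hnorm H (x - m))\<^sup>2 \<le> \<delta>" by simp
  have "hinner H (x - m) y = 0" if y: "y \<in> M" for y
  proof (cases "y = 0")
    case True then show ?thesis using x m(1) by simp
  next
    case False
    have yH: "y \<in> hcarrier H" using MH y by blast
    have ny: "hinner H y y \<noteq> 0" using False inner_definite yH by blast
    define a where "a = hinner H (x - m) y / hinner H y y"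
    define z where "z = x - m - a *\<^sub>C y"
    have zH: "z \<in> hcarrier H" using x m(1) yH by (simp add: z_def)
    have "m + a *\<^sub>C y \<in> M" using mM y M(1) complex_vector.subspace_add complex_vector.subspace_scale by blast
    from low[OF this] have lz: "\<delta> \<le> (hnorm H z)\<^sup>2" by (simp add: z_def algebra_simps)
    have "hinner H z y = 0" using x m(1) yH ny by (simp add: z_def inner_diff_left inner_scale_left a_def)
    then have "(hnorm H (z + a *\<^sub>C y))\<^sup>2 = (hnorm H z)\<^sup>2 + (hnorm H (a *\<^sub>C y))\<^sup>2"
      using norm_add_sq[of z "a *\<^sub>C y"] zH yH by (simp add: inner_scale_right)
    moreover have "z + a *\<^sub>C y = x - m" by (simp add: z_def)
    ultimately have "(hnorm H (x - m))\<^sup>2 = (hnorm H z)\<^sup>2 + (hnorm H (a *\<^sub>C y))\<^sup>2" by simp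
    then have "(hnorm H (a *\<^sub>C y))\<^sup>2 \<le> 0" using lz md by linarith
    then have "hnorm H (a *\<^sub>C y) = 0" by simp
    then have "a *\<^sub>C y = 0" using hnorm_eq_0 yH by simp
    then have "a = 0" using False by simp
    then show ?thesis using ny by (simp add: a_def)
  qed
  then have "x - m \<in> ortho_complement H M" using x m(1) by (simp add: ortho_complement_def)
  then show thesis using that mM by blast
qed
end

section \<open>Closed subspaces as Hilbert spaces\<close>

text \<open>
  The orthogonal projection onto a closed subspace \<open>M\<close>; the choice is unique for \<open>x\<close> in the carrier
  of \<open>H\<close>.
\<close>

definition hproj :: "'a::complex_vector hilbert \<Rightarrow> 'a set \<Rightarrow> 'a \<Rightarrow> 'a"
  where "hproj H M x = (SOME m. m \<in> M \<and> x - m \<in> ortho_complement H M)"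

abbreviation hsub :: "'a hilbert \<Rightarrow> 'a set \<Rightarrow> 'a hilbert"
  where "hsub H M \<equiv> H\<lparr>hcarrier := M\<rparr>"

lemma hnorm_hsub [simp]: "hnorm (hsub H M) = hnorm H"
  by (simp add: hnorm_def fun_eq_iff)

context hilbert_space
begin

lemma subspace_ortho_complement:
  assumes "M \<subseteq> hcarrier H" shows "complex_vector.subspace (ortho_complement H M)"
  using assms by (intro complex_vector.subspaceI)
    (auto simp: ortho_complement_def inner_add_left inner_scale_left subset_iff)

lemma closedin_ortho_complement:
  assumes "M \<subseteq> hcarrier H" shows "closedin (htopology H) (ortho_complement H M)"
proof (rule closedin_carrierI)
  show "ortho_complement H M \<subseteq> hcarrier H" by (auto simp: ortho_complement_def)
  fix x assume x: "x \<in> hcarrier H"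
    and ap: "\<And>r. r > 0 \<Longrightarrow> \<exists>y\<in>ortho_complement H M. y \<in> hcarrier H \<and> hnorm H (x - y) < r"
  have "hinner H x m = 0" if m: "m \<in> M" for m
  proof (rule ccontr)
    assume ne: "hinner H x m \<noteq> 0"
    have mH: "m \<in> hcarrier H" using m assms by blast
    then have pos: "hnorm H m > 0" using ne x hnorm_eq_0[of m] hnorm_nonneg[of m] by (auto simp: less_le)
    obtain y where y: "y \<in> ortho_complement H M" "y \<in> hcarrier H"
      "hnorm H (x - y) < cmod (hinner H x m) / hnorm H m"
      using ap[of "cmod (hinner H x m) / hnorm H m"] ne pos by auto
    have "hinner H x m = hinner H (x - y) m"
      using y m mH x by (simp add: inner_diff_left ortho_complement_def)
    then have "cmod (hinner H x m) \<le> hnorm H (x - y) * hnorm H m"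
      using cauchy_schwarz[of "x - y" m] x y mH by simp
    also have "\<dots> < cmod (hinner H x m)" using y(3) pos by (simp add: field_simps)
    finally show False by simp
  qed
  then show "x \<in> ortho_complement H M" using x by (simp add: ortho_complement_def)
qed

lemma ortho_complement_Int:
  assumes "x \<in> M" "x \<in> ortho_complement H M" shows "x = 0"
  using assms inner_definite by (auto simp: ortho_complement_def)

lemma ortho_complement_subset: "ortho_complement H M \<subseteq> hcarrier H"
  by (auto simp: ortho_complement_def)

text \<open>
  Completeness comes from closedness. For separability, the orthogonal projection does not increase distances and
  fixes \<open>M\<close>, so it maps a countable dense set of \<open>H\<close> to a countable dense set of \<open>M\<close>.
\<close>

lemma hilbert_space_hsub:
  assumes M: "complex_vector.subspace M" "closedin (htopology H) M"
  shows "hilbert_space (hsub H M)"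
proof -
  have MH: "m \<in> hcarrier H" if "m \<in> M" for m using closedin_subset_carrier[OF M(2)] that by blast
  have Mdiff: "x - y \<in> M" if "x \<in> M" "y \<in> M" for x y
    using M(1) that complex_vector.subspace_diff by blast
  interpret S: Metric_space M "hdist (hsub H M)"
    by unfold_locales (auto simp: hdist_def MH Mdiff hnorm_diff_commute hnorm_eq_0 triangle_diff)
  have top: "htopology (hsub H M) = S.mtopology" by (simp add: htopology_def)
  have complete: "S.mcomplete"
    unfolding S.mcomplete_def
  proof (intro allI impI)
    fix s assume s: "S.MCauchy s"
    then have sM: "s n \<in> M" for n unfolding S.MCauchy_def by auto
    obtain x where x: "x \<in> hcarrier H" "(\<lambda>n. hnorm H (s n - x)) \<longlonglongrightarrow> 0"
    proof (rule cauchy_converges[of s])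
      show "s n \<in> hcarrier H" for n using sM MH by blast
      show "\<exists>N. \<forall>m\<ge>N. \<forall>n\<ge>N. hnorm H (s m - s n) < e" if "e > 0" for e
        using s that sM unfolding S.MCauchy_def by (simp add: hdist_def)
    qed blast
    have "x \<in> M" by (rule closed_limit[OF M(2) sM x])
    then have "limitin S.mtopology s x sequentially"
      using sM LIMSEQ_D[OF x(2)] x(1) MH
      unfolding S.limitin_metric eventually_sequentially by (simp add: hdist_def)
    then show "\<exists>x. limitin S.mtopology s x sequentially" by blast
  qed
  have separable: "separable_space S.mtopology"
  proof -
    obtain D where D: "countable D" "D \<subseteq> hcarrier H" "htopology H closure_of D = hcarrier H"
      using separable unfolding separable_space_def by (auto simp: htopology_eq)
    have "\<forall>x\<in>hcarrier H. \<exists>m. m \<in> M \<and> x - m \<in> ortho_complement H M"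
      using projection_exists[OF M] by metis
    then obtain p where p: "\<And>x. x \<in> hcarrier H \<Longrightarrow> p x \<in> M"
      "\<And>x. x \<in> hcarrier H \<Longrightarrow> x - p x \<in> ortho_complement H M" by metis
    have "S.mtopology closure_of (p ` D) = M"
    proof -
      have "\<exists>y\<in>p ` D. y \<in> S.mball x r" if x: "x \<in> M" and r: "r > 0" for x r
      proof -
        obtain y where y: "y \<in> D" "y \<in> hcarrier H" "hnorm H (x - y) < r"
          using D(3) in_closure_iff[of x D] MH[OF x] r by auto
        have "x - y = (x - p y) + - (y - p y)" by simp
        moreover have "hinner H (x - p y) (- (y - p y)) = 0"
          using p(2)[OF y(2)] p(1)[OF y(2)] Mdiff[OF x p(1)[OF y(2)]] MH[OF Mdiff[OF x p(1)[OF y(2)]]]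
            inner_commute[of "x - p y" "- (y - p y)"] inner_scale_left[of "y - p y" "x - p y" "-1"] MH y(2)
          by (auto simp: ortho_complement_def)
        ultimately have "(hnorm H (x - y))\<^sup>2 = (hnorm H (x - p y))\<^sup>2 + (hnorm H (y - p y))\<^sup>2"
          using norm_add_sq[of "x - p y" "- (y - p y)"] MH[OF x] MH[OF p(1)[OF y(2)]] y(2)
            hnorm_minus[of "y - p y"] by simp
        then have "(hnorm H (x - p y))\<^sup>2 \<le> (hnorm H (x - y))\<^sup>2" by simp
        then have "hnorm H (x - p y) \<le> hnorm H (x - y)"
          using MH[OF x] MH[OF p(1)[OF y(2)]] y(2) by (simp add: power2_le_iff_abs_le)
        then have "hnorm H (x - p y) < r" using y(3) by simp
        then show ?thesis using y(1) x p(1)[OF y(2)] by (intro bexI[of _ "p y"]) (auto simp: hdist_def)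
      qed
      then show ?thesis unfolding S.metric_closure_of by auto
    qed
    then show ?thesis unfolding separable_space_def
      using D(1,2) p(1) by (intro exI[of _ "p ` D"]) auto
  qed
  show ?thesis
    using complete separable M(1)
    by unfold_locales
      (simp_all add: top MH inner_add_left inner_scale_left inner_nonneg inner_definite inner_commute[symmetric])
qed

end

locale closed_subspace = hilbert_space H for H :: "'a::complex_vector hilbert" +
  fixes M :: "'a set"
  assumes subspace: "complex_vector.subspace M" and closed: "closedin (htopology H) M"
begin

sublocale sub: hilbert_space "hsub H M"
  by (rule hilbert_space_hsub[OF subspace closed])

lemma M_carrier [simp]: "x \<in> M \<Longrightarrow> x \<in> hcarrier H"
  using closedin_subset_carrier[OF closed] by blast

lemma M_subset: "M \<subseteq> hcarrier H" by auto

lemma M_closure_props: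
  "0 \<in> M" "x \<in> M \<Longrightarrow> y \<in> M \<Longrightarrow> x + y \<in> M" "x \<in> M \<Longrightarrow> y \<in> M \<Longrightarrow> x - y \<in> M" "x \<in> M \<Longrightarrow> c *\<^sub>C x \<in> M"
  using sub.zero_mem sub.add_mem sub.diff_mem sub.scale_mem by auto

lemma hproj_mem: assumes "x \<in> hcarrier H"
  shows "hproj H M x \<in> M" "x - hproj H M x \<in> ortho_complement H M"
proof -
  have "\<exists>m. m \<in> M \<and> x - m \<in> ortho_complement H M"
    using projection_exists[OF subspace closed assms] by metis
  from someI_ex[OF this] show "hproj H M x \<in> M" "x - hproj H M x \<in> ortho_complement H M"
    unfolding hproj_def by auto
qed

lemma hproj_carrier [simp]: "x \<in> hcarrier H \<Longrightarrow> hproj H M x \<in> hcarrier H"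
  using hproj_mem(1) by simp

lemma hproj_eqI: assumes "m \<in> M" "x - m \<in> ortho_complement H M" shows "hproj H M x = m"
proof -
  have x: "x \<in> hcarrier H" using assms ortho_complement_subset[of M] add_mem[of "x - m" m] by auto
  have "hproj H M x - m \<in> M" using hproj_mem(1)[OF x] assms(1) by (rule M_closure_props(3))
  moreover have "hproj H M x - m = (x - m) - (x - hproj H M x)" by simp
  then have "hproj H M x - m \<in> ortho_complement H M"
    using assms(2) hproj_mem(2)[OF x]
      complex_vector.subspace_diff[OF subspace_ortho_complement[OF M_subset]] by metis
  ultimately have "hproj H M x - m = 0" by (rule ortho_complement_Int)
  then show ?thesis by simp
qed

sublocale oc: hilbert_space "hsub H (ortho_complement H M)"
  by (rule hilbert_space_hsub[OF subspace_ortho_complement[OF M_subset] closedin_ortho_complement[OF M_subset]])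

lemma oc_props:
  "0 \<in> ortho_complement H M"
  "x \<in> ortho_complement H M \<Longrightarrow> y \<in> ortho_complement H M \<Longrightarrow> x + y \<in> ortho_complement H M"
  "x \<in> ortho_complement H M \<Longrightarrow> y \<in> ortho_complement H M \<Longrightarrow> x - y \<in> ortho_complement H M"
  "x \<in> ortho_complement H M \<Longrightarrow> c *\<^sub>C x \<in> ortho_complement H M"
  using oc.zero_mem oc.add_mem oc.diff_mem oc.scale_mem by auto

lemma oc_carrier: "x \<in> ortho_complement H M \<Longrightarrow> x \<in> hcarrier H"
  using ortho_complement_subset by blast

lemma hproj_add: assumes "x \<in> hcarrier H" "y \<in> hcarrier H"
  shows "hproj H M (x + y) = hproj H M x + hproj H M y"
proof (rule hproj_eqI)
  show "hproj H M x + hproj H M y \<in> M" using assms by (intro M_closure_props(2) hproj_mem(1))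
  have e: "x + y - (hproj H M x + hproj H M y) = (x - hproj H M x) + (y - hproj H M y)" by simp
  show "x + y - (hproj H M x + hproj H M y) \<in> ortho_complement H M"
    unfolding e by (rule oc_props(2)[OF hproj_mem(2)[OF assms(1)] hproj_mem(2)[OF assms(2)]])
qed

lemma hproj_scale: assumes "x \<in> hcarrier H"
  shows "hproj H M (c *\<^sub>C x) = c *\<^sub>C hproj H M x"
proof (rule hproj_eqI)
  show "c *\<^sub>C hproj H M x \<in> M" using assms by (intro M_closure_props(4) hproj_mem(1))
  have "c *\<^sub>C x - c *\<^sub>C hproj H M x = c *\<^sub>C (x - hproj H M x)"
    by (simp add: complex_vector.scale_right_diff_distrib)
  then show "c *\<^sub>C x - c *\<^sub>C hproj H M x \<in> ortho_complement H M"
    using oc_props(4)[OF hproj_mem(2)[OF assms]] by simp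
qed

lemma hproj_id: "x \<in> M \<Longrightarrow> hproj H M x = x"
  by (rule hproj_eqI) (simp_all add: oc_props(1))

lemma hproj_oc: "x \<in> ortho_complement H M \<Longrightarrow> hproj H M x = 0"
  by (rule hproj_eqI) (simp_all add: M_closure_props(1))

lemma hinner_M_oc: "x \<in> M \<Longrightarrow> y \<in> ortho_complement H M \<Longrightarrow> hinner H x y = 0"
  by (subst inner_commute) (auto simp: ortho_complement_def)

lemma hinner_split: assumes "x \<in> hcarrier H" "y \<in> hcarrier H"
  shows "hinner H x y = hinner H (hproj H M x) (hproj H M y)
    + hinner H (x - hproj H M x) (y - hproj H M y)"
proof -
  let ?p = "hproj H M"
  have expand: "hinner H (a + b) (c + d) = hinner H a c + hinner H b d + hinner H a d + hinner H b c"
    if "a \<in> hcarrier H" "b \<in> hcarrier H" "c \<in> hcarrier H" "d \<in> hcarrier H" for a b c d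
    using that by (simp add: inner_add_left inner_add_right)
  have "hinner H x y = hinner H (?p x) (?p y) + hinner H (x - ?p x) (y - ?p y)
     + hinner H (?p x) (y - ?p y) + hinner H (x - ?p x) (?p y)"
    using expand[of "?p x" "x - ?p x" "?p y" "y - ?p y"] assms by simp
  moreover have "hinner H (?p x) (y - ?p y) = 0"
    using assms by (intro hinner_M_oc hproj_mem)
  moreover have "hinner H (x - ?p x) (?p y) = 0"
    using hproj_mem(2)[OF assms(1)] hproj_mem(1)[OF assms(2)] unfolding ortho_complement_def by blast
  ultimately show ?thesis by simp
qed

lemma hnorm_split: assumes "x \<in> hcarrier H"
  shows "(hnorm H x)\<^sup>2 = (hnorm H (hproj H M x))\<^sup>2 + (hnorm H (x - hproj H M x))\<^sup>2"
proof -
  let ?p = "hproj H M x"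
  have p: "?p \<in> M" "x - ?p \<in> ortho_complement H M" using hproj_mem[OF assms] by auto
  have "(hnorm H (?p + (x - ?p)))\<^sup>2 = (hnorm H ?p)\<^sup>2 + (hnorm H (x - ?p))\<^sup>2 + 2 * Re (hinner H ?p (x - ?p))"
    by (rule norm_add_sq[OF M_carrier[OF p(1)] oc_carrier[OF p(2)]])
  moreover have "?p + (x - ?p) = x" by simp
  ultimately show ?thesis unfolding hinner_M_oc[OF p] by simp
qed

lemma hnorm_hproj_le: assumes "x \<in> hcarrier H"
  shows "hnorm H (hproj H M x) \<le> hnorm H x" "hnorm H (x - hproj H M x) \<le> hnorm H x"
proof -
  have "(hnorm H (hproj H M x))\<^sup>2 \<le> (hnorm H x)\<^sup>2"
    unfolding hnorm_split[OF assms] by simp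
  then show "hnorm H (hproj H M x) \<le> hnorm H x"
    by (rule power2_le_imp_le) (rule hnorm_nonneg[OF assms])
  have "(hnorm H (x - hproj H M x))\<^sup>2 \<le> (hnorm H x)\<^sup>2"
    unfolding hnorm_split[OF assms] by simp
  then show "hnorm H (x - hproj H M x) \<le> hnorm H x"
    by (rule power2_le_imp_le) (rule hnorm_nonneg[OF assms])
qed

lemma ortho_complement_twice: "ortho_complement H (ortho_complement H M) = M"
proof
  show "M \<subseteq> ortho_complement H (ortho_complement H M)"
  proof
    fix x assume x: "x \<in> M"
    show "x \<in> ortho_complement H (ortho_complement H M)"
      unfolding ortho_complement_def[of H "ortho_complement H M"]
      using M_carrier[OF x] hinner_M_oc[OF x] by simp
  qed
  show "ortho_complement H (ortho_complement H M) \<subseteq> M"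
  proof
    fix x assume x: "x \<in> ortho_complement H (ortho_complement H M)"
    then have xH: "x \<in> hcarrier H" by (simp add: ortho_complement_def)
    let ?z = "x - hproj H M x"
    have z: "?z \<in> ortho_complement H M" using hproj_mem(2) xH by blast
    have "hinner H x ?z = 0" using x z by (simp add: ortho_complement_def)
    moreover have "hinner H (hproj H M x) ?z = 0" using xH by (intro hinner_M_oc hproj_mem)
    ultimately have "hinner H ?z ?z = 0" using xH by (simp add: inner_diff_left)
    then have "?z = 0" using inner_definite[of ?z] xH by simp
    then show "x \<in> M" using hproj_mem(1)[OF xH] by simp
  qed
qed

lemma ortho_complement_trivial: "ortho_complement H M = {0} \<longleftrightarrow> M = hcarrier H"
proof
  assume *: "ortho_complement H M = {0}"
  have "x \<in> M" if "x \<in> hcarrier H" for x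
    using hproj_mem[OF that] * by simp
  then show "M = hcarrier H" using M_subset by blast
next
  assume "M = hcarrier H"
  then have "x = 0" if "x \<in> ortho_complement H M" for x
    using ortho_complement_Int[of x M] oc_carrier[OF that] that \<open>M = hcarrier H\<close> by blast
  then show "ortho_complement H M = {0}" using oc_props(1) by blast
qed

lemma closed_subspace_oc: "closed_subspace H (ortho_complement H M)"
  by unfold_locales
    (rule subspace_ortho_complement[OF M_subset] closedin_ortho_complement[OF M_subset])+

lemma hproj_complement: "x \<in> hcarrier H \<Longrightarrow> hproj H (ortho_complement H M) x = x - hproj H M x"
  by (rule closed_subspace.hproj_eqI[OF closed_subspace_oc])
    (simp_all add: hproj_mem ortho_complement_twice)

end

section \<open>Open mapping theorem and continuation of eigenvectors\<close>

lemma linear_operatorD: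
  assumes "linear_operator H K T"
  shows "x \<in> hcarrier H \<Longrightarrow> T x \<in> hcarrier K"
    "x \<in> hcarrier H \<Longrightarrow> y \<in> hcarrier H \<Longrightarrow> T (x + y) = T x + T y"
    "x \<in> hcarrier H \<Longrightarrow> T (c *\<^sub>C x) = c *\<^sub>C T x"
  using assms by (auto simp: linear_operator_def)

lemma (in hilbert_space) linear_operator_diff:
  assumes T: "linear_operator H K T" and "x \<in> hcarrier H" "y \<in> hcarrier H"
  shows "T (x - y) = T x - T y"
  using linear_operatorD(2)[OF T, of "x - y" y] assms by simp

lemma (in hilbert_space) linear_operator_zero: "linear_operator H K T \<Longrightarrow> T 0 = 0"
  using linear_operatorD(3)[of H K T 0 0] by simp

lemma bounded_operator_linear: "bounded_operator H K T \<Longrightarrow> linear_operator H K T"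
  by (simp add: bounded_operator_def)

lemma (in hilbert_space) bounded_operator_bound:
  assumes "bounded_operator H K T"
  obtains B where "B > 0" "\<And>x. x \<in> hcarrier H \<Longrightarrow> hnorm K (T x) \<le> B * hnorm H x"
proof -
  obtain B where B: "\<forall>x\<in>hcarrier H. hnorm K (T x) \<le> B * hnorm H x"
    using assms by (auto simp: bounded_operator_def)
  show thesis
  proof (rule that[of "\<bar>B\<bar> + 1"])
    fix x assume x: "x \<in> hcarrier H"
    have "B * hnorm H x \<le> (\<bar>B\<bar> + 1) * hnorm H x"
      using hnorm_nonneg[OF x] by (intro mult_right_mono) auto
    then show "hnorm K (T x) \<le> (\<bar>B\<bar> + 1) * hnorm H x" using B x by fastforce
  qed simp
qed

text \<open>
  The open mapping theorem, in the form of a linear bound on some preimage. The closures of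
  the images of the balls of integer radius cover \<open>K\<close>, so by Baire's theorem one of them contains a
  ball. Hence every \<open>y\<close> is the image of a vector of controlled norm up to an error of at most half
  its norm; applying this to the error again and again gives a convergent series of preimages.
\<close>

lemma open_mapping_bound:
  fixes H :: "'a::complex_vector hilbert" and K :: "'b::complex_vector hilbert"
  assumes "hilbert_space H" "hilbert_space K" and A: "bounded_operator H K A"
    and surj: "A ` hcarrier H = hcarrier K"
  obtains C where "C > 0" "\<And>y. y \<in> hcarrier K \<Longrightarrow> \<exists>x\<in>hcarrier H. A x = y \<and> hnorm H x \<le> C * hnorm K y"
proof -
  interpret H: hilbert_space H by fact
  interpret K: hilbert_space K by fact
  note lin = bounded_operator_linear[OF A]
  note Amem = linear_operatorD(1)[OF lin]
  obtain B where B: "B > 0" "\<And>x. x \<in> hcarrier H \<Longrightarrow> hnorm K (A x) \<le> B * hnorm H x"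
    using H.bounded_operator_bound[OF A] by blast
  define F where "F n = htopology K closure_of (A ` {x \<in> hcarrier H. hnorm H x \<le> real n})" for n
  have FK: "F n \<subseteq> hcarrier K" for n by (auto simp: F_def K.in_closure_iff)
  have cover: "\<Union>(range F) = hcarrier K"
  proof
    show "hcarrier K \<subseteq> \<Union>(range F)"
    proof
      fix y assume y: "y \<in> hcarrier K"
      then have "y \<in> A ` hcarrier H" using surj by simp
      then obtain x where x: "x \<in> hcarrier H" "A x = y" by blast
      obtain n where "hnorm H x \<le> real n" using real_arch_simple by blast
      then have "y \<in> A ` {x \<in> hcarrier H. hnorm H x \<le> real n}" using x by blast
      moreover have "A ` {x \<in> hcarrier H. hnorm H x \<le> real n} \<subseteq> F n"
        unfolding F_def using Amem by (intro closure_of_subset) (auto simp: K.htopology_eq)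
      ultimately show "y \<in> \<Union>(range F)" by blast
    qed
  qed (use FK in blast)
  obtain n where n: "K.metric.mtopology interior_of (F n) \<noteq> {}"
  proof (rule ccontr)
    assume "\<not> thesis"
    then have e: "K.metric.mtopology interior_of (F n) = {}" for n using that by blast
    have "K.metric.mtopology interior_of \<Union>(range F) = {}"
    proof (rule K.metric.metric_Baire_category_alt[OF K.complete])
      show "countable (range F)" by simp
      show "closedin K.metric.mtopology T \<and> K.metric.mtopology interior_of T = {}" if "T \<in> range F" for T
        using that e by (auto simp: F_def K.htopology_eq)
    qed
    then have "hcarrier K = {}" using cover interior_of_topspace[of K.metric.mtopology] by simp
    then show False using K.zero_mem by blast
  qed
  then obtain y0 \<epsilon> where y0: "y0 \<in> hcarrier K" "\<epsilon> > 0" "K.metric.mball y0 \<epsilon> \<subseteq> F n"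
    unfolding K.metric.metric_interior_of by blast
  have approx: "\<exists>x\<in>hcarrier H. hnorm H x \<le> 2 * real n \<and> hnorm K (y - A x) < r"
    if y: "y \<in> hcarrier K" "hnorm K y < \<epsilon>" and r: "r > 0" for y r
  proof -
    have "y0 + y \<in> F n" "y0 \<in> F n"
      using y0 y by (auto intro!: subsetD[OF y0(3)] simp: hdist_def K.hnorm_minus)
    then obtain x1 x2 where x: "x1 \<in> hcarrier H" "hnorm H x1 \<le> real n" "hnorm K (y0 + y - A x1) < r/2"
      "x2 \<in> hcarrier H" "hnorm H x2 \<le> real n" "hnorm K (y0 - A x2) < r/2"
      unfolding F_def K.in_closure_iff using r by (fastforce dest!: spec[of _ "r/2"])
    have "hnorm H (x1 - x2) \<le> 2 * real n"
      using H.triangle_ineq[of x1 "- x2"] x by simp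
    moreover have e: "y - A (x1 - x2) = (y0 + y - A x1) + - (y0 - A x2)"
      using H.linear_operator_diff[OF lin] x by simp
    have "hnorm K (y - A (x1 - x2)) \<le> hnorm K (y0 + y - A x1) + hnorm K (- (y0 - A x2))"
      unfolding e using x y y0 Amem by (intro K.triangle_ineq) auto
    then have "hnorm K (y - A (x1 - x2)) < r"
      using x y0 Amem K.hnorm_minus[of "y0 - A x2"] by simp
    ultimately show ?thesis using x by (intro bexI[of _ "x1 - x2"]) auto
  qed
  \<comment> \<open>A vector of norm \<open>\<epsilon> / 2\<close> is approximated within \<open>\<epsilon> / 4\<close> by the image of a vector of
    norm at most \<open>2 * n\<close>; \<open>D\<close> is the quotient of \<open>2 * n\<close> and \<open>\<epsilon> / 2\<close>.\<close>
  define D where "D = 4 * real n / \<epsilon>"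
  have D0: "D \<ge> 0" using y0 by (simp add: D_def)
  have half: "\<exists>x\<in>hcarrier H. hnorm H x \<le> D * hnorm K y \<and> hnorm K (y - A x) \<le> hnorm K y / 2"
    if y: "y \<in> hcarrier K" for y
  proof (cases "y = 0")
    case True
    then show ?thesis using H.linear_operator_zero[OF lin] by (intro bexI[of _ 0]) auto
  next
    case False
    then have ny: "hnorm K y > 0" using K.hnorm_nonneg[OF y] K.hnorm_eq_0[OF y] by simp
    define t where "t = \<epsilon> / (2 * hnorm K y)"
    have t: "t > 0" using y0 ny by (simp add: t_def)
    let ?t = "complex_of_real t" and ?s = "complex_of_real (1/t)"
    have "hnorm K (?t *\<^sub>C y) = \<epsilon> / 2" using y t ny by (simp add: K.hnorm_scale) (simp add: t_def)
    then obtain x where x: "x \<in> hcarrier H" "hnorm H x \<le> 2 * real n" "hnorm K (?t *\<^sub>C y - A x) < \<epsilon> / 4"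
      using approx[of "?t *\<^sub>C y" "\<epsilon>/4"] y y0 by auto
    have e: "y - A (?s *\<^sub>C x) = ?s *\<^sub>C (?t *\<^sub>C y - A x)"
      using t x linear_operatorD(3)[OF lin]
      by (simp add: complex_vector.scale_right_diff_distrib scaleC_scaleC scaleC_one flip: of_real_mult)
    have "hnorm K (y - A (?s *\<^sub>C x)) = (1/t) * hnorm K (?t *\<^sub>C y - A x)"
      unfolding e using x y t Amem by (subst K.hnorm_scale) (auto simp: norm_divide)
    also have "\<dots> \<le> (1/t) * (\<epsilon> / 4)" using x t by (intro mult_left_mono) auto
    also have "\<dots> = hnorm K y / 2" using y0 ny by (simp add: t_def)
    finally have 1: "hnorm K (y - A (?s *\<^sub>C x)) \<le> hnorm K y / 2" .
    have "hnorm H (?s *\<^sub>C x) = (1/t) * hnorm H x" using x t by (subst H.hnorm_scale) (auto simp: norm_divide)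
    also have "\<dots> \<le> (1/t) * (2 * real n)" using x t by (intro mult_left_mono) auto
    also have "\<dots> = D * hnorm K y" using y0 ny by (simp add: t_def D_def)
    finally show ?thesis using 1 x by (intro bexI[of _ "?s *\<^sub>C x"]) auto
  qed
  then obtain g where g: "\<And>y. y \<in> hcarrier K \<Longrightarrow> g y \<in> hcarrier H"
    "\<And>y. y \<in> hcarrier K \<Longrightarrow> hnorm H (g y) \<le> D * hnorm K y"
    "\<And>y. y \<in> hcarrier K \<Longrightarrow> hnorm K (y - A (g y)) \<le> hnorm K y / 2" by metis
  have "\<exists>x\<in>hcarrier H. A x = y \<and> hnorm H x \<le> 2 * D * hnorm K y" if y: "y \<in> hcarrier K" for y
  proof -
    define ys where "ys k = ((\<lambda>z. z - A (g z)) ^^ k) y" for k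
    have ysS: "ys (Suc k) = ys k - A (g (ys k))" for k by (simp add: ys_def)
    have ysK: "ys k \<in> hcarrier K" for k
    proof (induction k)
      case 0 then show ?case using y by (simp add: ys_def)
    next
      case (Suc k) then show ?case unfolding ysS using Amem g(1) by auto
    qed
    have ysn: "hnorm K (ys k) \<le> hnorm K y / 2 ^ k" for k
    proof (induction k)
      case 0 then show ?case by (simp add: ys_def)
    next
      case (Suc k)
      have "hnorm K (ys (Suc k)) \<le> hnorm K (ys k) / 2" unfolding ysS using g(3) ysK by blast
      also have "\<dots> \<le> (hnorm K y / 2 ^ k) / 2" using Suc by simp
      finally show ?case by simp
    qed
    define xs where "xs k = (\<Sum>i<k. g (ys i))" for k
    have xsH: "xs k \<in> hcarrier H" for k
      unfolding xs_def using g(1) ysK H.subspace_carrier by (intro complex_vector.subspace_sum) auto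
    have xsS: "xs (Suc k) = xs k + g (ys k)" for k by (simp add: xs_def)
    have Axs: "A (xs k) = y - ys k" for k
    proof (induction k)
      case 0 then show ?case using H.linear_operator_zero[OF lin] by (simp add: xs_def ys_def)
    next
      case (Suc k)
      then show ?case unfolding xsS ysS using linear_operatorD(2)[OF lin] xsH g(1) ysK by simp
    qed
    let ?c = "2 * D * hnorm K y"
    have c0: "?c \<ge> 0" using D0 y by simp
    \<comment> \<open>The telescoping form of the bound makes the induction on \<open>j\<close> exact.\<close>
    have tail: "hnorm H (xs (k + j) - xs k) \<le> ?c * (1 / 2 ^ k - 1 / 2 ^ (k + j))" for k j
    proof (induction j)
      case 0 then show ?case by simp
    next
      case (Suc j)
      have "hnorm H (xs (k + Suc j) - xs k) \<le> hnorm H (xs (k + Suc j) - xs (k+j)) + hnorm H (xs (k + j) - xs k)"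
        by (intro H.triangle_diff xsH)
      also have "hnorm H (xs (k + Suc j) - xs (k + j)) \<le> D * hnorm K (ys (k + j))"
        using xsS[of "k+j"] g(2)[OF ysK] by simp
      also have "\<dots> \<le> D * (hnorm K y / 2 ^ (k + j))" using D0 ysn by (intro mult_left_mono)
      also have "\<dots> = ?c * (1 / 2 ^ (k + j) - 1 / 2 ^ (k + Suc j))" by (simp add: field_simps)
      finally show ?case using Suc unfolding right_diff_distrib by linarith
    qed
    have tail': "hnorm H (xs m - xs k) \<le> ?c / 2 ^ k" if "k \<le> m" for k m
    proof -
      have "hnorm H (xs m - xs k) \<le> ?c * (1 / 2 ^ k - 1 / 2 ^ m)" using tail[of k "m - k"] that by simp
      also have "\<dots> \<le> ?c * (1 / 2 ^ k)" using c0 by (intro mult_left_mono) auto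
      finally show ?thesis by simp
    qed
    have lim0: "(\<lambda>k. a / 2 ^ k) \<longlonglongrightarrow> 0" for a :: real
      using tendsto_mult_right_zero[OF LIMSEQ_inverse_realpow_zero[of 2], of a]
      by (simp add: field_simps)
    obtain x where x: "x \<in> hcarrier H" "(\<lambda>k. hnorm H (xs k - x)) \<longlonglongrightarrow> 0"
    proof (rule H.cauchy_converges[of xs])
      show "xs k \<in> hcarrier H" for k by (rule xsH)
      fix e :: real assume "e > 0"
      then obtain N where "norm (?c / 2 ^ N - 0) < e / 2"
        using LIMSEQ_D[OF lim0[of ?c], of "e/2"] by auto
      then have N: "?c / 2 ^ N < e / 2" by (metis abs_ge_self diff_zero le_less_trans real_norm_def)
      have "hnorm H (xs i - xs j) < e" if "i \<ge> N" "j \<ge> N" for i j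
        using tail'[OF that(1)] tail'[OF that(2)] N H.triangle_diff[OF xsH[of i] xsH[of N] xsH[of j]]
          H.hnorm_diff_commute[OF xsH[of N] xsH[of j]] by linarith
      then show "\<exists>N. \<forall>i\<ge>N. \<forall>j\<ge>N. hnorm H (xs i - xs j) < e" by blast
    qed blast
    have "hnorm K (A x - y) \<le> 0"
    proof (rule LIMSEQ_le_const)
      show "(\<lambda>k. B * hnorm H (xs k - x) + hnorm K y / 2 ^ k) \<longlonglongrightarrow> 0"
        using tendsto_add[OF tendsto_mult_left[OF x(2), of B] lim0[of "hnorm K y"]] by simp
      show "\<exists>N. \<forall>k\<ge>N. hnorm K (A x - y) \<le> B * hnorm H (xs k - x) + hnorm K y / 2 ^ k"
      proof (intro exI allI impI)
        fix k
        have "hnorm K (A x - y) \<le> hnorm K (A x - A (xs k)) + hnorm K (A (xs k) - y)"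
          using Amem x xsH y by (intro K.triangle_diff) auto
        also have "A x - A (xs k) = A (x - xs k)" using H.linear_operator_diff[OF lin] x xsH by simp
        also have "hnorm K (A (x - xs k)) \<le> B * hnorm H (x - xs k)" using B x xsH by simp
        also have "A (xs k) - y = - ys k" by (simp add: Axs)
        also have "hnorm K (- ys k) \<le> hnorm K y / 2 ^ k" using ysn ysK by simp
        finally show "hnorm K (A x - y) \<le> B * hnorm H (xs k - x) + hnorm K y / 2 ^ k"
          using H.hnorm_diff_commute x xsH by simp
      qed
    qed
    moreover have AxyK: "A x - y \<in> hcarrier K" using Amem x(1) y by simp
    ultimately have "A x - y = 0"
      using K.hnorm_eq_0[OF AxyK] K.hnorm_nonneg[OF AxyK] by linarith
    moreover have "hnorm H x \<le> ?c"
    proof (rule LIMSEQ_le_const)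
      show "(\<lambda>k. hnorm H (xs k - x) + ?c) \<longlonglongrightarrow> ?c"
        using tendsto_add[OF x(2) tendsto_const[of ?c]] by simp
      show "\<exists>N. \<forall>k\<ge>N. hnorm H x \<le> hnorm H (xs k - x) + ?c"
      proof (intro exI allI impI)
        fix k
        have "hnorm H x \<le> hnorm H (x - xs k) + hnorm H (xs k)"
          using H.triangle_ineq[of "x - xs k" "xs k"] x xsH by simp
        then show "hnorm H x \<le> hnorm H (xs k - x) + ?c"
          using tail'[of 0 k] H.hnorm_diff_commute[OF x(1) xsH[of k]] by (simp add: xs_def)
      qed
    qed
    ultimately show ?thesis using x by auto
  qed
  moreover have "2 * D * hnorm K y \<le> (2 * D + 1) * hnorm K y" if "y \<in> hcarrier K" for y
    using that by (intro mult_right_mono) auto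
  ultimately show thesis using D0 by (intro that[of "2 * D + 1"]) (auto, meson order_trans)
qed

lemma linear_operator_shift:
  assumes "hilbert_space H" "linear_operator H H T"
  shows "linear_operator H H (\<lambda>x. T x - \<mu> *\<^sub>C x)"
proof -
  interpret hilbert_space H by fact
  show ?thesis using linear_operatorD[OF assms(2)]
    by (auto simp: linear_operator_def scaleC_add_right complex_vector.scale_right_diff_distrib
        complex_vector.scale_left_commute)
qed

lemma bounded_operator_shift:
  assumes "hilbert_space H" "bounded_operator H H T"
  shows "bounded_operator H H (\<lambda>x. T x - \<mu> *\<^sub>C x)"
proof -
  interpret hilbert_space H by fact
  obtain B where B: "B > 0" "\<And>x. x \<in> hcarrier H \<Longrightarrow> hnorm H (T x) \<le> B * hnorm H x"
    using bounded_operator_bound[OF assms(2)] by blast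
  have "hnorm H (T x - \<mu> *\<^sub>C x) \<le> (B + cmod \<mu>) * hnorm H x" if x: "x \<in> hcarrier H" for x
  proof -
    have "hnorm H (T x + - (\<mu> *\<^sub>C x)) \<le> hnorm H (T x) + hnorm H (- (\<mu> *\<^sub>C x))"
      using x linear_operatorD(1)[OF bounded_operator_linear[OF assms(2)]] by (intro triangle_ineq) auto
    then show ?thesis using B(2)[OF x] hnorm_scale[OF x] x by (simp add: algebra_simps)
  qed
  then show ?thesis
    using linear_operator_shift[OF assms(1) bounded_operator_linear[OF assms(2)]]
    unfolding bounded_operator_def by blast
qed

lemma closed_subspace_kernel:
  assumes "hilbert_space H" "hilbert_space K" "bounded_operator H K A"
  shows "closed_subspace H {x \<in> hcarrier H. A x = 0}"
proof -
  interpret hilbert_space H by fact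
  interpret K: hilbert_space K by fact
  note lin = bounded_operator_linear[OF assms(3)]
  obtain B where B: "B > 0" "\<And>x. x \<in> hcarrier H \<Longrightarrow> hnorm K (A x) \<le> B * hnorm H x"
    using bounded_operator_bound[OF assms(3)] by blast
  show ?thesis
  proof unfold_locales
    show "complex_vector.subspace {x \<in> hcarrier H. A x = 0}"
      using linear_operatorD[OF lin] linear_operator_zero[OF lin]
      by (intro complex_vector.subspaceI) auto
    show "closedin (htopology H) {x \<in> hcarrier H. A x = 0}"
    proof (rule closedin_carrierI)
      fix x assume x: "x \<in> hcarrier H"
        and ap: "\<And>r. r > 0 \<Longrightarrow> \<exists>y\<in>{x \<in> hcarrier H. A x = 0}. y \<in> hcarrier H \<and> hnorm H (x - y) < r"
      have "hnorm K (A x) \<le> 0"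
      proof (rule field_le_epsilon)
        fix e :: real assume e: "e > 0"
        then obtain y where y: "y \<in> hcarrier H" "A y = 0" "hnorm H (x - y) < e / B"
          using ap[of "e / B"] B by auto
        have "A x = A (x - y)" using linear_operator_diff[OF lin x y(1)] y by simp
        then have "hnorm K (A x) \<le> B * hnorm H (x - y)" using B x y by simp
        also have "\<dots> \<le> e" using y(3) B(1) by (simp add: field_simps)
        finally show "hnorm K (A x) \<le> 0 + e" by simp
      qed
      then have "A x = 0" using K.hnorm_eq_0 K.hnorm_nonneg linear_operatorD(1)[OF lin x] by fastforce
      then show "x \<in> {x \<in> hcarrier H. A x = 0}" using x by simp
    qed auto
  qed
qed

lemma closed_subspace_eigenspace:
  assumes "hilbert_space H" "bounded_operator H H T"
  shows "closed_subspace H (eigenspace H T \<mu>)"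
  unfolding eigenspace_def
  by (rule closed_subspace_kernel[OF assms(1) assms(1) bounded_operator_shift[OF assms]])

text \<open>
  An eigenvector \<open>e\<close> for \<open>\<mu>\<close> extends to the eigenvector \<open>e + z\<close> for \<open>\<nu>\<close> as soon as
  \<open>z = R ((\<nu> - \<mu>) (e + z))\<close>, where \<open>R\<close> is the inverse of \<open>T - \<mu>\<close> on the orthogonal complement
  of its kernel. The open mapping theorem bounds \<open>R\<close>, so for \<open>\<nu>\<close> close to \<open>\<mu>\<close> the right-hand side is a
  contraction in \<open>z\<close>. The correction \<open>z\<close> is orthogonal to the eigenspace, so linearly independent
  eigenvectors remain independent.
\<close>

lemma eigenvector_perturbation:
  assumes "hilbert_space H" and T: "bounded_operator H H T"
    and surj: "(\<lambda>x. T x - \<mu> *\<^sub>C x) ` hcarrier H = hcarrier H"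
  obtains \<delta> where "\<delta> > 0"
    "\<And>\<nu> e. \<lbrakk>cmod (\<nu> - \<mu>) < \<delta>; e \<in> eigenspace H T \<mu>\<rbrakk> \<Longrightarrow>
      \<exists>z \<in> ortho_complement H (eigenspace H T \<mu>). e + z \<in> eigenspace H T \<nu>"
proof -
  interpret hilbert_space H by fact
  define A where "A = (\<lambda>x. T x - \<mu> *\<^sub>C x)"
  define E where "E = eigenspace H T \<mu>"
  interpret E: closed_subspace H E unfolding E_def
    by (rule closed_subspace_eigenspace[OF assms(1) T])
  let ?F = "ortho_complement H E"
  have E_iff: "x \<in> E \<longleftrightarrow> x \<in> hcarrier H \<and> A x = 0" for x
    unfolding E_def A_def eigenspace_def by blast
  have A: "bounded_operator H H A" unfolding A_def by (rule bounded_operator_shift[OF assms(1) T])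
  note lin = bounded_operator_linear[OF A]
  obtain C where C: "C > 0" "\<And>y. y \<in> hcarrier H \<Longrightarrow> \<exists>x\<in>hcarrier H. A x = y \<and> hnorm H x \<le> C * hnorm H y"
    using open_mapping_bound[OF assms(1,1) A surj[folded A_def]] by blast
  have "\<exists>x\<in>?F. A x = y \<and> hnorm H x \<le> C * hnorm H y" if y: "y \<in> hcarrier H" for y
  proof -
    obtain x where x: "x \<in> hcarrier H" "A x = y" "hnorm H x \<le> C * hnorm H y" using C(2)[OF y] by blast
    have "A (x - hproj H E x) = y"
      using linear_operator_diff[OF lin x(1), of "hproj H E x"] E.hproj_mem(1)[OF x(1)] x by (simp add: E_iff)
    moreover have "hnorm H (x - hproj H E x) \<le> C * hnorm H y"
      using E.hnorm_hproj_le(2)[OF x(1)] x(3) by linarith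
    ultimately show ?thesis using E.hproj_mem(2)[OF x(1)] by blast
  qed
  then obtain R where R: "\<And>y. y \<in> hcarrier H \<Longrightarrow> R y \<in> ?F" "\<And>y. y \<in> hcarrier H \<Longrightarrow> A (R y) = y"
    "\<And>y. y \<in> hcarrier H \<Longrightarrow> hnorm H (R y) \<le> C * hnorm H y" by metis
  have RH: "R y \<in> hcarrier H" if "y \<in> hcarrier H" for y using R(1)[OF that] E.oc_carrier by blast
  have Rdiff: "R y - R z = R (y - z)" if "y \<in> hcarrier H" "z \<in> hcarrier H" for y z
  proof -
    let ?w = "R y - R z - R (y - z)"
    have "?w \<in> ?F" using R(1) that by (intro E.oc_props(3)) auto
    moreover have "A ?w = 0" using R(2) RH that linear_operator_diff[OF lin] by simp
    then have "?w \<in> E" using RH that by (simp add: E_iff)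
    ultimately have "?w = 0" using ortho_complement_Int by blast
    then show ?thesis by simp
  qed
  \<comment> \<open>Within this radius \<open>\<nu> - \<mu>\<close> times the bound \<open>C\<close> of \<open>R\<close> is below \<open>1 / 2\<close>.\<close>
  show thesis
  proof (rule that[of "1 / (2 * C)"])
    show "1 / (2 * C) > 0" using C(1) by simp
    fix \<nu> e assume \<nu>: "cmod (\<nu> - \<mu>) < 1 / (2 * C)" and e: "e \<in> eigenspace H T \<mu>"
    have eE: "e \<in> E" using e by (simp add: E_def)
    let ?k = "\<nu> - \<mu>"
    define f where "f z = R (?k *\<^sub>C (e + z))" for z
    obtain z where z: "z \<in> ?F" "f z = z"
    proof (rule E.oc.metric.Banach_fixedpoint_thm[OF E.oc.complete, of f "1/2"])
      show "hcarrier (hsub H ?F) \<noteq> {}" using E.oc_props(1) by auto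
      show "f \<in> hcarrier (hsub H ?F) \<rightarrow> hcarrier (hsub H ?F)"
        using R(1) eE E.oc_carrier by (auto simp: f_def)
      fix x y assume xy: "x \<in> hcarrier (hsub H ?F)" "y \<in> hcarrier (hsub H ?F)"
      then have xyF: "x \<in> ?F" "y \<in> ?F" and xyH: "x \<in> hcarrier H" "y \<in> hcarrier H"
        using E.oc_carrier by auto
      have "f x - f y = R (?k *\<^sub>C (x - y))"
        unfolding f_def using xyH eE by (subst Rdiff)
          (auto simp flip: complex_vector.scale_right_diff_distrib)
      then have "hnorm H (f x - f y) \<le> C * (cmod ?k * hnorm H (x - y))"
        using R(3)[of "?k *\<^sub>C (x - y)"] xyH by (simp add: hnorm_scale)
      also have "\<dots> = (C * cmod ?k) * hnorm H (x - y)" by simp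
      also have "\<dots> \<le> (1/2) * hnorm H (x - y)"
        using \<nu> C(1) xyH by (intro mult_right_mono) (auto simp: field_simps)
      finally show "hdist (hsub H ?F) (f x) (f y) \<le> 1/2 * hdist (hsub H ?F) x y"
        using xyF xyH R(1) eE by (simp add: hdist_def f_def)
    qed auto
    have zH: "z \<in> hcarrier H" using z(1) E.oc_carrier by blast
    have "A (e + z) = A e + A (f z)" using linear_operatorD(2)[OF lin] eE zH z(2) by simp
    also have "\<dots> = ?k *\<^sub>C (e + z)" using eE zH R(2) by (simp add: E_iff f_def)
    finally have "T (e + z) - \<mu> *\<^sub>C (e + z) = ?k *\<^sub>C (e + z)" by (simp add: A_def)
    then have "T (e + z) - \<nu> *\<^sub>C (e + z) = 0"
      by (simp add: complex_vector.scale_left_diff_distrib algebra_simps)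
    then have "e + z \<in> eigenspace H T \<nu>" using eE zH by (simp add: eigenspace_def)
    then show "\<exists>z\<in>ortho_complement H (eigenspace H T \<mu>). e + z \<in> eigenspace H T \<nu>"
      using z(1) by (auto simp: E_def)
  qed
qed

section \<open>Dimensions of eigenspaces\<close>

text \<open>
  Stated for an arbitrary function \<open>g\<close> that reflects linear relations, in order to apply both to operators
  that are linear on a carrier only and to eigenvectors that are continued one at a time by choice.
\<close>

lemma card_le_of_independent_images:
  fixes B :: "'a::complex_vector set" and C :: "'b::complex_vector set"
  assumes B: "finite B" "complex_vector.independent B"
    and C: "finite C" "\<And>b. b \<in> B \<Longrightarrow> g b \<in> W" "W \<subseteq> complex_vector.span C"
    and inj: "\<And>c. (\<Sum>b\<in>B. c b *\<^sub>C g b) = 0 \<Longrightarrow> (\<Sum>b\<in>B. c b *\<^sub>C b) = 0"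
  shows "card B \<le> card C"
proof -
  have zero: "c b = 0" if "(\<Sum>b\<in>B. c b *\<^sub>C g b) = 0" "b \<in> B" for c b
    using complex_vector.independentD[OF B(2) B(1) subset_refl inj[OF that(1)] that(2)] .
  have injg: "inj_on g B"
  proof (rule inj_onI, rule ccontr)
    fix a b assume ab: "a \<in> B" "b \<in> B" "g a = g b" "a \<noteq> b"
    let ?c = "\<lambda>x. if x = a then 1 else if x = b then -1 else (0::complex)"
    have "(\<Sum>x\<in>B. ?c x *\<^sub>C g x) = (\<Sum>x\<in>{a,b}. ?c x *\<^sub>C g x)"
      using ab B(1) by (intro sum.mono_neutral_right) auto
    also have "\<dots> = 0" using ab by (simp add: scaleC_one)
    finally have "?c a = 0" using zero[of ?c a] ab(1) by blast
    then show False by simp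
  qed
  have "complex_vector.independent (g ` B)"
  proof (rule complex_vector.independent_if_scalars_zero)
    show "finite (g ` B)" using B(1) by simp
    fix u w assume "(\<Sum>x\<in>g ` B. u x *\<^sub>C x) = 0" and w: "w \<in> g ` B"
    then have "(\<Sum>b\<in>B. (u \<circ> g) b *\<^sub>C g b) = 0" by (simp add: sum.reindex[OF injg] o_def)
    then show "u w = 0" using zero[of "u \<circ> g"] w by auto
  qed
  then have "card (g ` B) \<le> card C"
    using complex_vector.independent_span_bound[OF C(1)] C(2,3) by (meson image_subset_iff subset_trans)
  then show ?thesis using injg by (simp add: card_image)
qed

text \<open>
  The library dimension of an infinite-dimensional space is 0, so a bound on the dimension does not
  imply this property.
\<close>

definition finite_dimensional :: "'a::complex_vector set \<Rightarrow> bool"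
  where "finite_dimensional V \<longleftrightarrow> (\<exists>C. finite C \<and> V \<subseteq> complex_vector.span C)"

lemma finite_dimensional_subset: "finite_dimensional V \<Longrightarrow> U \<subseteq> V \<Longrightarrow> finite_dimensional U"
  unfolding finite_dimensional_def by blast

lemma finite_dimensional_basis:
  assumes "finite_dimensional V"
  obtains B where "finite B" "B \<subseteq> V" "complex_vector.independent B" "V \<subseteq> complex_vector.span B"
    "card B = complex_vector.dim V"
proof -
  obtain B where B: "B \<subseteq> V" "complex_vector.independent B" "V \<subseteq> complex_vector.span B"
    "card B = complex_vector.dim V" using complex_vector.basis_exists by blast
  obtain C where C: "finite C" "V \<subseteq> complex_vector.span C"
    using assms unfolding finite_dimensional_def by blast
  have "finite B" using complex_vector.independent_span_bound[OF C(1) B(2)] B(1) C(2) by blast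
  then show thesis using that B by blast
qed

lemma finite_dimensional_dim_pos:
  assumes "complex_vector.dim V > 0" shows "finite_dimensional V"
proof -
  obtain B where B: "V \<subseteq> complex_vector.span B" "card B = complex_vector.dim V"
    using complex_vector.basis_exists by blast
  then have "finite B" using assms by (simp add: card_ge_0_finite)
  then show ?thesis using B(1) unfolding finite_dimensional_def by blast
qed

lemma dim_le_of_independent_images:
  assumes V: "finite_dimensional V" and W: "finite_dimensional W"
    and g: "\<And>v. v \<in> V \<Longrightarrow> g v \<in> W"
    and inj: "\<And>B c. \<lbrakk>finite B; B \<subseteq> V; (\<Sum>b\<in>B. c b *\<^sub>C g b) = 0\<rbrakk> \<Longrightarrow> (\<Sum>b\<in>B. c b *\<^sub>C b) = 0"
  shows "complex_vector.dim V \<le> complex_vector.dim W"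
proof -
  obtain B where B: "finite B" "B \<subseteq> V" "complex_vector.independent B" "card B = complex_vector.dim V"
    using finite_dimensional_basis[OF V] by metis
  obtain C where C: "finite C" "W \<subseteq> complex_vector.span C" "card C = complex_vector.dim W"
    using finite_dimensional_basis[OF W] by metis
  have "card B \<le> card C"
  proof (rule card_le_of_independent_images[OF B(1,3) C(1) _ C(2)])
    show "g b \<in> W" if "b \<in> B" for b using g that B(2) by blast
    show "(\<Sum>b\<in>B. c b *\<^sub>C b) = 0" if "(\<Sum>b\<in>B. c b *\<^sub>C g b) = 0" for c
      using inj[OF B(1,2) that] .
  qed
  then show ?thesis using B C by simp
qed

lemma dim_pos_nonzero:
  assumes "complex_vector.dim V > 0"
  obtains x :: "'a::complex_vector" where "x \<in> V" "x \<noteq> 0"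
proof -
  have "\<not> V \<subseteq> {0}"
  proof
    assume "V \<subseteq> {0}"
    then have "complex_vector.dim V \<le> card ({} :: 'a set)"
      by (intro complex_vector.dim_le_card) auto
    then show False using assms by simp
  qed
  then show thesis using that by blast
qed

lemma finite_dimensional_dim_0:
  assumes "finite_dimensional V" "complex_vector.dim V = 0" "x \<in> V" shows "x = 0"
proof -
  obtain B where "finite B" "V \<subseteq> complex_vector.span B" "card B = complex_vector.dim V"
    using finite_dimensional_basis[OF assms(1)] by metis
  then show ?thesis using assms(2,3) by auto
qed

lemma dim_direct_sum:
  assumes E: "finite_dimensional E"
    and sub: "complex_vector.subspace E" "complex_vector.subspace M" "complex_vector.subspace N"
    and triv: "\<And>x. x \<in> M \<Longrightarrow> x \<in> N \<Longrightarrow> x = 0"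
    and split: "\<And>x. x \<in> E \<Longrightarrow> \<exists>a\<in>E \<inter> M. \<exists>b\<in>E \<inter> N. x = a + b"
  shows "complex_vector.dim E = complex_vector.dim (E \<inter> M) + complex_vector.dim (E \<inter> N)"
proof -
  obtain A where A: "finite A" "A \<subseteq> E \<inter> M" "complex_vector.independent A" "E \<inter> M \<subseteq> complex_vector.span A"
    "card A = complex_vector.dim (E \<inter> M)"
    using finite_dimensional_basis[OF finite_dimensional_subset[OF E Int_lower1]] by metis
  obtain B where B: "finite B" "B \<subseteq> E \<inter> N" "complex_vector.independent B" "E \<inter> N \<subseteq> complex_vector.span B"
    "card B = complex_vector.dim (E \<inter> N)"
    using finite_dimensional_basis[OF finite_dimensional_subset[OF E Int_lower1]] by metis
  have disj: "A \<inter> B = {}"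
  proof -
    have "x \<noteq> 0" if "x \<in> A" for x using that A(3) complex_vector.dependent_zero by blast
    then show ?thesis using triv A(2) B(2) by blast
  qed
  have "complex_vector.independent (A \<union> B)"
  proof (rule complex_vector.independent_if_scalars_zero)
    show "finite (A \<union> B)" using A B by simp
    fix u x assume 0: "(\<Sum>x\<in>A \<union> B. u x *\<^sub>C x) = 0" and x: "x \<in> A \<union> B"
    have s: "(\<Sum>x\<in>A. u x *\<^sub>C x) + (\<Sum>x\<in>B. u x *\<^sub>C x) = 0"
      using 0 by (simp add: sum.union_disjoint[OF A(1) B(1) disj])
    have MA: "(\<Sum>x\<in>A. u x *\<^sub>C x) \<in> M"
      using A(2) sub(2) by (intro complex_vector.subspace_sum complex_vector.subspace_scale) auto
    have NB: "(\<Sum>x\<in>B. u x *\<^sub>C x) \<in> N"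
      using B(2) sub(3) by (intro complex_vector.subspace_sum complex_vector.subspace_scale) auto
    have "(\<Sum>x\<in>A. u x *\<^sub>C x) = - (\<Sum>x\<in>B. u x *\<^sub>C x)" using s by (rule eq_neg_iff_add_eq_0[THEN iffD2])
    then have "(\<Sum>x\<in>A. u x *\<^sub>C x) \<in> N" using complex_vector.subspace_neg[OF sub(3) NB] by simp
    then have A0: "(\<Sum>x\<in>A. u x *\<^sub>C x) = 0" using triv[OF MA] by blast
    then have B0: "(\<Sum>x\<in>B. u x *\<^sub>C x) = 0" using s by simp
    show "u x = 0"
      using x complex_vector.independentD[OF A(3,1) subset_refl A0]
        complex_vector.independentD[OF B(3,1) subset_refl B0] by blast
  qed
  moreover have "E \<subseteq> complex_vector.span (A \<union> B)"
  proof
    fix x assume "x \<in> E"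
    then obtain a b where "a \<in> E \<inter> M" "b \<in> E \<inter> N" "x = a + b" using split by blast
    moreover have "complex_vector.span A \<subseteq> complex_vector.span (A \<union> B)"
      "complex_vector.span B \<subseteq> complex_vector.span (A \<union> B)"
      by (rule complex_vector.span_mono, blast)+
    ultimately show "x \<in> complex_vector.span (A \<union> B)"
      using A(4) B(4) complex_vector.span_add by (metis subsetD)
  qed
  moreover have "A \<union> B \<subseteq> E" using A(2) B(2) by blast
  ultimately have "card (A \<union> B) = complex_vector.dim E"
    using complex_vector.basis_card_eq_dim by blast
  then show ?thesis using card_Un_disjoint[OF A(1) B(1) disj] A(5) B(5) by simp
qed

text \<open>
  A vanishing combination of the continued eigenvectors \<open>e + z e\<close> splits into a part in the eigenspace
  and a part orthogonal to it, so the same combination of the original eigenvectors vanishes.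
\<close>

lemma dim_eigenspace_lower_semicontinuous:
  assumes "hilbert_space H" "bounded_operator H H T"
    and "(\<lambda>x. T x - \<mu> *\<^sub>C x) ` hcarrier H = hcarrier H"
    and fd: "finite_dimensional (eigenspace H T \<mu>)"
  obtains \<delta> where "\<delta> > 0"
    "\<And>\<nu>. \<lbrakk>cmod (\<nu> - \<mu>) < \<delta>; finite_dimensional (eigenspace H T \<nu>)\<rbrakk> \<Longrightarrow>
      complex_vector.dim (eigenspace H T \<mu>) \<le> complex_vector.dim (eigenspace H T \<nu>)"
proof -
  let ?E = "eigenspace H T"
  interpret E: closed_subspace H "?E \<mu>" by (rule closed_subspace_eigenspace[OF assms(1,2)])
  obtain \<delta> where \<delta>: "\<delta> > 0"
    "\<And>\<nu> e. \<lbrakk>cmod (\<nu> - \<mu>) < \<delta>; e \<in> ?E \<mu>\<rbrakk> \<Longrightarrow> \<exists>z \<in> ortho_complement H (?E \<mu>). e + z \<in> ?E \<nu>"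
    using eigenvector_perturbation[OF assms(1-3)] by blast
  show thesis
  proof (rule that[OF \<delta>(1)])
    fix \<nu> assume \<nu>: "cmod (\<nu> - \<mu>) < \<delta>" "finite_dimensional (?E \<nu>)"
    have "\<forall>e\<in>?E \<mu>. \<exists>z. z \<in> ortho_complement H (?E \<mu>) \<and> e + z \<in> ?E \<nu>" using \<delta>(2)[OF \<nu>(1)] by blast
    then obtain z where z: "\<And>e. e \<in> ?E \<mu> \<Longrightarrow> z e \<in> ortho_complement H (?E \<mu>)"
      "\<And>e. e \<in> ?E \<mu> \<Longrightarrow> e + z e \<in> ?E \<nu>" by metis
    show "complex_vector.dim (?E \<mu>) \<le> complex_vector.dim (?E \<nu>)"
    proof (rule dim_le_of_independent_images[OF fd \<nu>(2), of "\<lambda>e. e + z e"])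
      show "e + z e \<in> ?E \<nu>" if "e \<in> ?E \<mu>" for e using z(2) that by blast
      fix B and c :: "'a \<Rightarrow> complex"
      assume B: "finite B" "B \<subseteq> ?E \<mu>" and s: "(\<Sum>b\<in>B. c b *\<^sub>C (b + z b)) = 0"
      let ?x = "\<Sum>b\<in>B. c b *\<^sub>C b" and ?y = "\<Sum>b\<in>B. c b *\<^sub>C z b"
      have "?x + ?y = 0" using s by (simp add: scaleC_add_right sum.distrib)
      then have xy: "?x = - ?y" by (rule eq_neg_iff_add_eq_0[THEN iffD2])
      have oc: "complex_vector.subspace (ortho_complement H (?E \<mu>))"
        by (rule E.subspace_ortho_complement[OF E.M_subset])
      have "?x \<in> ?E \<mu>"
        using B(2) by (intro complex_vector.subspace_sum complex_vector.subspace_scale E.subspace) auto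
      moreover have "?y \<in> ortho_complement H (?E \<mu>)"
        using B(2) z(1) by (intro complex_vector.subspace_sum complex_vector.subspace_scale oc) auto
      then have "?x \<in> ortho_complement H (?E \<mu>)"
        unfolding xy by (rule complex_vector.subspace_neg[OF oc])
      ultimately show "?x = 0" by (rule E.ortho_complement_Int)
    qed
  qed
qed

section \<open>Restriction to a reducing subspace\<close>

locale reducing = hilbert_space H for H :: "'a::complex_vector hilbert" +
  fixes T :: "'a \<Rightarrow> 'a" and M :: "'a set"
  assumes bounded: "bounded_operator H H T" and reducing: "reducing_subspace H T M"
begin

sublocale closed_subspace H M
  using reducing by unfold_locales (auto simp: reducing_subspace_def)

lemmas linear = bounded_operator_linear[OF bounded]
lemmas T_carrier = linear_operatorD(1)[OF linear]

lemma invariant: "x \<in> M \<Longrightarrow> T x \<in> M"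
  "x \<in> ortho_complement H M \<Longrightarrow> T x \<in> ortho_complement H M"
  using reducing unfolding reducing_subspace_def by blast+

lemma reducing_oc: "reducing H T (ortho_complement H M)"
proof unfold_locales
  show "reducing_subspace H T (ortho_complement H M)"
    unfolding reducing_subspace_def ortho_complement_twice
    using ortho_complement_subset subspace_ortho_complement[OF M_subset]
      closedin_ortho_complement[OF M_subset] invariant by blast
qed (rule bounded)

lemma hproj_T: assumes "x \<in> hcarrier H" shows "hproj H M (T x) = T (hproj H M x)"
proof (rule hproj_eqI)
  show "T (hproj H M x) \<in> M" using hproj_mem(1)[OF assms] invariant by blast
  have "T x - T (hproj H M x) = T (x - hproj H M x)"
    using linear_operator_diff[OF linear] assms by simp
  then show "T x - T (hproj H M x) \<in> ortho_complement H M"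
    using hproj_mem(2)[OF assms] invariant by simp
qed

lemma bounded_sub: "bounded_operator (hsub H M) (hsub H M) T"
proof -
  obtain B where B: "\<And>x. x \<in> hcarrier H \<Longrightarrow> hnorm H (T x) \<le> B * hnorm H x"
    using bounded_operator_bound[OF bounded] by blast
  have "\<forall>x\<in>M. hnorm H (T x) \<le> B * hnorm H x" using B by simp
  then show ?thesis unfolding bounded_operator_def linear_operator_def
    using linear_operatorD(2,3)[OF linear] invariant(1) by auto
qed

lemma eigenspace_sub: "eigenspace (hsub H M) T \<mu> = eigenspace H T \<mu> \<inter> M"
  unfolding eigenspace_def using M_subset by auto

lemma hproj_shift: assumes "x \<in> hcarrier H"
  shows "hproj H M (T x - \<mu> *\<^sub>C x) = T (hproj H M x) - \<mu> *\<^sub>C hproj H M x"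
proof -
  have "hproj H M (T x + (-\<mu>) *\<^sub>C x) = T (hproj H M x) + (-\<mu>) *\<^sub>C hproj H M x"
    using assms T_carrier by (simp only: hproj_add scale_mem hproj_scale hproj_T)
  then show ?thesis by simp
qed

lemma hproj_eigenspace: assumes "x \<in> eigenspace H T \<mu>"
  shows "hproj H M x \<in> eigenspace (hsub H M) T \<mu>"
proof -
  have x: "x \<in> hcarrier H" "T x - \<mu> *\<^sub>C x = 0" using assms by (auto simp: eigenspace_def)
  then show ?thesis
    using hproj_shift[OF x(1), of \<mu>] hproj_mem(1)[OF x(1)] hproj_oc[OF oc_props(1)]
    by (simp add: eigenspace_def)
qed

lemma surj_sub: assumes "(\<lambda>x. T x - \<mu> *\<^sub>C x) ` hcarrier H = hcarrier H"
  shows "(\<lambda>x. T x - \<mu> *\<^sub>C x) ` hcarrier (hsub H M) = hcarrier (hsub H M)"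
proof -
  have "T x - \<mu> *\<^sub>C x \<in> M" if "x \<in> M" for x
    using that invariant M_closure_props(3,4) by simp
  moreover have "\<exists>x\<in>M. T x - \<mu> *\<^sub>C x = y" if y: "y \<in> M" for y
  proof -
    have "y \<in> (\<lambda>x. T x - \<mu> *\<^sub>C x) ` hcarrier H" using assms y by simp
    then obtain x where x: "x \<in> hcarrier H" "T x - \<mu> *\<^sub>C x = y" by blast
    then show ?thesis using hproj_shift[OF x(1), of \<mu>] hproj_id[OF y] hproj_mem(1)[OF x(1)] by auto
  qed
  ultimately show ?thesis by (auto simp: image_iff)
qed

lemma dim_eigenspace_split:
  assumes "finite_dimensional (eigenspace H T \<mu>)"
  shows "complex_vector.dim (eigenspace H T \<mu>) = complex_vector.dim (eigenspace (hsub H M) T \<mu>)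
    + complex_vector.dim (eigenspace (hsub H (ortho_complement H M)) T \<mu>)"
proof -
  interpret oc: reducing H T "ortho_complement H M" by (rule reducing_oc)
  interpret E: closed_subspace H "eigenspace H T \<mu>"
    by (rule closed_subspace_eigenspace[OF hilbert_space_axioms bounded])
  show ?thesis unfolding eigenspace_sub oc.eigenspace_sub
  proof (rule dim_direct_sum[OF assms E.subspace subspace oc.subspace])
    show "x = 0" if "x \<in> M" "x \<in> ortho_complement H M" for x
      using that by (rule ortho_complement_Int)
    fix x assume x: "x \<in> eigenspace H T \<mu>"
    then have xH: "x \<in> hcarrier H" by simp
    have "hproj H M x \<in> eigenspace H T \<mu> \<inter> M"
      using hproj_eigenspace[OF x] unfolding eigenspace_sub .
    moreover have "x - hproj H M x \<in> eigenspace H T \<mu> \<inter> ortho_complement H M"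
      using oc.hproj_eigenspace[OF x] unfolding oc.eigenspace_sub hproj_complement[OF xH] .
    ultimately show "\<exists>a\<in>eigenspace H T \<mu> \<inter> M. \<exists>b\<in>eigenspace H T \<mu> \<inter> ortho_complement H M. x = a + b"
      by (metis add_diff_cancel_left' diff_add_cancel add.commute)
  qed
qed

text \<open>
  The projection onto \<open>M\<close> maps eigenvectors to eigenvectors in \<open>M\<close> and does not increase distances, so it
  carries an approximation of \<open>x\<close> by sums of eigenvectors to one inside \<open>M\<close>.
\<close>

lemma dense_sub:
  assumes "htopology H closure_of complex_vector.span (\<Union>\<mu>\<in>\<Omega>. eigenspace H T \<mu>) = hcarrier H"
  shows "htopology (hsub H M) closure_of complex_vector.span (\<Union>\<mu>\<in>\<Omega>. eigenspace (hsub H M) T \<mu>) = M"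
proof -
  let ?S = "complex_vector.span (\<Union>\<mu>\<in>\<Omega>. eigenspace H T \<mu>)"
  let ?SM = "complex_vector.span (\<Union>\<mu>\<in>\<Omega>. eigenspace (hsub H M) T \<mu>)"
  have proj: "y \<in> hcarrier H \<and> hproj H M y \<in> ?SM" if "y \<in> ?S" for y
    using that
  proof (induction rule: complex_vector.span_induct_alt)
    case base
    show ?case using hproj_oc[OF oc_props(1)] complex_vector.span_zero by simp
  next
    case (step c x y)
    then obtain \<mu> where \<mu>: "\<mu> \<in> \<Omega>" "x \<in> eigenspace H T \<mu>" by blast
    have x: "x \<in> hcarrier H" using \<mu>(2) by (simp add: eigenspace_def)
    have "hproj H M x \<in> ?SM" using hproj_eigenspace[OF \<mu>(2)] \<mu>(1) by (intro complex_vector.span_base) blast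
    then show ?case using x step.IH
      by (auto simp: hproj_add hproj_scale intro: complex_vector.span_add complex_vector.span_scale)
  qed
  have "x \<in> htopology (hsub H M) closure_of ?SM" if x: "x \<in> M" for x
    unfolding sub.in_closure_iff
  proof (intro conjI allI impI)
    show "x \<in> hcarrier (hsub H M)" using x by simp
    fix r :: real assume r: "r > 0"
    have xH: "x \<in> hcarrier H" using x by simp
    then obtain y where y: "y \<in> ?S" "y \<in> hcarrier H" "hnorm H (x - y) < r"
      using assms in_closure_iff[of x ?S] r by auto
    have "x - hproj H M y = hproj H M (x + (-1) *\<^sub>C y)"
      using xH y(2) hproj_id[OF x] by (simp only: hproj_add hproj_scale scale_mem) simp
    then have "hnorm H (x - hproj H M y) \<le> hnorm H (x - y)"
      using hnorm_hproj_le(1)[of "x - y"] xH y(2) by simp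
    then show "\<exists>y\<in>?SM. y \<in> hcarrier (hsub H M) \<and> hnorm (hsub H M) (x - y) < r"
      using proj[OF y(1)] y(3) hproj_mem(1)[OF y(2)] by (intro bexI[of _ "hproj H M y"]) auto
  qed
  moreover have "htopology (hsub H M) closure_of ?SM \<subseteq> M"
    using sub.in_closure_iff by auto
  ultimately show ?thesis by blast
qed

end

lemma eigenvalue_in_spectrum:
  assumes "hilbert_space H" "x \<in> eigenspace H T \<mu>" "x \<noteq> 0"
  shows "\<mu> \<in> operator_spectrum H T"
proof -
  interpret hilbert_space H by fact
  have "False" if R: "bounded_operator H H R" "\<forall>x\<in>hcarrier H. R (T x - \<mu> *\<^sub>C x) = x" for R
    using assms(2,3) R(2) linear_operator_zero[OF bounded_operator_linear[OF R(1)]]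
    unfolding eigenspace_def by fastforce
  then show ?thesis unfolding operator_spectrum_def by blast
qed

lemma cowen_douglas_eigenvector:
  assumes "cowen_douglas \<Omega> n H T" "\<mu> \<in> \<Omega>"
  obtains x where "x \<in> eigenspace H T \<mu>" "x \<noteq> 0"
  by (rule dim_pos_nonzero[of "eigenspace H T \<mu>"]) (use assms in \<open>auto simp: cowen_douglas_def\<close>)

lemma cowen_douglas_finite_dimensional:
  assumes "cowen_douglas \<Omega> n H T" "\<mu> \<in> \<Omega>" shows "finite_dimensional (eigenspace H T \<mu>)"
  using assms by (intro finite_dimensional_dim_pos) (auto simp: cowen_douglas_def)

text \<open>
  The dimensions of the eigenspaces in \<open>M\<close> and in its complement are lower semicontinuous with
  constant sum \<open>n\<close>, hence locally constant. The eigenvectors in either subspace span a dense part of it,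
  so dimension 0 forces the subspace to be trivial.
\<close>

lemma cowen_douglas_reducing:
  fixes \<Omega> :: "complex set"
  assumes \<Omega>: "connected \<Omega>" "\<Omega> \<noteq> {}" and CD: "cowen_douglas \<Omega> n H T"
    and M: "reducing_subspace H T M"
  obtains k where "M \<noteq> {0} \<Longrightarrow> cowen_douglas \<Omega> k (hsub H M) T" "M = {0} \<Longrightarrow> k = 0"
    "ortho_complement H M \<noteq> {0} \<Longrightarrow> cowen_douglas \<Omega> (n - k) (hsub H (ortho_complement H M)) T"
    "k \<le> n" "ortho_complement H M = {0} \<Longrightarrow> k = n"
proof -
  have H: "hilbert_space H" and T: "bounded_operator H H T" using CD by (auto simp: cowen_douglas_def)
  interpret r: reducing H T M using H T M by (simp add: reducing_def reducing_axioms_def)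
  let ?N = "ortho_complement H M"
  interpret c: reducing H T ?N by (rule r.reducing_oc)
  have surj: "\<And>\<mu>. \<mu> \<in> \<Omega> \<Longrightarrow> (\<lambda>x. T x - \<mu> *\<^sub>C x) ` hcarrier H = hcarrier H"
    using CD by (simp add: cowen_douglas_def)
  have dense: "htopology H closure_of complex_vector.span (\<Union>\<mu>\<in>\<Omega>. eigenspace H T \<mu>) = hcarrier H"
    using CD by (simp add: cowen_douglas_def)
  note fd = cowen_douglas_finite_dimensional[OF CD]
  have fdM: "finite_dimensional (eigenspace (hsub H M) T \<mu>)" if "\<mu> \<in> \<Omega>" for \<mu>
    unfolding r.eigenspace_sub using fd[OF that] finite_dimensional_subset by blast
  have fdN: "finite_dimensional (eigenspace (hsub H ?N) T \<mu>)" if "\<mu> \<in> \<Omega>" for \<mu>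
    unfolding c.eigenspace_sub using fd[OF that] finite_dimensional_subset by blast
  let ?f = "\<lambda>\<mu>. complex_vector.dim (eigenspace (hsub H M) T \<mu>)"
  let ?g = "\<lambda>\<mu>. complex_vector.dim (eigenspace (hsub H ?N) T \<mu>)"
  have sum: "?f \<mu> + ?g \<mu> = n" if "\<mu> \<in> \<Omega>" for \<mu>
    using r.dim_eigenspace_split[OF fd[OF that]] CD that by (simp add: cowen_douglas_def)
  \<comment> \<open>Neither \<open>?f\<close> nor \<open>?g\<close> drops near \<open>\<mu>\<close>, and a rise of one would be a drop of the other.\<close>
  have loc: "\<forall>\<mu>\<in>\<Omega>. \<forall>\<^sub>F \<nu> in at \<mu> within \<Omega>. ?f \<mu> = ?f \<nu>"
  proof
    fix \<mu> assume \<mu>: "\<mu> \<in> \<Omega>"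
    obtain \<delta>1 where 1: "\<delta>1 > 0" "\<And>\<nu>. \<lbrakk>cmod (\<nu> - \<mu>) < \<delta>1; \<nu> \<in> \<Omega>\<rbrakk> \<Longrightarrow> ?f \<mu> \<le> ?f \<nu>"
      using dim_eigenspace_lower_semicontinuous[OF r.sub.hilbert_space_axioms r.bounded_sub
          r.surj_sub[OF surj[OF \<mu>]] fdM[OF \<mu>]] fdM by metis
    obtain \<delta>2 where 2: "\<delta>2 > 0" "\<And>\<nu>. \<lbrakk>cmod (\<nu> - \<mu>) < \<delta>2; \<nu> \<in> \<Omega>\<rbrakk> \<Longrightarrow> ?g \<mu> \<le> ?g \<nu>"
      using dim_eigenspace_lower_semicontinuous[OF r.oc.hilbert_space_axioms c.bounded_sub
          c.surj_sub[OF surj[OF \<mu>]] fdN[OF \<mu>]] fdN by metis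
    have "?f \<mu> = ?f \<nu>" if "\<nu> \<in> \<Omega>" "dist \<nu> \<mu> < min \<delta>1 \<delta>2" for \<nu>
      using 1(2)[of \<nu>] 2(2)[of \<nu>] that sum[OF \<mu>] sum[OF that(1)] by (simp add: dist_norm)
    then show "\<forall>\<^sub>F \<nu> in at \<mu> within \<Omega>. ?f \<mu> = ?f \<nu>"
      unfolding eventually_at using 1(1) 2(1) by (intro exI[of _ "min \<delta>1 \<delta>2"]) auto
  qed
  obtain \<mu>0 where \<mu>0: "\<mu>0 \<in> \<Omega>" using \<Omega> by blast
  have f: "?f \<mu> = ?f \<mu>0" if "\<mu> \<in> \<Omega>" for \<mu> using connected_local_const[OF \<Omega>(1) that \<mu>0 loc] .
  have g: "?g \<mu> = n - ?f \<mu>0" if "\<mu> \<in> \<Omega>" for \<mu> using f[OF that] sum[OF that] by simp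
  have cd: "cowen_douglas \<Omega> k (hsub H L) T"
    if L: "reducing H T L" "L \<noteq> {0}" and k: "\<And>\<mu>. \<mu> \<in> \<Omega> \<Longrightarrow> complex_vector.dim (eigenspace (hsub H L) T \<mu>) = k" for L k
  proof -
    interpret L: reducing H T L by (rule L(1))
    let ?E = "eigenspace (hsub H L) T"
    have fdL: "finite_dimensional (?E \<mu>)" if "\<mu> \<in> \<Omega>" for \<mu>
      unfolding L.eigenspace_sub using fd[OF that] finite_dimensional_subset by blast
    have k0: "k > 0"
    proof (rule ccontr)
      assume "\<not> k > 0"
      then have E0: "?E \<mu> \<subseteq> {0}" if "\<mu> \<in> \<Omega>" for \<mu>
        using k[OF that] finite_dimensional_dim_0[OF fdL[OF that]] by blast
      then have "(\<Union>\<mu>\<in>\<Omega>. ?E \<mu>) \<subseteq> {0}" by blast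
      then have "complex_vector.span (\<Union>\<mu>\<in>\<Omega>. ?E \<mu>) \<subseteq> {0}"
        by (intro complex_vector.span_minimal) auto
      then have S: "y = 0" if "y \<in> complex_vector.span (\<Union>\<mu>\<in>\<Omega>. ?E \<mu>)" for y using that by blast
      have "x = 0" if "x \<in> L" for x
      proof -
        have xL: "x \<in> hcarrier (hsub H L)" using that by simp
        have "x \<in> htopology (hsub H L) closure_of complex_vector.span (\<Union>\<mu>\<in>\<Omega>. ?E \<mu>)"
          using that L.dense_sub[OF dense] by simp
        then have "\<forall>r>0. hnorm (hsub H L) x < r" unfolding L.sub.in_closure_iff using S by fastforce
        then have "hnorm (hsub H L) x = 0" using L.sub.hnorm_nonneg[OF xL] by (metis less_le less_irrefl)
        then show ?thesis using L.sub.hnorm_eq_0[OF xL] by simp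
      qed
      then show False using L(2) L.M_closure_props(1) by blast
    qed
    have "\<mu> \<in> operator_spectrum (hsub H L) T" if \<mu>: "\<mu> \<in> \<Omega>" for \<mu>
    proof -
      obtain x where "x \<in> ?E \<mu>" "x \<noteq> 0" by (rule dim_pos_nonzero[of "?E \<mu>"]) (use k[OF \<mu>] k0 in auto)
      then show ?thesis using eigenvalue_in_spectrum[OF L.sub.hilbert_space_axioms] by blast
    qed
    then show ?thesis
      unfolding cowen_douglas_def
      using k0 k L.sub.hilbert_space_axioms L.bounded_sub L.surj_sub[OF surj] L.dense_sub[OF dense] by auto
  qed
  have z: "complex_vector.dim (eigenspace (hsub H L) T \<mu>) = 0" if "L = {0}" for L \<mu>
  proof -
    have "eigenspace (hsub H L) T \<mu> \<subseteq> {0}" using that by (auto simp: eigenspace_def)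
    then show ?thesis using dim_pos_nonzero[of "eigenspace (hsub H L) T \<mu>"] by blast
  qed
  show thesis
  proof (rule that[of "?f \<mu>0"])
    show "cowen_douglas \<Omega> (?f \<mu>0) (hsub H M) T" if "M \<noteq> {0}"
      by (rule cd[OF r.reducing_axioms that f])
    show "cowen_douglas \<Omega> (n - ?f \<mu>0) (hsub H ?N) T" if "?N \<noteq> {0}"
      by (rule cd[OF c.reducing_axioms that g])
    show "?f \<mu>0 = 0" if "M = {0}" by (rule z[OF that])
    show "?f \<mu>0 \<le> n" using sum[OF \<mu>0] by simp
    show "?f \<mu>0 = n" if "?N = {0}" using sum[OF \<mu>0] z[OF that] by simp
  qed
qed

section \<open>Unitary equivalence\<close>

lemma unitary_operatorD:
  assumes "unitary_operator H K U"
  shows "linear_operator H K U" "inj_on U (hcarrier H)" "U ` hcarrier H = hcarrier K"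
    "x \<in> hcarrier H \<Longrightarrow> y \<in> hcarrier H \<Longrightarrow> hinner K (U x) (U y) = hinner H x y"
    "x \<in> hcarrier H \<Longrightarrow> U x \<in> hcarrier K"
  using assms by (auto simp: unitary_operator_def bij_betw_def)

lemma unitary_operatorI:
  assumes "linear_operator H K U" "inj_on U (hcarrier H)"
    "\<And>y. y \<in> hcarrier K \<Longrightarrow> \<exists>x\<in>hcarrier H. U x = y"
    "\<And>x y. x \<in> hcarrier H \<Longrightarrow> y \<in> hcarrier H \<Longrightarrow> hinner K (U x) (U y) = hinner H x y"
  shows "unitary_operator H K U"
  using assms linear_operatorD(1)[OF assms(1)] unfolding unitary_operator_def bij_betw_def
  by (auto simp: image_iff)

lemma unitary_operator_compose:
  assumes U: "unitary_operator H K U" and V: "unitary_operator K L V"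
  shows "unitary_operator H L (V \<circ> U)"
proof -
  have "bij_betw (V \<circ> U) (hcarrier H) (hcarrier L)"
    using U V unfolding unitary_operator_def by (blast intro: bij_betw_trans)
  then show ?thesis
    using linear_operatorD[OF unitary_operatorD(1)[OF U]] linear_operatorD[OF unitary_operatorD(1)[OF V]]
      unitary_operatorD(4)[OF U] unitary_operatorD(4)[OF V]
    by (simp add: unitary_operator_def linear_operator_def)
qed

lemma unitary_operator_inverse:
  assumes H: "complex_vector.subspace (hcarrier H)" and U: "unitary_operator H K U"
  defines "V \<equiv> inv_into (hcarrier H) U"
  shows "unitary_operator K H V" "\<And>x. x \<in> hcarrier H \<Longrightarrow> V (U x) = x"
    "\<And>y. y \<in> hcarrier K \<Longrightarrow> U (V y) = y"
proof -
  note closed = complex_vector.subspace_add[OF H] complex_vector.subspace_scale[OF H]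
  note UD = unitary_operatorD[OF U]
  show VU: "V (U x) = x" if "x \<in> hcarrier H" for x using UD(2) that by (simp add: V_def)
  have ex: "\<exists>x\<in>hcarrier H. y = U x" if "y \<in> hcarrier K" for y using that UD(3) by blast
  show UV: "U (V y) = y" if "y \<in> hcarrier K" for y using ex[OF that] VU by auto
  have VH: "V y \<in> hcarrier H" if "y \<in> hcarrier K" for y using ex[OF that] VU by auto
  have add: "V (y + z) = V y + V z" if "y \<in> hcarrier K" "z \<in> hcarrier K" for y z
    using VU[of "V y + V z"] linear_operatorD(2)[OF UD(1), of "V y" "V z"] VH UV closed that by simp
  have scale: "V (c *\<^sub>C y) = c *\<^sub>C V y" if "y \<in> hcarrier K" for c y
    using VU[of "c *\<^sub>C V y"] linear_operatorD(3)[OF UD(1), of "V y" c] VH UV closed that by simp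
  have inner: "hinner H (V y) (V z) = hinner K y z" if "y \<in> hcarrier K" "z \<in> hcarrier K" for y z
    using UD(4)[of "V y" "V z"] VH UV that by simp
  show "unitary_operator K H V"
  proof (rule unitary_operatorI)
    show "linear_operator K H V" using VH add scale by (simp add: linear_operator_def)
    show "inj_on V (hcarrier K)" using UV by (rule inj_on_inverseI)
    show "\<exists>y\<in>hcarrier K. V y = x" if "x \<in> hcarrier H" for x using VU UD(5) that by blast
  qed (rule inner)
qed

lemma unitarily_equivalent_sym:
  assumes H: "hilbert_space H" and T: "linear_operator H H T" and eq: "unitarily_equivalent H T K S"
  shows "unitarily_equivalent K S H T"
proof -
  obtain U where U: "unitary_operator H K U" "\<And>x. x \<in> hcarrier H \<Longrightarrow> U (T x) = S (U x)"
    using eq unfolding unitarily_equivalent_def by blast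
  define V where "V = inv_into (hcarrier H) U"
  note V = unitary_operator_inverse[OF hilbert_space.subspace_carrier[OF H] U(1), folded V_def]
  have "V (S y) = T (V y)" if y: "y \<in> hcarrier K" for y
  proof -
    have Vy: "V y \<in> hcarrier H" using unitary_operatorD(5)[OF V(1) y] .
    have "V (S y) = V (U (T (V y)))" using U(2)[OF Vy] V(3)[OF y] by simp
    then show ?thesis using V(2) linear_operatorD(1)[OF T Vy] by simp
  qed
  then show ?thesis using V(1) unfolding unitarily_equivalent_def by blast
qed

lemma unitarily_equivalent_trans:
  assumes "unitarily_equivalent H T K S" "unitarily_equivalent K S L R"
  shows "unitarily_equivalent H T L R"
proof -
  obtain U where U: "unitary_operator H K U" "\<And>x. x \<in> hcarrier H \<Longrightarrow> U (T x) = S (U x)"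
    using assms(1) unfolding unitarily_equivalent_def by blast
  obtain V where V: "unitary_operator K L V" "\<And>x. x \<in> hcarrier K \<Longrightarrow> V (S x) = R (V x)"
    using assms(2) unfolding unitarily_equivalent_def by blast
  show ?thesis unfolding unitarily_equivalent_def
    using unitary_operator_compose[OF U(1) V(1)] U(2) V(2) unitary_operatorD(5)[OF U(1)]
    by (intro exI[of _ "V \<circ> U"]) simp
qed

lemma (in hilbert_space) linear_operator_sum:
  assumes T: "linear_operator H K T" and "finite B" "\<And>b. b \<in> B \<Longrightarrow> f b \<in> hcarrier H"
  shows "T (\<Sum>b\<in>B. c b *\<^sub>C f b) = (\<Sum>b\<in>B. c b *\<^sub>C T (f b))"
  using assms(2,3)
proof (induction B rule: finite_induct)
  case empty then show ?case using linear_operator_zero[OF T] by simp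
next
  case (insert b B)
  have "(\<Sum>b\<in>B. c b *\<^sub>C f b) \<in> hcarrier H"
    using insert.prems subspace_carrier by (intro complex_vector.subspace_sum) auto
  then show ?case using insert linear_operatorD(2,3)[OF T] by simp
qed

lemma cowen_douglas_hilbert: "cowen_douglas \<Omega> n H T \<Longrightarrow> hilbert_space H"
  and cowen_douglas_bounded: "cowen_douglas \<Omega> n H T \<Longrightarrow> bounded_operator H H T"
  and cowen_douglas_linear: "cowen_douglas \<Omega> n H T \<Longrightarrow> linear_operator H H T"
  and cowen_douglas_pos: "cowen_douglas \<Omega> n H T \<Longrightarrow> n > 0"
  by (auto simp: cowen_douglas_def bounded_operator_def)

lemma cowen_douglas_rank_le:
  assumes H: "cowen_douglas \<Omega> k H T" and K: "cowen_douglas \<Omega> l K S" and "\<Omega> \<noteq> {}"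
    and eq: "unitarily_equivalent H T K S"
  shows "k \<le> l"
proof -
  interpret hilbert_space H using cowen_douglas_hilbert[OF H] .
  interpret K: hilbert_space K using cowen_douglas_hilbert[OF K] .
  obtain U where U: "unitary_operator H K U" "\<And>x. x \<in> hcarrier H \<Longrightarrow> U (T x) = S (U x)"
    using eq unfolding unitarily_equivalent_def by blast
  note UD = unitary_operatorD[OF U(1)]
  obtain \<mu> where \<mu>: "\<mu> \<in> \<Omega>" using assms(3) by blast
  have "complex_vector.dim (eigenspace H T \<mu>) \<le> complex_vector.dim (eigenspace K S \<mu>)"
  proof (rule dim_le_of_independent_images[of _ _ U])
    show "finite_dimensional (eigenspace H T \<mu>)" "finite_dimensional (eigenspace K S \<mu>)"
      using cowen_douglas_finite_dimensional[OF H \<mu>] cowen_douglas_finite_dimensional[OF K \<mu>] by auto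
    show "U v \<in> eigenspace K S \<mu>" if "v \<in> eigenspace H T \<mu>" for v
      using that U(2)[of v] UD(5)[of v] linear_operatorD(3)[OF UD(1), of v \<mu>]
      by (simp add: eigenspace_def)
    fix B c assume B: "finite B" "B \<subseteq> eigenspace H T \<mu>" and s: "(\<Sum>b\<in>B. c b *\<^sub>C U b) = 0"
    have BH: "b \<in> hcarrier H" if "b \<in> B" for b using that B(2) by (auto simp: eigenspace_def)
    let ?x = "\<Sum>b\<in>B. c b *\<^sub>C b"
    have x: "?x \<in> hcarrier H"
      using BH subspace_carrier by (intro complex_vector.subspace_sum) auto
    have "U ?x = U 0"
      using linear_operator_sum[OF UD(1) B(1), of "\<lambda>b. b" c] BH s linear_operator_zero[OF UD(1)] by simp
    then show "?x = 0" using inj_onD[OF UD(2)] x by simp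
  qed
  then show ?thesis using H K \<mu> by (simp add: cowen_douglas_def)
qed

section \<open>Orthogonal sums of blocks\<close>

text \<open>
  The sum over \<open>i\<close> of \<open>m i\<close> copies of \<open>G i\<close>, written as a single sum over pairs: \<open>(i, k)\<close> stands for the
  \<open>k\<close>-th copy of \<open>G i\<close>. An arbitrary index set \<open>J\<close> allows one block to be added at a time.
\<close>

definition block_sum :: "(nat \<times> nat) set \<Rightarrow> (nat \<Rightarrow> 'a::complex_vector hilbert) \<Rightarrow> (nat \<Rightarrow> nat \<Rightarrow> 'a) hilbert"
  where "block_sum J G =
    \<lparr>hcarrier = {f. \<forall>i k. if (i, k) \<in> J then f i k \<in> hcarrier (G i) else f i k = 0},
     hinner = (\<lambda>f g. \<Sum>(i, k)\<in>J. hinner (G i) (f i k) (g i k))\<rparr>"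

definition block_operator :: "(nat \<times> nat) set \<Rightarrow> (nat \<Rightarrow> 'a \<Rightarrow> 'a::complex_vector) \<Rightarrow>
    (nat \<Rightarrow> nat \<Rightarrow> 'a) \<Rightarrow> nat \<Rightarrow> nat \<Rightarrow> 'a"
  where "block_operator J S f = (\<lambda>i k. if (i, k) \<in> J then S i (f i k) else 0)"

abbreviation blocks :: "nat \<Rightarrow> (nat \<Rightarrow> nat) \<Rightarrow> (nat \<times> nat) set"
  where "blocks t m \<equiv> Sigma {1..t} (\<lambda>i. {1..m i})"

lemma hilbert_sum_copies:
  "hilbert_sum {1..t} (\<lambda>i. hilbert_copies (m i) (G i)) = block_sum (blocks t m) G"
proof -
  have "(\<Sum>i=1..t. \<Sum>k=1..m i. hinner (G i) (f i k) (g i k))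
      = (\<Sum>(i, k)\<in>blocks t m. hinner (G i) (f i k) (g i k))" for f g :: "nat \<Rightarrow> nat \<Rightarrow> 'a"
    by (rule sum.Sigma) auto
  moreover have "{f :: nat \<Rightarrow> nat \<Rightarrow> 'a. (\<forall>i\<in>{1..t}. f i \<in> hcarrier (hilbert_sum {1..m i} (\<lambda>_. G i))) \<and> (\<forall>i. i \<notin> {1..t} \<longrightarrow> f i = 0)}
    = {f. \<forall>i k. if (i, k) \<in> blocks t m then f i k \<in> hcarrier (G i) else f i k = 0}"
    by (auto simp: hilbert_sum_def fun_eq_iff split: if_splits)
  ultimately show ?thesis
    unfolding hilbert_copies_def block_sum_def by (simp add: hilbert_sum_def)
qed

lemma operator_sum_copies:
  "operator_sum {1..t} (\<lambda>i. operator_copies (m i) (S i)) = block_operator (blocks t m) S"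
  by (auto simp: operator_sum_def operator_copies_def block_operator_def fun_eq_iff)

lemma IR_decomposition_blocks:
  "IR_decomposition \<Omega> n H T t G S m d \<longleftrightarrow>
    unitarily_equivalent H T (block_sum (blocks t m) G) (block_operator (blocks t m) S) \<and>
    (\<forall>i\<in>{1..t}. m i > 0 \<and> cowen_douglas \<Omega> (d i) (G i) (S i) \<and> irreducible_operator (G i) (S i)) \<and>
    (\<Sum>i=1..t. m i * d i) = n \<and>
    (\<forall>i\<in>{1..t}. \<forall>j\<in>{1..t}. i \<noteq> j \<longrightarrow> \<not> unitarily_equivalent (G i) (S i) (G j) (S j))"
  unfolding IR_decomposition_def hilbert_sum_copies operator_sum_copies ..

lemma block_sumD:
  assumes "f \<in> hcarrier (block_sum J G)"
  shows "(i, k) \<in> J \<Longrightarrow> f i k \<in> hcarrier (G i)" "(i, k) \<notin> J \<Longrightarrow> f i k = 0"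
proof -
  have "\<forall>i k. if (i, k) \<in> J then f i k \<in> hcarrier (G i) else f i k = 0"
    using assms by (simp add: block_sum_def)
  then show "(i, k) \<in> J \<Longrightarrow> f i k \<in> hcarrier (G i)" "(i, k) \<notin> J \<Longrightarrow> f i k = 0"
    by metis+
qed

lemma block_sumI:
  assumes "\<And>i k. (i, k) \<in> J \<Longrightarrow> f i k \<in> hcarrier (G i)" "\<And>i k. (i, k) \<notin> J \<Longrightarrow> f i k = 0"
  shows "f \<in> hcarrier (block_sum J G)"
  using assms by (simp add: block_sum_def)

lemma block_sum_inner: "hinner (block_sum J G) f g = (\<Sum>(i, k)\<in>J. hinner (G i) (f i k) (g i k))"
  by (simp add: block_sum_def)

text \<open>
  The two families \<open>G\<close> and \<open>G'\<close> allow both uses of this lemma: for a further copy of an existing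
  summand they coincide, and for a new summand \<open>G'\<close> extends \<open>G\<close>.
\<close>

lemma unitarily_equivalent_insert_block:
  assumes red: "reducing H T M"
    and U: "unitary_operator (hsub H (ortho_complement H M)) (block_sum J G) U"
      "\<And>x. x \<in> ortho_complement H M \<Longrightarrow> U (T x) = block_operator J S (U x)"
    and W: "unitary_operator (hsub H M) (G' a) W" "\<And>x. x \<in> M \<Longrightarrow> W (T x) = S' a (W x)"
    and agree: "\<And>i k. (i, k) \<in> J \<Longrightarrow> G' i = G i \<and> S' i = S i"
    and J: "(a, b) \<notin> J" "finite J"
  shows "unitarily_equivalent H T (block_sum (insert (a, b) J) G') (block_operator (insert (a, b) J) S')"
proof -
  interpret reducing H T M by fact
  let ?N = "ortho_complement H M"
  let ?J = "insert (a, b) J"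
  note UD = unitary_operatorD[OF U(1), simplified]
  note WD = unitary_operatorD[OF W(1), simplified]
  note Ul = linear_operatorD[OF UD(1), simplified]
  note Wl = linear_operatorD[OF WD(1), simplified]
  define p where "p x = hproj H M x" for x
  define q where "q x = x - hproj H M x" for x
  define V where "V x = (\<lambda>i k. if (i, k) = (a, b) then W (p x) else U (q x) i k)" for x
  have p: "p x \<in> M" and q: "q x \<in> ?N" if "x \<in> hcarrier H" for x
    using hproj_mem[OF that] by (auto simp: p_def q_def)
  have padd: "p (x + y) = p x + p y" "q (x + y) = q x + q y" if "x \<in> hcarrier H" "y \<in> hcarrier H" for x y
    using that by (auto simp: p_def q_def hproj_add)
  have pscale: "p (c *\<^sub>C x) = c *\<^sub>C p x" "q (c *\<^sub>C x) = c *\<^sub>C q x" if "x \<in> hcarrier H" for x c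
    using that by (auto simp: p_def q_def hproj_scale complex_vector.scale_right_diff_distrib)
  have pT: "p (T x) = T (p x)" "q (T x) = T (q x)" if "x \<in> hcarrier H" for x
    using that hproj_T[OF that] linear_operator_diff[OF linear that, of "hproj H M x"]
    by (auto simp: p_def q_def)
  have Uout: "U y i k = 0" if "y \<in> ?N" "(i, k) \<notin> J" for y i k
    using block_sumD(2)[OF UD(5)[OF that(1)] that(2)] .
  have lin: "linear_operator H (block_sum ?J G') V"
    unfolding linear_operator_def
  proof (intro conjI ballI allI)
    fix x assume x: "x \<in> hcarrier H"
    show "V x \<in> hcarrier (block_sum ?J G')"
    proof (rule block_sumI)
      fix i k assume "(i, k) \<in> ?J"
      then show "V x i k \<in> hcarrier (G' i)"
        using WD(5)[OF p[OF x]] block_sumD(1)[OF UD(5)[OF q[OF x]]] agree[of i k] by (auto simp: V_def)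
    next
      fix i k assume "(i, k) \<notin> ?J"
      then have "(i, k) \<noteq> (a, b)" "(i, k) \<notin> J" by auto
      then show "V x i k = 0" using Uout[OF q[OF x], of i k] by (auto simp: V_def)
    qed
    show "V (c *\<^sub>C x) = c *\<^sub>C V x" for c
      using pscale[OF x] Wl(3)[OF p[OF x]] Ul(3)[OF q[OF x]] by (auto simp: V_def scaleC_fun_def fun_eq_iff)
    fix y assume y: "y \<in> hcarrier H"
    show "V (x + y) = V x + V y"
      using padd[OF x y] Wl(2)[OF p[OF x] p[OF y]] Ul(2)[OF q[OF x] q[OF y]]
      by (auto simp: V_def fun_eq_iff)
  qed
  have split: "x = p x + q x" for x by (simp add: p_def q_def)
  have "unitary_operator H (block_sum ?J G') V"
  proof (rule unitary_operatorI[OF lin])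
    show "inj_on V (hcarrier H)"
    proof (rule inj_onI)
      fix x y assume x: "x \<in> hcarrier H" and y: "y \<in> hcarrier H" and eq: "V x = V y"
      have eq': "V x i k = V y i k" for i k using eq by simp
      have "W (p x) = W (p y)" using eq'[of a b] by (simp add: V_def)
      then have 1: "p x = p y" using inj_onD[OF WD(2)] p[OF x] p[OF y] by simp
      have "U (q x) i k = U (q y) i k" for i k
        using eq'[of i k] Uout[OF q[OF x]] Uout[OF q[OF y]] J(1) by (cases "(i, k) = (a, b)") (auto simp: V_def)
      then have "U (q x) = U (q y)" by (simp add: fun_eq_iff)
      then have 2: "q x = q y" using inj_onD[OF UD(2)] q[OF x] q[OF y] by simp
      show "x = y" using 1 2 split by metis
    qed
    show "\<exists>x\<in>hcarrier H. V x = f" if f: "f \<in> hcarrier (block_sum ?J G')" for f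
    proof -
      have "f a b \<in> W ` M" using block_sumD(1)[OF f, of a b] WD(3) by simp
      then obtain u where u: "u \<in> M" "W u = f a b" by (metis imageE)
      let ?g = "\<lambda>i k. if (i, k) = (a, b) then 0 else f i k"
      have "?g \<in> hcarrier (block_sum J G)"
      proof (rule block_sumI)
        fix i k assume ik: "(i, k) \<in> J"
        then have "(i, k) \<noteq> (a, b)" using J(1) by blast
        moreover have "f i k \<in> hcarrier (G i)" using block_sumD(1)[OF f, of i k] agree[OF ik] ik by simp
        ultimately show "?g i k \<in> hcarrier (G i)" by (simp only: if_False)
      next
        fix i k assume "(i, k) \<notin> J"
        then show "?g i k = 0" using block_sumD(2)[OF f, of i k] by simp
      qed
      then have "?g \<in> U ` ?N" using UD(3) by simp
      then obtain v where v: "v \<in> ?N" "?g = U v" by (rule imageE)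
      have uvH: "u \<in> hcarrier H" "v \<in> hcarrier H" using u v oc_carrier by auto
      have pu: "p u = u" "p v = 0" "q u = 0" "q v = v"
        using hproj_id[OF u(1)] hproj_oc[OF v(1)] by (auto simp: p_def q_def)
      have "V (u + v) = f"
        using padd[OF uvH] pu u(2) v(2)[symmetric] by (auto simp: V_def fun_eq_iff)
      then show ?thesis using uvH by (intro bexI[of _ "u + v"]) auto
    qed
    fix x y assume x: "x \<in> hcarrier H" and y: "y \<in> hcarrier H"
    have "hinner (block_sum ?J G') (V x) (V y) = hinner (G' a) (W (p x)) (W (p y))
        + (\<Sum>(i, k)\<in>J. hinner (G' i) (V x i k) (V y i k))"
      using J by (simp add: block_sum_inner V_def)
    also have "(\<Sum>(i, k)\<in>J. hinner (G' i) (V x i k) (V y i k))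
        = (\<Sum>(i, k)\<in>J. hinner (G i) (U (q x) i k) (U (q y) i k))"
    proof (rule sum.cong[OF refl])
      fix z assume z: "z \<in> J"
      obtain i k where ik: "z = (i, k)" by (cases z)
      then have "(i, k) \<noteq> (a, b)" using z J(1) by blast
      then show "(case z of (i, k) \<Rightarrow> hinner (G' i) (V x i k) (V y i k))
        = (case z of (i, k) \<Rightarrow> hinner (G i) (U (q x) i k) (U (q y) i k))"
        using agree[of i k] z ik by (auto simp: V_def)
    qed
    also have "\<dots> = hinner (block_sum J G) (U (q x)) (U (q y))" by (simp add: block_sum_inner)
    also have "\<dots> = hinner H (q x) (q y)" using UD(4)[OF q[OF x] q[OF y]] .
    also have "hinner (G' a) (W (p x)) (W (p y)) = hinner H (p x) (p y)" using WD(4)[OF p[OF x] p[OF y]] .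
    also have "hinner H (p x) (p y) + hinner H (q x) (q y) = hinner H x y"
      using hinner_split[OF x y] by (simp add: p_def q_def)
    finally show "hinner (block_sum ?J G') (V x) (V y) = hinner H x y" .
  qed
  moreover have "V (T x) = block_operator ?J S' (V x)" if x: "x \<in> hcarrier H" for x
  proof -
    have "V (T x) i k = block_operator ?J S' (V x) i k" for i k
    proof (cases "(i, k) = (a, b)")
      case True
      then show ?thesis using pT[OF x] W(2)[OF p[OF x]] by (simp add: V_def block_operator_def)
    next
      case False
      then show ?thesis using pT[OF x] U(2)[OF q[OF x]] agree[of i k]
        by (auto simp: V_def block_operator_def)
    qed
    then show ?thesis by (simp add: fun_eq_iff)
  qed
  ultimately show ?thesis unfolding unitarily_equivalent_def by blast
qed

section \<open>Existence of the decomposition\<close>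

lemma reducing_subspace_trans:
  assumes "hilbert_space H" "bounded_operator H H T"
    and M: "reducing_subspace H T M" and N: "reducing_subspace (hsub H M) T N"
  shows "reducing_subspace H T N"
proof -
  interpret reducing H T M using assms by (simp add: reducing_def reducing_axioms_def)
  interpret N: reducing "hsub H M" T N
    using N sub.hilbert_space_axioms bounded_sub by (simp add: reducing_def reducing_axioms_def)
  have NM: "N \<subseteq> M" using N.M_subset by simp
  have "closedin (htopology H) N"
  proof (rule closedin_carrierI)
    show "N \<subseteq> hcarrier H" using NM M_subset by blast
    fix x assume x: "x \<in> hcarrier H"
      and ap: "\<And>r. r > 0 \<Longrightarrow> \<exists>y\<in>N. y \<in> hcarrier H \<and> hnorm H (x - y) < r"
    have "x \<in> M" by (rule closure_absorb[OF closed x]) (use ap NM in blast)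
    then show "x \<in> N"
      by (intro sub.closure_absorb[OF N.closed]) (use ap NM in auto)
  qed
  moreover have "T x \<in> ortho_complement H N" if x: "x \<in> ortho_complement H N" for x
  proof -
    have xH: "x \<in> hcarrier H" using x ortho_complement_subset by blast
    let ?p = "hproj H M x" and ?q = "x - hproj H M x"
    note pq = hproj_mem[OF xH]
    have N0: "hinner H z y = 0" if "z \<in> ortho_complement H M" "y \<in> N" for z y
      using that NM by (auto simp: ortho_complement_def)
    have "hinner H ?p y = 0" if y: "y \<in> N" for y
    proof -
      have yH: "y \<in> hcarrier H" using y NM by auto
      have "hinner H x y = hinner H ?p y + hinner H ?q y"
        using inner_add_left[of ?p ?q y] xH yH by simp
      then show ?thesis using x y N0[OF pq(2) y] by (simp add: ortho_complement_def)
    qed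
    then have "?p \<in> ortho_complement (hsub H M) N" using pq(1) by (simp add: ortho_complement_def)
    then have "T ?p \<in> ortho_complement (hsub H M) N" by (rule N.invariant(2))
    then have Tp: "hinner H (T ?p) y = 0" if "y \<in> N" for y using that by (simp add: ortho_complement_def)
    have Tx: "T x = T ?p + T ?q" using linear_operatorD(2)[OF linear, of ?p ?q] xH by simp
    have "hinner H (T x) y = 0" if y: "y \<in> N" for y
      unfolding Tx using y NM xH T_carrier Tp[OF y] N0[OF invariant(2)[OF pq(2)] y]
      by (subst inner_add_left) auto
    then show ?thesis using T_carrier[OF xH] by (simp add: ortho_complement_def)
  qed
  moreover have "T ` N \<subseteq> N" using N.invariant(1) by blast
  ultimately show ?thesis unfolding reducing_subspace_def using NM M_subset N.subspace by blast
qed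

lemma reducing_subspace_carrier:
  assumes "hilbert_space H" "linear_operator H H T"
  shows "reducing_subspace H T (hcarrier H)"
proof -
  interpret hilbert_space H by fact
  have cl: "closedin (htopology H) (hcarrier H)" by (rule closedin_carrierI) auto
  interpret closed_subspace H "hcarrier H" by unfold_locales (rule subspace_carrier cl)+
  have "ortho_complement H (hcarrier H) = {0}" using ortho_complement_trivial by blast
  then show ?thesis unfolding reducing_subspace_def
    using subspace_carrier cl linear_operatorD(1)[OF assms(2)] linear_operator_zero[OF assms(2)] by auto
qed

text \<open>
  Passing to a nontrivial reducing subspace lowers the rank, because the complement has positive rank;
  so this descent ends with an irreducible restriction.
\<close>

lemma exists_irreducible_reducing_subspace:
  fixes \<Omega> :: "complex set"
  assumes \<Omega>: "connected \<Omega>" "\<Omega> \<noteq> {}"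
  shows "cowen_douglas \<Omega> n H T \<Longrightarrow>
    \<exists>M. M \<noteq> {0} \<and> reducing_subspace H T M \<and> irreducible_operator (hsub H M) T"
proof (induction n arbitrary: H rule: less_induct)
  case (less n)
  note CD = less.prems
  have H: "hilbert_space H" "bounded_operator H H T" "linear_operator H H T"
    using cowen_douglas_hilbert[OF CD] cowen_douglas_bounded[OF CD] cowen_douglas_linear[OF CD] by auto
  show ?case
  proof (cases "irreducible_operator H T")
    case True
    have "hcarrier H \<noteq> {0}"
    proof
      assume H0: "hcarrier H = {0}"
      obtain \<mu> where "\<mu> \<in> \<Omega>" using \<Omega> by blast
      then show False using cowen_douglas_eigenvector[OF CD] H0 unfolding eigenspace_def by blast
    qed
    then show ?thesis using True reducing_subspace_carrier[OF H(1,3)] by (intro exI[of _ "hcarrier H"]) simp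
  next
    case False
    then obtain M where M: "reducing_subspace H T M" "M \<noteq> {0}" "M \<noteq> hcarrier H"
      unfolding irreducible_operator_def by blast
    interpret reducing H T M using H M by (simp add: reducing_def reducing_axioms_def)
    have oc0: "ortho_complement H M \<noteq> {0}" using M(3) ortho_complement_trivial by blast
    obtain k where k: "cowen_douglas \<Omega> k (hsub H M) T"
      "cowen_douglas \<Omega> (n - k) (hsub H (ortho_complement H M)) T"
      using cowen_douglas_reducing[OF \<Omega> CD M(1)] M(2) oc0 by metis
    have "k < n" using cowen_douglas_pos[OF k(2)] by simp
    then obtain N where N: "N \<noteq> {0}" "reducing_subspace (hsub H M) T N" "irreducible_operator (hsub (hsub H M) N) T"
      using less.IH[OF _ k(1)] by blast
    then show ?thesis using reducing_subspace_trans[OF H(1,2) M(1) N(2)] by (intro exI[of _ N]) simp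
  qed
qed

text \<open>
  If the restriction to \<open>M\<close> is equivalent to a summand of the complement, it becomes an additional copy
  of it; the ranks agree because they are unitary invariants. Otherwise it is a new summand of
  multiplicity 1.
\<close>

lemma IR_decomposition_insert:
  fixes H :: "'a::complex_vector hilbert" and G :: "nat \<Rightarrow> 'a hilbert"
  assumes red: "reducing H T M" and CD: "cowen_douglas \<Omega> k (hsub H M) T"
    and irr: "irreducible_operator (hsub H M) T" and \<Omega>: "\<Omega> \<noteq> {}"
    and IR: "IR_decomposition \<Omega> l (hsub H (ortho_complement H M)) T t G S m d"
  shows "\<exists>t (G :: nat \<Rightarrow> 'a hilbert) S m d. IR_decomposition \<Omega> (k + l) H T t G S m d"
proof -
  note IRb = IR[unfolded IR_decomposition_blocks]
  obtain U where U: "unitary_operator (hsub H (ortho_complement H M)) (block_sum (blocks t m) G) U"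
      "\<And>x. x \<in> ortho_complement H M \<Longrightarrow> U (T x) = block_operator (blocks t m) S (U x)"
    using IRb unfolding unitarily_equivalent_def by auto
  have parts: "\<And>i. i \<in> {1..t} \<Longrightarrow> m i > 0 \<and> cowen_douglas \<Omega> (d i) (G i) (S i) \<and> irreducible_operator (G i) (S i)"
    and sum: "(\<Sum>i=1..t. m i * d i) = l"
    and ineq: "\<And>i j. \<lbrakk>i \<in> {1..t}; j \<in> {1..t}; i \<noteq> j\<rbrakk> \<Longrightarrow> \<not> unitarily_equivalent (G i) (S i) (G j) (S j)"
    using IRb by blast+
  show ?thesis
  proof (cases "\<exists>i\<in>{1..t}. unitarily_equivalent (hsub H M) T (G i) (S i)")
    case True
    then obtain i where i: "i \<in> {1..t}" "unitarily_equivalent (hsub H M) T (G i) (S i)" by blast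
    obtain W where W: "unitary_operator (hsub H M) (G i) W" "\<And>x. x \<in> M \<Longrightarrow> W (T x) = S i (W x)"
      using i(2) unfolding unitarily_equivalent_def by auto
    let ?m = "m(i := Suc (m i))"
    have J: "blocks t ?m = insert (i, Suc (m i)) (blocks t m)"
      using i(1) by (auto split: if_splits)
    have eq: "unitarily_equivalent H T (block_sum (blocks t ?m) G) (block_operator (blocks t ?m) S)"
      unfolding J by (rule unitarily_equivalent_insert_block[where G' = G and S' = S and a = i, OF red U W]) auto
    have "d i = k"
      using cowen_douglas_rank_le[OF CD _ \<Omega> i(2)] parts[OF i(1)]
        cowen_douglas_rank_le[OF _ CD \<Omega> unitarily_equivalent_sym[OF cowen_douglas_hilbert[OF CD]
            cowen_douglas_linear[OF CD] i(2)]] by (meson le_antisym)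
    moreover have "(\<Sum>j=1..t. ?m j * d j) = (\<Sum>j=1..t. m j * d j + (if j = i then d j else 0))"
      by (rule sum.cong) auto
    ultimately have "(\<Sum>j=1..t. ?m j * d j) = k + l"
      using i(1) sum by (simp add: sum.distrib)
    then have "IR_decomposition \<Omega> (k + l) H T t G S ?m d"
      unfolding IR_decomposition_blocks using eq parts ineq by simp
    then show ?thesis by blast
  next
    case False
    let ?G = "G(Suc t := hsub H M)" and ?S = "S(Suc t := T)" and ?m = "m(Suc t := 1)"
      and ?d = "d(Suc t := k)"
    have J: "blocks (Suc t) ?m = insert (Suc t, 1) (blocks t m)"
      by (auto split: if_splits simp: le_Suc_eq)
    have new_block: "unitary_operator (hsub H M) (?G (Suc t)) id" "\<And>x. x \<in> M \<Longrightarrow> id (T x) = ?S (Suc t) (id x)"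
      by (simp_all add: unitary_operator_def linear_operator_def)
    have "unitarily_equivalent H T (block_sum (blocks (Suc t) ?m) ?G) (block_operator (blocks (Suc t) ?m) ?S)"
      unfolding J
      by (rule unitarily_equivalent_insert_block[where G' = ?G and S' = ?S and a = "Suc t", OF red U new_block]) auto
    moreover have "?m i > 0 \<and> cowen_douglas \<Omega> (?d i) (?G i) (?S i) \<and> irreducible_operator (?G i) (?S i)"
      if "i \<in> {1..Suc t}" for i
      using that parts[of i] CD irr by (cases "i = Suc t") auto
    moreover have "(\<Sum>j=1..Suc t. ?m j * ?d j) = k + l"
      using sum by simp
    moreover have "\<not> unitarily_equivalent (?G i) (?S i) (?G j) (?S j)"
      if ij: "i \<in> {1..Suc t}" "j \<in> {1..Suc t}" "i \<noteq> j" for i j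
    proof -
      have new: "\<not> unitarily_equivalent (hsub H M) T (G i) (S i)" if "i \<in> {1..t}" for i
        using False that by blast
      have new': "\<not> unitarily_equivalent (G i) (S i) (hsub H M) T" if "i \<in> {1..t}" for i
        using new[OF that] parts[OF that] unitarily_equivalent_sym
          cowen_douglas_hilbert cowen_douglas_linear by blast
      show ?thesis using ij new[of j] new'[of i] ineq[of i j]
        by (cases "i = Suc t"; cases "j = Suc t") auto
    qed
    ultimately have "IR_decomposition \<Omega> (k + l) H T (Suc t) ?G ?S ?m ?d"
      unfolding IR_decomposition_blocks by blast
    then show ?thesis by blast
  qed
qed

text \<open>
  The induction ends with the empty sum, which occurs when an irreducible restriction exhausts the space.
\<close>

lemma IR_decomposition_zero:
  assumes "hcarrier H = {0}" "hinner H 0 0 = 0" "T 0 = 0"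
  shows "IR_decomposition \<Omega> 0 H T 0 G S m d"
proof -
  have carrier: "hcarrier (block_sum {} G) = {0}"
    by (auto simp: block_sum_def fun_eq_iff)
  have "unitary_operator H (block_sum {} G) (\<lambda>_. 0)"
    unfolding unitary_operator_def linear_operator_def carrier assms(1) bij_betw_def
    using assms(2) by (simp add: block_sum_inner)
  moreover have "block_operator {} S f = 0" for f by (simp add: block_operator_def fun_eq_iff)
  ultimately have "unitarily_equivalent H T (block_sum {} G) (block_operator {} S)"
    unfolding unitarily_equivalent_def by (intro exI[of _ "\<lambda>_. 0"]) simp
  then show ?thesis unfolding IR_decomposition_blocks by simp
qed

lemma IR_decomposition_exists:
  fixes \<Omega> :: "complex set" and H :: "'a::complex_vector hilbert"
  assumes \<Omega>: "connected \<Omega>" "\<Omega> \<noteq> {}"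
  shows "cowen_douglas \<Omega> n H T \<Longrightarrow>
    \<exists>t (G :: nat \<Rightarrow> 'a hilbert) S m d. IR_decomposition \<Omega> n H T t G S m d"
proof (induction n arbitrary: H rule: less_induct)
  case (less n)
  note CD = less.prems
  note H = cowen_douglas_hilbert[OF CD] cowen_douglas_bounded[OF CD]
  obtain M where M: "M \<noteq> {0}" "reducing_subspace H T M" "irreducible_operator (hsub H M) T"
    using exists_irreducible_reducing_subspace[OF \<Omega> CD] by blast
  interpret reducing H T M using H M by (simp add: reducing_def reducing_axioms_def)
  let ?N = "ortho_complement H M"
  obtain k where k: "cowen_douglas \<Omega> k (hsub H M) T" "k \<le> n"
    "?N \<noteq> {0} \<Longrightarrow> cowen_douglas \<Omega> (n - k) (hsub H ?N) T" "?N = {0} \<Longrightarrow> k = n"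
    using cowen_douglas_reducing[OF \<Omega> CD M(2)] M(1) by metis
  have "\<exists>t (G :: nat \<Rightarrow> 'a hilbert) S m d. IR_decomposition \<Omega> (n - k) (hsub H ?N) T t G S m d"
  proof (cases "?N = {0}")
    case True
    then show ?thesis
      using k(4)[OF True] IR_decomposition_zero[of "hsub H ?N" T] linear_operator_zero[OF linear]
      by (auto intro!: exI)
  next
    case False
    have "n - k < n" using cowen_douglas_pos[OF k(1)] k(2) by simp
    then show ?thesis using less.IH k(3)[OF False] by blast
  qed
  then show ?case
    using IR_decomposition_insert[OF reducing_axioms k(1) M(3) \<Omega>(2)] k(2) by fastforce
qed

section \<open>Schur's lemma\<close>

text \<open>
  For the polynomials \<open>p\<close> let \<open>W p\<close> be the value at \<open>v0\<close> of the operator \<open>p\<close> of \<open>Z\<close>. As the vectors \<open>e k\<close>, the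
  iterates of \<open>Z\<close> on \<open>v0\<close>, are dependent, some nonzero polynomial has \<open>W p = 0\<close>. In one of least
  degree a linear factor with root \<open>c\<close> can be split off, and the value \<open>W q\<close> of the cofactor \<open>q\<close>
  is nonzero and annihilated by \<open>Z - c\<close>.
\<close>

lemma exists_eigenvector:
  fixes V :: "'a::complex_vector set"
  assumes V: "complex_vector.subspace V" "finite_dimensional V"
    and Z: "\<And>x. x \<in> V \<Longrightarrow> Z x \<in> V" "\<And>x y. x \<in> V \<Longrightarrow> y \<in> V \<Longrightarrow> Z (x + y) = Z x + Z y"
      "\<And>c x. x \<in> V \<Longrightarrow> Z (c *\<^sub>C x) = c *\<^sub>C Z x"
    and v0: "v0 \<in> V" "v0 \<noteq> 0"
  obtains c v where "v \<in> V" "v \<noteq> 0" "Z v = c *\<^sub>C v"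
proof -
  define e where "e k = (Z ^^ k) v0" for k
  have e_Suc: "e (Suc k) = Z (e k)" for k by (simp add: e_def)
  have eV: "e k \<in> V" for k
  proof (induction k)
    case 0 then show ?case using v0 by (simp add: e_def)
  next
    case (Suc k) then show ?case using Z(1) by (simp add: e_Suc)
  qed
  have combV: "(\<Sum>i\<in>I. c i *\<^sub>C e i) \<in> V" for I c
    using V(1) eV by (intro complex_vector.subspace_sum complex_vector.subspace_scale) auto
  have Z_comb: "Z (\<Sum>i\<le>N. c i *\<^sub>C e i) = (\<Sum>i\<le>N. c i *\<^sub>C e (Suc i))" for N and c :: "nat \<Rightarrow> complex"
  proof (induction N)
    case 0 then show ?case using Z(3)[OF eV] by (simp add: e_Suc)
  next
    case (Suc N)
    have "Z (\<Sum>i\<le>Suc N. c i *\<^sub>C e i) = Z ((\<Sum>i\<le>N. c i *\<^sub>C e i) + c (Suc N) *\<^sub>C e (Suc N))" by simp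
    also have "\<dots> = Z (\<Sum>i\<le>N. c i *\<^sub>C e i) + Z (c (Suc N) *\<^sub>C e (Suc N))"
      by (rule Z(2)[OF combV complex_vector.subspace_scale[OF V(1) eV]])
    finally show ?case unfolding Suc Z(3)[OF eV] by (simp add: e_Suc)
  qed
  define W where "W p = (\<Sum>i\<le>degree p. coeff p i *\<^sub>C e i)" for p
  have WV: "W p \<in> V" for p unfolding W_def by (rule combV)
  have W_bound: "W p = (\<Sum>i\<le>N. coeff p i *\<^sub>C e i)" if "degree p \<le> N" for p N
    unfolding W_def using that by (intro sum.mono_neutral_left) (auto simp: coeff_eq_0)
  have W_factor: "W ([:-c, 1:] * q) = Z (W q) - c *\<^sub>C W q" for c q
  proof -
    have pq: "[:-c, 1:] * q = pCons 0 q - smult c q" by simp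
    have "degree ([:-c, 1:] * q) \<le> Suc (degree q)"
      using degree_mult_le[of "[:-c, 1:]" q] by simp
    then have "W ([:-c, 1:] * q) = (\<Sum>i\<le>Suc (degree q). coeff ([:-c, 1:] * q) i *\<^sub>C e i)" by (rule W_bound)
    also have "\<dots> = (\<Sum>i\<le>Suc (degree q). coeff (pCons 0 q) i *\<^sub>C e i - c *\<^sub>C coeff q i *\<^sub>C e i)"
      unfolding pq by (intro sum.cong refl) (simp add: complex_vector.scale_left_diff_distrib scaleC_scaleC)
    also have "\<dots> = (\<Sum>i\<le>Suc (degree q). coeff (pCons 0 q) i *\<^sub>C e i)
        - c *\<^sub>C (\<Sum>i\<le>Suc (degree q). coeff q i *\<^sub>C e i)"
      by (simp only: sum_subtractf complex_vector.scale_sum_right)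
    also have "(\<Sum>i\<le>Suc (degree q). coeff q i *\<^sub>C e i) = W q" by (rule W_bound[symmetric]) simp
    also have "(\<Sum>i\<le>Suc (degree q). coeff (pCons 0 q) i *\<^sub>C e i) = (\<Sum>i\<le>degree q. coeff q i *\<^sub>C e (Suc i))"
      by (subst sum.atMost_Suc_shift) simp
    also have "\<dots> = Z (W q)" unfolding W_def by (rule Z_comb[symmetric])
    finally show ?thesis .
  qed
  have "\<exists>p. p \<noteq> 0 \<and> W p = 0"
  proof -
    obtain C where C: "finite C" "V \<subseteq> complex_vector.span C" using V(2) finite_dimensional_def by blast
    define N where "N = card C"
    show ?thesis
    proof (cases "inj_on e {..N}")
      case True
      have "complex_vector.dependent (e ` {..N})"
      proof (rule ccontr)
        assume "\<not> complex_vector.dependent (e ` {..N})"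
        then have "card (e ` {..N}) \<le> card C"
          using complex_vector.independent_span_bound[OF C(1)] C(2) eV by blast
        then show False using card_image[OF True] by (simp add: N_def)
      qed
      then obtain u where u: "\<exists>v\<in>e ` {..N}. u v \<noteq> 0" "(\<Sum>v\<in>e ` {..N}. u v *\<^sub>C v) = 0"
        by (subst (asm) complex_vector.dependent_finite) auto
      define p where "p = (\<Sum>k\<le>N. monom (u (e k)) k)"
      have cp: "coeff p i = (if i \<le> N then u (e i) else 0)" for i
        unfolding p_def by (simp add: coeff_sum)
      have "degree p \<le> N" by (rule degree_le) (simp add: cp)
      then have "W p = (\<Sum>i\<le>N. coeff p i *\<^sub>C e i)" by (rule W_bound)
      also have "\<dots> = (\<Sum>v\<in>e ` {..N}. u v *\<^sub>C v)" by (simp add: sum.reindex[OF True] cp)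
      finally have "W p = 0" using u(2) by simp
      moreover obtain k where "k \<le> N" "u (e k) \<noteq> 0" using u(1) by auto
      then have "coeff p k \<noteq> 0" by (simp add: cp)
      then have "p \<noteq> 0" by auto
      ultimately show ?thesis by blast
    next
      case False
      then obtain i j where ij: "i \<le> N" "j \<le> N" "e i = e j" "i \<noteq> j" unfolding inj_on_def by auto
      define p :: "complex poly" where "p = monom 1 i - monom 1 j"
      have cp: "coeff p k = (if k = i then 1 else 0) - (if k = j then 1 else 0)" for k
        by (auto simp: p_def)
      have "degree p \<le> N" by (rule degree_le) (use ij in \<open>auto simp: cp\<close>)
      then have "W p = (\<Sum>k\<le>N. coeff p k *\<^sub>C e k)" by (rule W_bound)
      also have "\<dots> = (\<Sum>k\<le>N. (if k = i then e i else 0) - (if k = j then e j else 0))"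
        by (rule sum.cong[OF refl]) (auto simp: cp scaleC_one)
      also have "\<dots> = e i - e j" using ij(1,2) by (simp add: sum_subtractf)
      finally have "W p = 0" using ij(3) by simp
      moreover have "coeff p i \<noteq> 0" using ij(4) by (simp add: cp)
      then have "p \<noteq> 0" by auto
      ultimately show ?thesis by blast
    qed
  qed
  then have "\<exists>n p. p \<noteq> 0 \<and> W p = 0 \<and> degree p = n" by blast
  from LeastI_ex[OF this] obtain p where p: "p \<noteq> 0" "W p = 0"
    "degree p = (LEAST n. \<exists>p. p \<noteq> 0 \<and> W p = 0 \<and> degree p = n)" by blast
  have min: "degree p \<le> degree q" if "q \<noteq> 0" "W q = 0" for q
    unfolding p(3) using that by (intro Least_le) blast
  have "degree p \<noteq> 0"
  proof
    assume "degree p = 0"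
    then obtain a where a: "p = [:a:]" by (rule degree_eq_zeroE)
    then have "a *\<^sub>C v0 = 0" using p(2) by (simp add: W_def e_def)
    then show False using v0 a p(1) by simp
  qed
  then obtain c where "poly p c = 0"
    using fundamental_theorem_of_algebra constant_degree by metis
  then obtain q where q: "p = [:-c, 1:] * q" unfolding poly_eq_0_iff_dvd by (rule dvdE)
  then have q0: "q \<noteq> 0" using p(1) by auto
  have "degree p = Suc (degree q)" unfolding q using q0 by (subst degree_mult_eq) auto
  then have "W q \<noteq> 0" using min[OF q0] by auto
  moreover have "Z (W q) = c *\<^sub>C W q" using p(2) W_factor[of c q] unfolding q by simp
  ultimately show thesis using that WV by blast
qed

context hilbert_space
begin

lemma subspace_closure:
  assumes A: "complex_vector.subspace A" "A \<subseteq> hcarrier H"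
  shows "complex_vector.subspace (htopology H closure_of A)"
proof (rule complex_vector.subspaceI)
  note A' = complex_vector.subspace_0[OF A(1)] complex_vector.subspace_add[OF A(1)] complex_vector.subspace_scale[OF A(1)]
  show "0 \<in> htopology H closure_of A" unfolding in_closure_iff using A'(1) by (auto intro!: bexI[of _ 0])
  fix x y assume xy: "x \<in> htopology H closure_of A" "y \<in> htopology H closure_of A"
  then have H: "x \<in> hcarrier H" "y \<in> hcarrier H" by (auto simp: in_closure_iff)
  show "x + y \<in> htopology H closure_of A"
    unfolding in_closure_iff
  proof (intro conjI allI impI)
    show "x + y \<in> hcarrier H" using H by simp
    fix r :: real assume r: "r > 0"
    then have "r / 2 > 0" by simp
    then obtain a b where ab: "a \<in> A" "hnorm H (x - a) < r/2" "b \<in> A" "hnorm H (y - b) < r/2"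
      using xy unfolding in_closure_iff by meson
    have abH: "a \<in> hcarrier H" "b \<in> hcarrier H" using ab A(2) by auto
    have e: "x + y - (a + b) = (x - a) + (y - b)" by simp
    have "hnorm H (x + y - (a + b)) < r"
      unfolding e using triangle_ineq[of "x - a" "y - b"] H abH ab by simp
    then show "\<exists>z\<in>A. z \<in> hcarrier H \<and> hnorm H (x + y - z) < r"
      using A'(2)[OF ab(1,3)] abH by (intro bexI[of _ "a + b"]) auto
  qed
next
  note A' = complex_vector.subspace_scale[OF A(1)]
  fix c x assume x: "x \<in> htopology H closure_of A"
  then have H: "x \<in> hcarrier H" by (auto simp: in_closure_iff)
  show "c *\<^sub>C x \<in> htopology H closure_of A"
    unfolding in_closure_iff
  proof (intro conjI allI impI)
    show "c *\<^sub>C x \<in> hcarrier H" using H by simp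
    fix r :: real assume r: "r > 0"
    then have "r / (cmod c + 1) > 0" by (simp add: add_nonneg_pos)
    then obtain a where a: "a \<in> A" "hnorm H (x - a) < r / (cmod c + 1)"
      using x unfolding in_closure_iff by meson
    have aH: "a \<in> hcarrier H" using a A(2) by auto
    have "hnorm H (c *\<^sub>C x - c *\<^sub>C a) = cmod c * hnorm H (x - a)"
      using hnorm_scale[of "x - a" c] H aH by (simp add: complex_vector.scale_right_diff_distrib)
    also have "\<dots> \<le> (cmod c + 1) * hnorm H (x - a)" using H aH by (intro mult_right_mono) auto
    also have "\<dots> < r"
      using a(2) pos_less_divide_eq[of "cmod c + 1"] by (simp add: add_nonneg_pos mult.commute)
    finally show "\<exists>z\<in>A. z \<in> hcarrier H \<and> hnorm H (c *\<^sub>C x - z) < r"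
      using A'[OF a(1)] aH by (intro bexI[of _ "c *\<^sub>C a"]) auto
  qed
qed

lemma closure_invariant:
  assumes S: "bounded_operator H H S" "S ` A \<subseteq> A"
  shows "S ` (htopology H closure_of A) \<subseteq> htopology H closure_of A"
proof
  fix y assume "y \<in> S ` (htopology H closure_of A)"
  then obtain x where x: "x \<in> htopology H closure_of A" and y: "y = S x" by blast
  have xH: "x \<in> hcarrier H" using x by (simp add: in_closure_iff)
  note lin = bounded_operator_linear[OF S(1)]
  obtain B where B: "B > 0" "\<And>x. x \<in> hcarrier H \<Longrightarrow> hnorm H (S x) \<le> B * hnorm H x"
    using bounded_operator_bound[OF S(1)] by blast
  show "y \<in> htopology H closure_of A"
    unfolding in_closure_iff y
  proof (intro conjI allI impI)
    show "S x \<in> hcarrier H" using linear_operatorD(1)[OF lin xH] .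
    fix r :: real assume "r > 0"
    then have "r / B > 0" using B(1) by simp
    then obtain a where a: "a \<in> A" "a \<in> hcarrier H" "hnorm H (x - a) < r / B"
      using x unfolding in_closure_iff by meson
    have "hnorm H (S x - S a) \<le> B * hnorm H (x - a)"
      using B(2)[of "x - a"] linear_operator_diff[OF lin xH a(2)] xH a(2) by simp
    also have "\<dots> < r" using a(3) B(1) by (simp add: field_simps)
    finally show "\<exists>z\<in>A. z \<in> hcarrier H \<and> hnorm H (S x - z) < r"
      using a S(2) linear_operatorD(1)[OF lin a(2)] by (intro bexI[of _ "S a"]) auto
  qed
qed

lemma ortho_complement_closure:
  assumes "A \<subseteq> hcarrier H"
  shows "ortho_complement H (htopology H closure_of A) = ortho_complement H A"
proof
  show "ortho_complement H (htopology H closure_of A) \<subseteq> ortho_complement H A"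
    using closure_of_subset[of A "htopology H"] assms by (auto simp: ortho_complement_def htopology_eq)
  show "ortho_complement H A \<subseteq> ortho_complement H (htopology H closure_of A)"
  proof
    fix x assume x: "x \<in> ortho_complement H A"
    then have xH: "x \<in> hcarrier H" by (simp add: ortho_complement_def)
    have "A \<subseteq> ortho_complement H {x}"
      using x assms inner_commute[OF _ xH] by (auto simp: ortho_complement_def)
    then have "htopology H closure_of A \<subseteq> ortho_complement H {x}"
      using closedin_ortho_complement[of "{x}"] xH by (intro closure_of_minimal) auto
    then have "hinner H x y = 0" if "y \<in> htopology H closure_of A" for y
      using that inner_commute[OF xH, of y] by (auto simp: ortho_complement_def)
    then show "x \<in> ortho_complement H (htopology H closure_of A)"
      using xH by (simp add: ortho_complement_def)
  qed
qed

end

text \<open>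
  The closed range of \<open>D = Z - c\<close> reduces \<open>S\<close>: it is invariant because \<open>S\<close> commutes with \<open>D\<close>, and its
  orthogonal complement, the kernel of the self-adjoint \<open>D\<close>, is invariant for the same reason. (Starting
  from the kernel one would need the adjoint of \<open>S\<close> to see that its complement is invariant.) By
  irreducibility the range is zero, because its complement contains \<open>v\<close>.
\<close>

lemma self_adjoint_commutant_scalar:
  assumes "hilbert_space H" and S: "bounded_operator H H S" and irr: "irreducible_operator H S"
    and Z: "linear_operator H H Z"
    and adj: "\<And>x y. \<lbrakk>x \<in> hcarrier H; y \<in> hcarrier H\<rbrakk> \<Longrightarrow> hinner H (Z x) y = hinner H x (Z y)"
    and comm: "\<And>x. x \<in> hcarrier H \<Longrightarrow> Z (S x) = S (Z x)"
    and v: "v \<in> hcarrier H" "v \<noteq> 0" "Z v = complex_of_real c *\<^sub>C v"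
    and x: "x \<in> hcarrier H"
  shows "Z x = complex_of_real c *\<^sub>C x"
proof -
  interpret hilbert_space H by fact
  note SD = linear_operatorD[OF bounded_operator_linear[OF S]]
  note ZD = linear_operatorD[OF Z]
  define D where "D x = Z x - complex_of_real c *\<^sub>C x" for x
  have D: "linear_operator H H D" unfolding D_def by (rule linear_operator_shift[OF assms(1) Z])
  note DD = linear_operatorD[OF D]
  have Dadj: "hinner H (D x) y = hinner H x (D y)" if "x \<in> hcarrier H" "y \<in> hcarrier H" for x y
    using that ZD(1) adj by (simp add: D_def inner_diff_left inner_diff_right inner_scale_left inner_scale_right)
  have SDc: "S (D x) = D (S x)" if "x \<in> hcarrier H" for x
    using linear_operator_diff[OF bounded_operator_linear[OF S], of "Z x" "complex_of_real c *\<^sub>C x"]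
      that ZD(1) SD(3) comm by (simp add: D_def)
  let ?A = "D ` hcarrier H"
  let ?R = "htopology H closure_of ?A"
  have AH: "?A \<subseteq> hcarrier H" using DD(1) by blast
  have "complex_vector.subspace ?A"
  proof (rule complex_vector.subspaceI)
    show "0 \<in> ?A" using linear_operator_zero[OF D] by (intro image_eqI[of _ _ 0]) auto
    show "a + b \<in> ?A" if "a \<in> ?A" "b \<in> ?A" for a b
      using that by clarify (metis DD(2) add_mem imageI)
    show "k *\<^sub>C a \<in> ?A" if "a \<in> ?A" for k a
      using that by clarify (metis DD(3) scale_mem imageI)
  qed
  then have subR: "complex_vector.subspace ?R" by (rule subspace_closure[OF _ AH])
  have oc: "ortho_complement H ?R = {x \<in> hcarrier H. D x = 0}"
    unfolding ortho_complement_closure[OF AH]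
  proof (intro set_eqI iffI)
    fix x assume "x \<in> ortho_complement H ?A"
    then have x: "x \<in> hcarrier H" "\<And>y. y \<in> hcarrier H \<Longrightarrow> hinner H x (D y) = 0" by (auto simp: ortho_complement_def)
    then have "hinner H (D x) (D x) = 0" using Dadj[of x "D x"] DD(1)[OF x(1)] by simp
    then show "x \<in> {x \<in> hcarrier H. D x = 0}" using inner_definite DD(1) x(1) by simp
  next
    fix x assume x: "x \<in> {x \<in> hcarrier H. D x = 0}"
    then have "hinner H x (D y) = 0" if "y \<in> hcarrier H" for y
      using Dadj[of x y] that by simp
    then show "x \<in> ortho_complement H ?A" using x by (auto simp: ortho_complement_def)
  qed
  have "S ` ?A \<subseteq> ?A" using SDc SD(1) by auto
  then have invR: "S ` ?R \<subseteq> ?R" by (rule closure_invariant[OF S])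
  have "S ` {x \<in> hcarrier H. D x = 0} \<subseteq> {x \<in> hcarrier H. D x = 0}"
    using SD(1) SDc linear_operator_zero[OF bounded_operator_linear[OF S]] by force
  then have red: "reducing_subspace H S ?R"
    unfolding reducing_subspace_def oc using subR invR in_closure_iff by auto
  have "v \<in> ortho_complement H ?R" unfolding oc using v by (simp add: D_def)
  then have "?R \<noteq> hcarrier H" using ortho_complement_Int[of v "hcarrier H"] v by metis
  then have "?R = {0}" using irr red unfolding irreducible_operator_def by blast
  moreover have "D x \<in> ?R" using closure_of_subset[of ?A "htopology H"] AH x by (auto simp: htopology_eq)
  ultimately have "D x = 0" by blast
  then show ?thesis by (simp add: D_def)
qed

text \<open>
  The product \<open>Y X\<close> is self-adjoint and commutes with \<open>S\<close>, so it acts on a finite-dimensional eigenspace of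
  \<open>S\<close> and has an eigenvector \<open>v\<close> there. The eigenvalue is the quotient of the squared norms of \<open>X v\<close>
  and \<open>v\<close>, a nonnegative real number.
\<close>

lemma schur_scalar:
  assumes G: "cowen_douglas \<Omega> k G S" "irreducible_operator G S" and \<Omega>: "\<Omega> \<noteq> {}"
    and K: "hilbert_space K"
    and X: "linear_operator G K X" and Y: "linear_operator K G Y"
    and adj: "\<And>x y. \<lbrakk>x \<in> hcarrier G; y \<in> hcarrier K\<rbrakk> \<Longrightarrow> hinner K (X x) y = hinner G x (Y y)"
    and XS: "\<And>x. x \<in> hcarrier G \<Longrightarrow> X (S x) = R (X x)"
    and YR: "\<And>y. y \<in> hcarrier K \<Longrightarrow> Y (R y) = S (Y y)"
  obtains c where "c \<ge> 0" "\<And>x. x \<in> hcarrier G \<Longrightarrow> Y (X x) = complex_of_real c *\<^sub>C x"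
proof -
  interpret G: hilbert_space G using cowen_douglas_hilbert[OF G(1)] .
  interpret K: hilbert_space K by fact
  note SD = linear_operatorD[OF cowen_douglas_linear[OF G(1)]]
  note XD = linear_operatorD[OF X] and YD = linear_operatorD[OF Y]
  define Z where "Z x = Y (X x)" for x
  have Z: "linear_operator G G Z" using XD YD by (simp add: linear_operator_def Z_def)
  note ZD = linear_operatorD[OF Z]
  have comm: "Z (S x) = S (Z x)" if "x \<in> hcarrier G" for x using XS YR XD(1) that by (simp add: Z_def)
  have Zadj: "hinner G (Z x) y = hinner G x (Z y)" if xy: "x \<in> hcarrier G" "y \<in> hcarrier G" for x y
  proof -
    have "hinner G (Z x) y = cnj (hinner G y (Y (X x)))"
      unfolding Z_def using xy XD(1) YD(1) by (intro G.inner_commute) auto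
    also have "\<dots> = cnj (hinner K (X y) (X x))" using adj xy XD(1) by simp
    also have "\<dots> = hinner K (X x) (X y)" using K.inner_commute[of "X x" "X y"] xy XD(1) by simp
    also have "\<dots> = hinner G x (Z y)" unfolding Z_def using adj xy XD(1) by simp
    finally show ?thesis .
  qed
  obtain \<mu> where \<mu>: "\<mu> \<in> \<Omega>" using \<Omega> by blast
  interpret E: closed_subspace G "eigenspace G S \<mu>"
    by (rule closed_subspace_eigenspace[OF G.hilbert_space_axioms cowen_douglas_bounded[OF G(1)]])
  obtain v0 where v0: "v0 \<in> eigenspace G S \<mu>" "v0 \<noteq> 0"
    using cowen_douglas_eigenvector[OF G(1) \<mu>] .
  have EG: "x \<in> hcarrier G" if "x \<in> eigenspace G S \<mu>" for x using that by simp
  have ZE: "Z x \<in> eigenspace G S \<mu>" if x: "x \<in> eigenspace G S \<mu>" for x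
  proof -
    have xG: "x \<in> hcarrier G" and Sx: "S x = \<mu> *\<^sub>C x" using x unfolding eigenspace_def by auto
    have "S (Z x) = \<mu> *\<^sub>C Z x" using comm[OF xG] ZD(3)[OF xG] Sx by simp
    then show ?thesis using ZD(1)[OF xG] unfolding eigenspace_def by simp
  qed
  obtain a v where v: "v \<in> eigenspace G S \<mu>" "v \<noteq> 0" "Z v = a *\<^sub>C v"
    using exists_eigenvector[OF E.subspace cowen_douglas_finite_dimensional[OF G(1) \<mu>], of Z v0]
      ZE ZD(2,3) EG v0 by metis
  have vG: "v \<in> hcarrier G" using EG v(1) .
  have nv: "hnorm G v > 0" using G.hnorm_eq_0[OF vG] G.hnorm_nonneg[OF vG] v(2) by (auto simp: less_le)
  define c where "c = (hnorm K (X v))\<^sup>2 / (hnorm G v)\<^sup>2"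
  have "complex_of_real ((hnorm K (X v))\<^sup>2) = hinner G v (Z v)"
    using adj[of v "X v"] vG XD(1) K.inner_self[of "X v"] by (simp add: Z_def)
  also have "\<dots> = cnj a * complex_of_real ((hnorm G v)\<^sup>2)"
    unfolding v(3) using vG by (simp add: G.inner_scale_right G.inner_self)
  finally have "cnj a = complex_of_real c" using nv by (simp add: c_def field_simps)
  then have a: "a = complex_of_real c" by (metis complex_cnj_cnj complex_cnj_complex_of_real)
  show thesis
  proof (rule that[of c])
    show "c \<ge> 0" by (simp add: c_def)
    fix x assume "x \<in> hcarrier G"
    then have "Z x = complex_of_real c *\<^sub>C x"
      using self_adjoint_commutant_scalar[OF G.hilbert_space_axioms cowen_douglas_bounded[OF G(1)] G(2) Z
        Zadj comm vG v(2)] v(3) a by blast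
    then show "Y (X x) = complex_of_real c *\<^sub>C x" by (simp add: Z_def)
  qed
qed

text \<open>
  Both products of \<open>X\<close> and its adjoint \<open>Y\<close> are scalar, and the scalars agree since \<open>X Y X\<close> can be
  computed in two ways. If the scalar \<open>c\<close> is nonzero, \<open>X / sqrt c\<close> is unitary.
\<close>

lemma schur_intertwiner:
  assumes G: "cowen_douglas \<Omega> k G S" "irreducible_operator G S"
    and K: "cowen_douglas \<Omega> l K R" "irreducible_operator K R" and \<Omega>: "\<Omega> \<noteq> {}"
    and X: "linear_operator G K X" and Y: "linear_operator K G Y"
    and adj: "\<And>x y. \<lbrakk>x \<in> hcarrier G; y \<in> hcarrier K\<rbrakk> \<Longrightarrow> hinner K (X x) y = hinner G x (Y y)"
    and XS: "\<And>x. x \<in> hcarrier G \<Longrightarrow> X (S x) = R (X x)"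
    and YR: "\<And>y. y \<in> hcarrier K \<Longrightarrow> Y (R y) = S (Y y)"
  shows "\<exists>c. (\<forall>x\<in>hcarrier G. Y (X x) = complex_of_real c *\<^sub>C x) \<and>
    (\<forall>y\<in>hcarrier K. X (Y y) = complex_of_real c *\<^sub>C y) \<and>
    (c \<noteq> 0 \<longrightarrow> unitarily_equivalent G S K R)"
proof -
  interpret G: hilbert_space G using cowen_douglas_hilbert[OF G(1)] .
  interpret K: hilbert_space K using cowen_douglas_hilbert[OF K(1)] .
  note XD = linear_operatorD[OF X] and YD = linear_operatorD[OF Y]
  have adj': "hinner G (Y y) x = hinner K y (X x)" if xy: "y \<in> hcarrier K" "x \<in> hcarrier G" for x y
    using adj[OF xy(2,1)] G.inner_commute[of "Y y" x] K.inner_commute[of y "X x"] XD(1) YD(1) xy by simp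
  obtain c where c: "c \<ge> 0" "\<And>x. x \<in> hcarrier G \<Longrightarrow> Y (X x) = complex_of_real c *\<^sub>C x"
    using schur_scalar[OF G \<Omega> K.hilbert_space_axioms X Y adj XS YR] by metis
  obtain c' where c': "c' \<ge> 0" "\<And>y. y \<in> hcarrier K \<Longrightarrow> X (Y y) = complex_of_real c' *\<^sub>C y"
    using schur_scalar[OF K \<Omega> G.hilbert_space_axioms Y X adj' YR XS] by metis
  show ?thesis
  proof (cases "\<forall>x\<in>hcarrier G. X x = 0")
    case True
    have Y0: "Y y = 0" if y: "y \<in> hcarrier K" for y
      using adj[OF YD(1)[OF y] y] True YD(1)[OF y] y G.inner_definite by simp
    show ?thesis
      using True Y0 linear_operatorD G.linear_operator_zero[OF X] K.linear_operator_zero[OF Y]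
      by (intro exI[of _ 0]) simp
  next
    case False
    then obtain x where x: "x \<in> hcarrier G" "X x \<noteq> 0" by blast
    have "complex_of_real c *\<^sub>C X x = complex_of_real c' *\<^sub>C X x"
      using c(2)[OF x(1)] c'(2)[OF XD(1)[OF x(1)]] XD(3)[OF x(1)] by simp
    then have cc: "c' = c" using x(2) by simp
    have "unitarily_equivalent G S K R" if "c \<noteq> 0"
    proof -
      have c0: "c > 0" using that c(1) by simp
      let ?r = "complex_of_real (1 / sqrt c)"
      have rr: "?r * ?r = complex_of_real (1 / c)" using c0 by (simp flip: of_real_mult)
      define U where "U x = ?r *\<^sub>C X x" for x
      have "unitary_operator G K U"
      proof (rule unitary_operatorI)
        show lin: "linear_operator G K U"
          using XD by (simp add: linear_operator_def U_def scaleC_add_right complex_vector.scale_left_commute)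
        show "inj_on U (hcarrier G)"
        proof (rule inj_onI)
          fix x y assume xy: "x \<in> hcarrier G" "y \<in> hcarrier G" "U x = U y"
          then have "X x = X y" using c0 by (simp add: U_def)
          then have "complex_of_real c *\<^sub>C x = complex_of_real c *\<^sub>C y" using c(2) xy by metis
          then show "x = y" using c0 by simp
        qed
        show "\<exists>x\<in>hcarrier G. U x = y" if y: "y \<in> hcarrier K" for y
        proof
          show "?r *\<^sub>C Y y \<in> hcarrier G" using YD(1)[OF y] by simp
          have "U (?r *\<^sub>C Y y) = (?r * ?r * complex_of_real c) *\<^sub>C y"
            using XD(3)[OF YD(1)[OF y], of ?r] c'(2)[OF y] cc by (simp add: U_def scaleC_scaleC)
          also have "?r * ?r * complex_of_real c = 1" unfolding rr using c0 by simp
          finally show "U (?r *\<^sub>C Y y) = y" by (simp add: scaleC_one)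
        qed
        fix x y assume xy: "x \<in> hcarrier G" "y \<in> hcarrier G"
        have "hinner K (U x) (U y) = ?r * ?r * hinner K (X x) (X y)"
          using xy XD(1) by (simp add: U_def K.inner_scale_left K.inner_scale_right)
        also have "hinner K (X x) (X y) = hinner G x (complex_of_real c *\<^sub>C y)"
          using adj xy XD(1) c(2) by simp
        also have "\<dots> = complex_of_real c * hinner G x y" using xy by (simp add: G.inner_scale_right)
        finally show "hinner K (U x) (U y) = hinner G x y" unfolding rr using c0 by simp
      qed
      moreover have "U (S x) = R (U x)" if "x \<in> hcarrier G" for x
        using XS[OF that] linear_operatorD(3)[OF cowen_douglas_linear[OF K(1)] XD(1)[OF that], of ?r]
        by (simp add: U_def)
      ultimately show ?thesis unfolding unitarily_equivalent_def by blast
    qed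
    then show ?thesis using c(2) c'(2) cc by (intro exI[of _ c]) simp
  qed
qed

section \<open>Uniqueness of the decomposition\<close>

definition block_embed :: "nat \<times> nat \<Rightarrow> 'a::zero \<Rightarrow> nat \<Rightarrow> nat \<Rightarrow> 'a"
  where "block_embed p x = (\<lambda>i k. if (i, k) = p then x else 0)"

lemma subspace_block_sum:
  assumes "\<And>i k. (i, k) \<in> J \<Longrightarrow> hilbert_space (G i)"
  shows "complex_vector.subspace (hcarrier (block_sum J G))"
proof (rule complex_vector.subspaceI)
  note sub = hilbert_space.subspace_carrier[OF assms]
  show "0 \<in> hcarrier (block_sum J G)"
    using complex_vector.subspace_0[OF sub] by (intro block_sumI) auto
  show "f + g \<in> hcarrier (block_sum J G)"
    if fg: "f \<in> hcarrier (block_sum J G)" "g \<in> hcarrier (block_sum J G)" for f g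
    using complex_vector.subspace_add[OF sub] block_sumD[OF fg(1)] block_sumD[OF fg(2)]
    by (intro block_sumI) auto
  show "c *\<^sub>C f \<in> hcarrier (block_sum J G)" if f: "f \<in> hcarrier (block_sum J G)" for c f
    using complex_vector.subspace_scale[OF sub] block_sumD[OF f]
    by (intro block_sumI) (auto simp: scaleC_fun_def)
qed

locale block_family =
  fixes J :: "(nat \<times> nat) set" and G :: "nat \<Rightarrow> 'a::complex_vector hilbert"
  assumes finite_J: "finite J" and hilbert: "p \<in> J \<Longrightarrow> hilbert_space (G (fst p))"
begin

lemma embed_mem:
  assumes "p \<in> J" "x \<in> hcarrier (G (fst p))"
  shows "block_embed p x \<in> hcarrier (block_sum J G)"
proof (rule block_sumI)
  fix i k assume ik: "(i, k) \<in> J"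
  have "0 \<in> hcarrier (G i)" using hilbert[OF ik] hilbert_space.zero_mem by auto
  then show "block_embed p x i k \<in> hcarrier (G i)" using assms(2) by (auto simp: block_embed_def)
next
  fix i k assume "(i, k) \<notin> J"
  then show "block_embed p x i k = 0" using assms(1) by (auto simp: block_embed_def)
qed

lemma inner_embed:
  assumes p: "p \<in> J" and x: "x \<in> hcarrier (G (fst p))" and f: "f \<in> hcarrier (block_sum J G)"
  shows "hinner (block_sum J G) (block_embed p x) f = hinner (G (fst p)) x (f (fst p) (snd p))"
    and "hinner (block_sum J G) f (block_embed p x) = hinner (G (fst p)) (f (fst p) (snd p)) x"
proof -
  have z: "hinner (G (fst q)) (block_embed p x (fst q) (snd q)) (f (fst q) (snd q)) = 0 \<and>
      hinner (G (fst q)) (f (fst q) (snd q)) (block_embed p x (fst q) (snd q)) = 0"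
    if "q \<in> J" "q \<noteq> p" for q
  proof -
    interpret hilbert_space "G (fst q)" by (rule hilbert[OF that(1)])
    have "f (fst q) (snd q) \<in> hcarrier (G (fst q))" using block_sumD(1)[OF f] that(1) by simp
    then show ?thesis using that(2) by (simp add: block_embed_def)
  qed
  show "hinner (block_sum J G) (block_embed p x) f = hinner (G (fst p)) x (f (fst p) (snd p))"
    unfolding block_sum_inner case_prod_beta
    using z by (subst sum.remove[OF finite_J p]) (simp add: block_embed_def sum.neutral)
  show "hinner (block_sum J G) f (block_embed p x) = hinner (G (fst p)) (f (fst p) (snd p)) x"
    unfolding block_sum_inner case_prod_beta
    using z by (subst sum.remove[OF finite_J p]) (simp add: block_embed_def sum.neutral)
qed

lemma embed_operator:
  assumes p: "p \<in> J" and S: "\<And>q. q \<in> J \<Longrightarrow> linear_operator (G (fst q)) (G (fst q)) (S (fst q))"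
  shows "block_operator J S (block_embed p x) = block_embed p (S (fst p) x)"
proof -
  have "S i 0 = 0" if "(i, k) \<in> J" for i k
    using hilbert_space.linear_operator_zero[OF hilbert[OF that] S[OF that]] by simp
  then show ?thesis using p by (auto simp: block_operator_def block_embed_def fun_eq_iff)
qed

lemma norm_column:
  assumes \<Phi>: "unitary_operator (block_sum J G) (block_sum J' G') \<Phi>"
    and p: "p \<in> J" and x: "x \<in> hcarrier (G (fst p))"
  shows "(\<Sum>q\<in>J'. hinner (G' (fst q)) (\<Phi> (block_embed p x) (fst q) (snd q)) (\<Phi> (block_embed p x) (fst q) (snd q)))
    = hinner (G (fst p)) x x"
proof -
  have "hinner (block_sum J' G') (\<Phi> (block_embed p x)) (\<Phi> (block_embed p x)) = hinner (G (fst p)) x x"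
    using unitary_operatorD(4)[OF \<Phi> embed_mem[OF p x] embed_mem[OF p x]]
      inner_embed(1)[OF p x embed_mem[OF p x]] by (simp add: block_embed_def)
  then show ?thesis by (simp add: block_sum_inner case_prod_beta)
qed

lemma linear_entry:
  assumes \<Phi>: "linear_operator (block_sum J G) (block_sum J' G') \<Phi>" and p: "p \<in> J" and q: "q \<in> J'"
  shows "linear_operator (G (fst p)) (G' (fst q)) (\<lambda>x. \<Phi> (block_embed p x) (fst q) (snd q))"
proof -
  note D = linear_operatorD[OF \<Phi>]
  have "block_embed p (x + y) = block_embed p x + block_embed p y" for x y :: 'a
    by (auto simp: block_embed_def fun_eq_iff)
  moreover have "block_embed p (c *\<^sub>C x) = c *\<^sub>C block_embed p x" for c and x :: 'a
    by (auto simp: block_embed_def fun_eq_iff scaleC_fun_def)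
  ultimately show ?thesis
    using D(2,3) embed_mem[OF p] block_sumD(1)[OF D(1)[OF embed_mem[OF p]], of _ "fst q" "snd q"] q
    by (simp add: linear_operator_def scaleC_fun_def)
qed

end

text \<open>
  Schur's lemma applied to the entries \<open>X p q\<close> of a unitary between two orthogonal sums. The entry \<open>Y p q\<close>
  of the inverse is the adjoint of \<open>X p q\<close>. A vector \<open>x\<close> of block \<open>p\<close> is mapped to components
  \<open>X p q x\<close> with squared norms \<open>c p q\<close> times that of \<open>x\<close>, and they add up to the squared norm of \<open>x\<close>; this
  gives the row sums, and the inverse gives the column sums.
\<close>

lemma block_matrix:
  fixes G :: "nat \<Rightarrow> 'a::complex_vector hilbert" and G' :: "nat \<Rightarrow> 'b::complex_vector hilbert"
  assumes \<Omega>: "\<Omega> \<noteq> {}" and fin: "finite J" "finite J'"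
    and G: "\<And>p. p \<in> J \<Longrightarrow> cowen_douglas \<Omega> (d (fst p)) (G (fst p)) (S (fst p)) \<and>
        irreducible_operator (G (fst p)) (S (fst p))"
    and G': "\<And>q. q \<in> J' \<Longrightarrow> cowen_douglas \<Omega> (h (fst q)) (G' (fst q)) (S' (fst q)) \<and>
        irreducible_operator (G' (fst q)) (S' (fst q))"
    and eq: "unitarily_equivalent (block_sum J G) (block_operator J S) (block_sum J' G') (block_operator J' S')"
  obtains c :: "nat \<times> nat \<Rightarrow> nat \<times> nat \<Rightarrow> real"
  where "\<And>p. p \<in> J \<Longrightarrow> (\<Sum>q\<in>J'. c p q) = 1" "\<And>q. q \<in> J' \<Longrightarrow> (\<Sum>p\<in>J. c p q) = 1"
    "\<And>p q. \<lbrakk>p \<in> J; q \<in> J'; c p q \<noteq> 0\<rbrakk> \<Longrightarrow>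
      unitarily_equivalent (G (fst p)) (S (fst p)) (G' (fst q)) (S' (fst q))"
proof -
  note CD = conjunct1[OF G] and CD' = conjunct1[OF G']
  interpret B: block_family J G by (rule block_family.intro) (rule fin(1), rule cowen_douglas_hilbert[OF CD])
  interpret B': block_family J' G' by (rule block_family.intro) (rule fin(2), rule cowen_douglas_hilbert[OF CD'])
  note linS = cowen_douglas_linear[OF CD] and linS' = cowen_douglas_linear[OF CD']
  let ?K = "block_sum J G" and ?K' = "block_sum J' G'"
  obtain \<Phi> where \<Phi>: "unitary_operator ?K ?K' \<Phi>"
    "\<And>f. f \<in> hcarrier ?K \<Longrightarrow> \<Phi> (block_operator J S f) = block_operator J' S' (\<Phi> f)"
    using eq unfolding unitarily_equivalent_def by blast
  have sub: "complex_vector.subspace (hcarrier ?K)"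
    by (rule subspace_block_sum) (use B.hilbert in fastforce)
  define \<Psi> where "\<Psi> = inv_into (hcarrier ?K) \<Phi>"
  note \<Psi> = unitary_operator_inverse[OF sub \<Phi>(1), folded \<Psi>_def]
  have \<Psi>S: "\<Psi> (block_operator J' S' g) = block_operator J S (\<Psi> g)" if g: "g \<in> hcarrier ?K'" for g
  proof -
    have \<Psi>g: "\<Psi> g \<in> hcarrier ?K" using unitary_operatorD(5)[OF \<Psi>(1) g] .
    have "block_operator J S (\<Psi> g) \<in> hcarrier ?K"
    proof (rule block_sumI)
      fix i k assume ik: "(i, k) \<in> J"
      then show "block_operator J S (\<Psi> g) i k \<in> hcarrier (G i)"
        using linear_operatorD(1)[OF linS[OF ik]] block_sumD(1)[OF \<Psi>g ik] by (simp add: block_operator_def)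
    qed (simp add: block_operator_def)
    then show ?thesis using \<Phi>(2)[OF \<Psi>g] \<Psi>(2,3) g by metis
  qed
  define X where "X p q x = \<Phi> (block_embed p x) (fst q) (snd q)" for p q x
  define Y where "Y p q y = \<Psi> (block_embed q y) (fst p) (snd p)" for p q y
  have ex: "\<exists>c. (\<forall>x\<in>hcarrier (G (fst p)). Y p q (X p q x) = complex_of_real c *\<^sub>C x) \<and>
    (\<forall>y\<in>hcarrier (G' (fst q)). X p q (Y p q y) = complex_of_real c *\<^sub>C y) \<and>
    (c \<noteq> 0 \<longrightarrow> unitarily_equivalent (G (fst p)) (S (fst p)) (G' (fst q)) (S' (fst q)))"
    and adj: "\<And>x y. \<lbrakk>x \<in> hcarrier (G (fst p)); y \<in> hcarrier (G' (fst q))\<rbrakk> \<Longrightarrow>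
      hinner (G' (fst q)) (X p q x) y = hinner (G (fst p)) x (Y p q y)"
    and mem: "\<And>x. x \<in> hcarrier (G (fst p)) \<Longrightarrow> X p q x \<in> hcarrier (G' (fst q))"
      "\<And>y. y \<in> hcarrier (G' (fst q)) \<Longrightarrow> Y p q y \<in> hcarrier (G (fst p))"
    if p: "p \<in> J" and q: "q \<in> J'" for p q
  proof -
    have linX: "linear_operator (G (fst p)) (G' (fst q)) (X p q)"
      unfolding X_def by (rule B.linear_entry[OF unitary_operatorD(1)[OF \<Phi>(1)] p q])
    have linY: "linear_operator (G' (fst q)) (G (fst p)) (Y p q)"
      unfolding Y_def by (rule B'.linear_entry[OF unitary_operatorD(1)[OF \<Psi>(1)] q p])
    show mem: "\<And>x. x \<in> hcarrier (G (fst p)) \<Longrightarrow> X p q x \<in> hcarrier (G' (fst q))"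
      "\<And>y. y \<in> hcarrier (G' (fst q)) \<Longrightarrow> Y p q y \<in> hcarrier (G (fst p))"
      using linear_operatorD(1)[OF linX] linear_operatorD(1)[OF linY] by auto
    show adj: "hinner (G' (fst q)) (X p q x) y = hinner (G (fst p)) x (Y p q y)"
      if x: "x \<in> hcarrier (G (fst p))" and y: "y \<in> hcarrier (G' (fst q))" for x y
    proof -
      note ex = B.embed_mem[OF p x] and ey = B'.embed_mem[OF q y]
      have "hinner (G' (fst q)) (X p q x) y = hinner ?K' (\<Phi> (block_embed p x)) (block_embed q y)"
        unfolding X_def using B'.inner_embed(2)[OF q y unitary_operatorD(5)[OF \<Phi>(1) ex]] by simp
      also have "\<dots> = hinner ?K' (\<Phi> (block_embed p x)) (\<Phi> (\<Psi> (block_embed q y)))"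
        using \<Psi>(3)[OF ey] by simp
      also have "\<dots> = hinner ?K (block_embed p x) (\<Psi> (block_embed q y))"
        using unitary_operatorD(4)[OF \<Phi>(1) ex unitary_operatorD(5)[OF \<Psi>(1) ey]] .
      also have "\<dots> = hinner (G (fst p)) x (Y p q y)"
        unfolding Y_def using B.inner_embed(1)[OF p x unitary_operatorD(5)[OF \<Psi>(1) ey]] .
      finally show ?thesis .
    qed
    have XS: "X p q (S (fst p) x) = S' (fst q) (X p q x)" if x: "x \<in> hcarrier (G (fst p))" for x
      using B.embed_operator[where S = S and x = x, OF p linS] \<Phi>(2)[OF B.embed_mem[OF p x]] q
      by (simp add: X_def block_operator_def)
    have YS: "Y p q (S' (fst q) y) = S (fst p) (Y p q y)" if y: "y \<in> hcarrier (G' (fst q))" for y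
      using B'.embed_operator[where S = S' and x = y, OF q linS'] \<Psi>S[OF B'.embed_mem[OF q y]] p
      by (simp add: Y_def block_operator_def)
    show "\<exists>c. (\<forall>x\<in>hcarrier (G (fst p)). Y p q (X p q x) = complex_of_real c *\<^sub>C x) \<and>
      (\<forall>y\<in>hcarrier (G' (fst q)). X p q (Y p q y) = complex_of_real c *\<^sub>C y) \<and>
      (c \<noteq> 0 \<longrightarrow> unitarily_equivalent (G (fst p)) (S (fst p)) (G' (fst q)) (S' (fst q)))"
      by (rule schur_intertwiner[OF CD[OF p] conjunct2[OF G[OF p]] CD'[OF q] conjunct2[OF G'[OF q]] \<Omega> linX linY])
        (rule adj XS YS; assumption)+
  qed
  define c where "c p q = (SOME c. (\<forall>x\<in>hcarrier (G (fst p)). Y p q (X p q x) = complex_of_real c *\<^sub>C x) \<and>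
    (\<forall>y\<in>hcarrier (G' (fst q)). X p q (Y p q y) = complex_of_real c *\<^sub>C y) \<and>
    (c \<noteq> 0 \<longrightarrow> unitarily_equivalent (G (fst p)) (S (fst p)) (G' (fst q)) (S' (fst q))))" for p q
  have c: "\<And>x. x \<in> hcarrier (G (fst p)) \<Longrightarrow> Y p q (X p q x) = complex_of_real (c p q) *\<^sub>C x"
    "\<And>y. y \<in> hcarrier (G' (fst q)) \<Longrightarrow> X p q (Y p q y) = complex_of_real (c p q) *\<^sub>C y"
    "c p q \<noteq> 0 \<Longrightarrow> unitarily_equivalent (G (fst p)) (S (fst p)) (G' (fst q)) (S' (fst q))"
    if "p \<in> J" "q \<in> J'" for p q
    using someI_ex[OF ex[OF that]] unfolding c_def by blast+
  have nonzero: "\<exists>x\<in>hcarrier L. hinner L x x \<noteq> 0" if L: "cowen_douglas \<Omega> r L R" for r R and L :: "'z::complex_vector hilbert"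
  proof (rule ccontr)
    assume "\<not> ?thesis"
    then have "hcarrier L \<subseteq> {0}" using hilbert_space.inner_definite[OF cowen_douglas_hilbert[OF L]] by blast
    moreover obtain \<mu> where "\<mu> \<in> \<Omega>" using \<Omega> by blast
    then obtain x where "x \<in> eigenspace L R \<mu>" "x \<noteq> 0" using cowen_douglas_eigenvector[OF L] by blast
    ultimately show False unfolding eigenspace_def by blast
  qed
  show thesis
  proof (rule that[of c])
    fix p assume p: "p \<in> J"
    interpret hilbert_space "G (fst p)" by (rule B.hilbert[OF p])
    obtain x where x: "x \<in> hcarrier (G (fst p))" "hinner (G (fst p)) x x \<noteq> 0"
      using nonzero G[OF p] by blast
    have "hinner (G (fst p)) x x = (\<Sum>q\<in>J'. hinner (G' (fst q)) (X p q x) (X p q x))"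
      unfolding X_def by (rule B.norm_column[OF \<Phi>(1) p x(1), symmetric])
    also have "\<dots> = (\<Sum>q\<in>J'. complex_of_real (c p q) * hinner (G (fst p)) x x)"
    proof (rule sum.cong[OF refl])
      fix q assume q: "q \<in> J'"
      show "hinner (G' (fst q)) (X p q x) (X p q x) = complex_of_real (c p q) * hinner (G (fst p)) x x"
        using adj[OF p q x(1) mem(1)[OF p q x(1)]] c(1)[OF p q x(1)] x(1) by (simp add: inner_scale_right)
    qed
    also have "\<dots> = complex_of_real (\<Sum>q\<in>J'. c p q) * hinner (G (fst p)) x x"
      by (simp add: sum_distrib_right)
    finally have "complex_of_real (\<Sum>q\<in>J'. c p q) = 1" using x(2) by simp
    then show "(\<Sum>q\<in>J'. c p q) = 1" by (metis of_real_eq_1_iff)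
  next
    fix q assume q: "q \<in> J'"
    interpret hilbert_space "G' (fst q)" by (rule B'.hilbert[OF q])
    obtain y where y: "y \<in> hcarrier (G' (fst q))" "hinner (G' (fst q)) y y \<noteq> 0"
      using nonzero G'[OF q] by blast
    have "hinner (G' (fst q)) y y = (\<Sum>p\<in>J. hinner (G (fst p)) (Y p q y) (Y p q y))"
      unfolding Y_def by (rule B'.norm_column[OF \<Psi>(1) q y(1), symmetric])
    also have "\<dots> = (\<Sum>p\<in>J. complex_of_real (c p q) * hinner (G' (fst q)) y y)"
    proof (rule sum.cong[OF refl])
      fix p assume p: "p \<in> J"
      show "hinner (G (fst p)) (Y p q y) (Y p q y) = complex_of_real (c p q) * hinner (G' (fst q)) y y"
        using adj[OF p q mem(2)[OF p q y(1)] y(1)] c(2)[OF p q y(1)] y(1) by (simp add: inner_scale_left)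
    qed
    also have "\<dots> = complex_of_real (\<Sum>p\<in>J. c p q) * hinner (G' (fst q)) y y"
      by (simp add: sum_distrib_right)
    finally have "complex_of_real (\<Sum>p\<in>J. c p q) = 1" using y(2) by simp
    then show "(\<Sum>p\<in>J. c p q) = 1" by (metis of_real_eq_1_iff)
  next
    fix p q assume "p \<in> J" "q \<in> J'" "c p q \<noteq> 0"
    then show "unitarily_equivalent (G (fst p)) (S (fst p)) (G' (fst q)) (S' (fst q))" by (rule c(3))
  qed
qed

lemma sum_block:
  fixes f :: "nat \<times> nat \<Rightarrow> real"
  assumes "j \<in> {1..s}" "\<And>q. \<lbrakk>q \<in> blocks s l; fst q \<noteq> j\<rbrakk> \<Longrightarrow> f q = 0"
  shows "(\<Sum>q\<in>blocks s l. f q) = (\<Sum>k=1..l j. f (j, k))"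
proof -
  have "f q = 0" if "q \<in> blocks s l - Pair j ` {1..l j}" for q
    using that by (intro assms(2)) auto
  then have "(\<Sum>q\<in>blocks s l. f q) = (\<Sum>q\<in>Pair j ` {1..l j}. f q)"
    using assms(1) by (intro sum.mono_neutral_right) auto
  also have "\<dots> = (\<Sum>k=1..l j. f (j, k))" by (subst sum.reindex) (auto simp: inj_on_def)
  finally show ?thesis .
qed

text \<open>
  A row or column of sum 1 has a nonzero entry, so every type is related to one on the other side, and the
  relation is a bijection. For related types \<open>i\<close> and \<open>j\<close>, all of the weight of the \<open>m i\<close> rows of type \<open>i\<close> and of the \<open>l j\<close> columns of type \<open>j\<close> lies in the
  rectangle where they meet, so both \<open>m i\<close> and \<open>l j\<close> equal its total weight.
\<close>

lemma block_matching:
  fixes c :: "nat \<times> nat \<Rightarrow> nat \<times> nat \<Rightarrow> real"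
  assumes row: "\<And>p. p \<in> blocks t m \<Longrightarrow> (\<Sum>q\<in>blocks s l. c p q) = 1"
    and col: "\<And>q. q \<in> blocks s l \<Longrightarrow> (\<Sum>p\<in>blocks t m. c p q) = 1"
    and R: "\<And>p q. \<lbrakk>p \<in> blocks t m; q \<in> blocks s l; c p q \<noteq> 0\<rbrakk> \<Longrightarrow> R (fst p) (fst q)"
    and pos: "\<And>i. i \<in> {1..t} \<Longrightarrow> m i > 0" "\<And>j. j \<in> {1..s} \<Longrightarrow> l j > 0"
    and uniq: "\<And>i j j'. \<lbrakk>i \<in> {1..t}; j \<in> {1..s}; j' \<in> {1..s}; R i j; R i j'\<rbrakk> \<Longrightarrow> j = j'"
      "\<And>i i' j. \<lbrakk>i \<in> {1..t}; i' \<in> {1..t}; j \<in> {1..s}; R i j; R i' j\<rbrakk> \<Longrightarrow> i = i'"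
  shows "t = s \<and> (\<exists>\<pi>. \<pi> permutes {1..t} \<and> (\<forall>i\<in>{1..t}. R i (\<pi> i) \<and> m i = l (\<pi> i)))"
proof -
  have ex: "\<exists>j\<in>{1..s}. R i j" if i: "i \<in> {1..t}" for i
  proof -
    have p: "(i, 1) \<in> blocks t m" using i pos(1)[OF i] by auto
    then obtain q where q: "q \<in> blocks s l" "c (i, 1) q \<noteq> 0"
      using row[OF p] by (metis sum.neutral zero_neq_one)
    have "R i (fst q)" using R[OF p q] by simp
    moreover have "fst q \<in> {1..s}" using q(1) by auto
    ultimately show ?thesis by blast
  qed
  have ex': "\<exists>i\<in>{1..t}. R i j" if j: "j \<in> {1..s}" for j
  proof -
    have q: "(j, 1) \<in> blocks s l" using j pos(2)[OF j] by auto
    then obtain p where p: "p \<in> blocks t m" "c p (j, 1) \<noteq> 0"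
      using col[OF q] by (metis (no_types, lifting) sum.neutral zero_neq_one)
    have "R (fst p) j" using R[OF p(1) q p(2)] by simp
    moreover have "fst p \<in> {1..t}" using p(1) by auto
    ultimately show ?thesis by blast
  qed
  have mult: "m i = l j" if i: "i \<in> {1..t}" and j: "j \<in> {1..s}" and ij: "R i j" for i j
  proof -
    have "real (m i) = (\<Sum>k=1..m i. \<Sum>q\<in>blocks s l. c (i, k) q)"
      using row i by simp
    also have "\<dots> = (\<Sum>k=1..m i. \<Sum>k'=1..l j. c (i, k) (j, k'))"
    proof (intro sum.cong refl sum_block j)
      fix k q assume kq: "k \<in> {1..m i}" "q \<in> blocks s l" "fst q \<noteq> j"
      have p: "(i, k) \<in> blocks t m" using i kq(1) by simp
      show "c (i, k) q = 0"
      proof (rule ccontr)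
        assume "c (i, k) q \<noteq> 0"
        then have "R i (fst q)" using R[OF p kq(2)] by simp
        then show False using uniq(1)[OF i _ j _ ij, of "fst q"] kq(2,3) by auto
      qed
    qed
    also have "\<dots> = (\<Sum>k'=1..l j. \<Sum>k=1..m i. c (i, k) (j, k'))" by (rule sum.swap)
    also have "\<dots> = (\<Sum>k'=1..l j. \<Sum>p\<in>blocks t m. c p (j, k'))"
    proof (intro sum.cong refl sum_block[symmetric] i)
      fix k' p assume kp: "k' \<in> {1..l j}" "p \<in> blocks t m" "fst p \<noteq> i"
      have q: "(j, k') \<in> blocks s l" using j kp(1) by simp
      show "c p (j, k') = 0"
      proof (rule ccontr)
        assume "c p (j, k') \<noteq> 0"
        then have "R (fst p) j" using R[OF kp(2) q] by simp
        then show False using uniq(2)[OF _ i j _ ij, of "fst p"] kp(2,3) by auto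
      qed
    qed
    also have "\<dots> = real (l j)" using col j by simp
    finally show ?thesis by simp
  qed
  have "\<forall>i. \<exists>j. i \<in> {1..t} \<longrightarrow> j \<in> {1..s} \<and> R i j" using ex by blast
  then obtain f where f: "\<And>i. i \<in> {1..t} \<Longrightarrow> f i \<in> {1..s} \<and> R i (f i)" by metis
  have bij: "bij_betw f {1..t} {1..s}"
    unfolding bij_betw_def
  proof
    show "inj_on f {1..t}"
    proof (rule inj_onI)
      fix i i' assume "i \<in> {1..t}" "i' \<in> {1..t}" "f i = f i'"
      then show "i = i'" using uniq(2)[of i i' "f i"] f[of i] f[of i'] by auto
    qed
    show "f ` {1..t} = {1..s}"
    proof
      show "f ` {1..t} \<subseteq> {1..s}" using f by blast
      show "{1..s} \<subseteq> f ` {1..t}"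
      proof
        fix j assume j: "j \<in> {1..s}"
        then obtain i where i: "i \<in> {1..t}" "R i j" using ex' by blast
        then have "f i = j" using uniq(1)[of i "f i" j] f[OF i(1)] j by blast
        then show "j \<in> f ` {1..t}" using i(1) by blast
      qed
    qed
  qed
  then have ts: "t = s" using bij_betw_same_card by fastforce
  define \<pi> where "\<pi> i = (if i \<in> {1..t} then f i else i)" for i
  have "bij_betw \<pi> {1..t} {1..t}"
    using bij ts by (subst bij_betw_cong[of _ \<pi> f]) (auto simp: \<pi>_def)
  then have "\<pi> permutes {1..t}" by (rule bij_imp_permutes) (simp only: \<pi>_def if_False)
  moreover have "R i (\<pi> i) \<and> m i = l (\<pi> i)" if "i \<in> {1..t}" for i
    using f[OF that] mult[OF that] that by (simp add: \<pi>_def)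
  ultimately show ?thesis using ts by blast
qed

lemma IR_decomposition_unique:
  fixes G :: "nat \<Rightarrow> 'b::complex_vector hilbert" and G' :: "nat \<Rightarrow> 'd::complex_vector hilbert"
  assumes \<Omega>: "\<Omega> \<noteq> {}" and H: "hilbert_space H" "linear_operator H H T"
    and IR: "IR_decomposition \<Omega> n H T t G S m d" and eq: "unitarily_equivalent H T H' T'"
    and IR': "IR_decomposition \<Omega> n' H' T' s G' S' l h"
  shows "t = s \<and> (\<exists>\<pi>. \<pi> permutes {1..t} \<and>
    (\<forall>i\<in>{1..t}. unitarily_equivalent (G i) (S i) (G' (\<pi> i)) (S' (\<pi> i)) \<and> m i = l (\<pi> i)))"
proof -
  note D = IR[unfolded IR_decomposition_blocks] and D' = IR'[unfolded IR_decomposition_blocks]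
  have G: "m i > 0" "cowen_douglas \<Omega> (d i) (G i) (S i)" "irreducible_operator (G i) (S i)"
    if "i \<in> {1..t}" for i using D that by blast+
  have G': "l j > 0" "cowen_douglas \<Omega> (h j) (G' j) (S' j)" "irreducible_operator (G' j) (S' j)"
    if "j \<in> {1..s}" for j using D' that by blast+
  have sym: "unitarily_equivalent (G' j) (S' j) (G i) (S i)"
    if "i \<in> {1..t}" "unitarily_equivalent (G i) (S i) (G' j) (S' j)" for i j
    using unitarily_equivalent_sym[OF cowen_douglas_hilbert cowen_douglas_linear that(2)] G(2)[OF that(1)] by blast
  have "unitarily_equivalent (block_sum (blocks t m) G) (block_operator (blocks t m) S) H T"
    using unitarily_equivalent_sym[OF H] D by blast
  then have "unitarily_equivalent (block_sum (blocks t m) G) (block_operator (blocks t m) S) H' T'"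
    using eq by (rule unitarily_equivalent_trans)
  then have eqv: "unitarily_equivalent (block_sum (blocks t m) G) (block_operator (blocks t m) S)
      (block_sum (blocks s l) G') (block_operator (blocks s l) S')"
    using D' by (blast intro: unitarily_equivalent_trans)
  obtain c :: "nat \<times> nat \<Rightarrow> nat \<times> nat \<Rightarrow> real" where
    c: "\<And>p. p \<in> blocks t m \<Longrightarrow> (\<Sum>q\<in>blocks s l. c p q) = 1"
      "\<And>q. q \<in> blocks s l \<Longrightarrow> (\<Sum>p\<in>blocks t m. c p q) = 1"
      "\<And>p q. \<lbrakk>p \<in> blocks t m; q \<in> blocks s l; c p q \<noteq> 0\<rbrakk> \<Longrightarrow>
        unitarily_equivalent (G (fst p)) (S (fst p)) (G' (fst q)) (S' (fst q))"
  proof (rule block_matrix[OF \<Omega> _ _ _ _ eqv])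
    show "cowen_douglas \<Omega> (d (fst p)) (G (fst p)) (S (fst p)) \<and> irreducible_operator (G (fst p)) (S (fst p))"
      if "p \<in> blocks t m" for p using that G by auto
    show "cowen_douglas \<Omega> (h (fst q)) (G' (fst q)) (S' (fst q)) \<and> irreducible_operator (G' (fst q)) (S' (fst q))"
      if "q \<in> blocks s l" for q using that G' by auto
  qed auto
  show ?thesis
  proof (rule block_matching[OF c(1,2), where R = "\<lambda>i j. unitarily_equivalent (G i) (S i) (G' j) (S' j)"])
    fix i j j' assume "i \<in> {1..t}" "j \<in> {1..s}" "j' \<in> {1..s}"
      "unitarily_equivalent (G i) (S i) (G' j) (S' j)" "unitarily_equivalent (G i) (S i) (G' j') (S' j')"
    then show "j = j'" using unitarily_equivalent_trans[OF sym] D' by blast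
  next
    fix i i' j assume "i \<in> {1..t}" "i' \<in> {1..t}" "j \<in> {1..s}"
      "unitarily_equivalent (G i) (S i) (G' j) (S' j)" "unitarily_equivalent (G i') (S i') (G' j) (S' j)"
    then show "i = i'" using unitarily_equivalent_trans[OF _ sym] D by blast
  qed (use c(3) G(1) G'(1) in auto)
qed

theorem theorem4p2:
  fixes \<Omega> :: "complex set" and n :: nat
    and H :: "'a::complex_vector hilbert" and T :: "'a \<Rightarrow> 'a"
  assumes "open \<Omega>" and "connected \<Omega>" and "\<Omega> \<noteq> {}"
    and "cowen_douglas \<Omega> n H T"
  shows "(\<exists>t (G :: nat \<Rightarrow> 'a hilbert) S m d. IR_decomposition \<Omega> n H T t G S m d) \<and>
    (\<forall>t (G :: nat \<Rightarrow> 'b::complex_vector hilbert) S m d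
      (H' :: 'c::complex_vector hilbert) T'
      s (G' :: nat \<Rightarrow> 'd::complex_vector hilbert) S' l h.
        IR_decomposition \<Omega> n H T t G S m d \<longrightarrow>
        hilbert_space H' \<longrightarrow> bounded_operator H' H' T' \<longrightarrow>
        unitarily_equivalent H T H' T' \<longrightarrow>
        IR_decomposition \<Omega> n H' T' s G' S' l h \<longrightarrow>
        t = s \<and>
        (\<exists>\<pi>. \<pi> permutes {1..t} \<and>
          (\<forall>i\<in>{1..t}. unitarily_equivalent (G i) (S i) (G' (\<pi> i)) (S' (\<pi> i)) \<and>
                       m i = l (\<pi> i))))"
  using IR_decomposition_exists[OF assms(2-4)]
    IR_decomposition_unique[OF assms(3) cowen_douglas_hilbert[OF assms(4)] cowen_douglas_linear[OF assms(4)]]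
  by blast

end
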